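(* Let $(G,\theta)$ be a reductive symmetric pair with variety of reductions $\mathfrak{R}$. If $G$ is semi-simple, then every point $\mathfrak{u}$ belonging to a closed $K$-orbit of $\mathfrak{R}$ is (as a subspace of $\mathfrak{g}$) contained in the nilpotent cone of $\mathfrak{g}$.
   Context: All groups and varieties are over $\mathbb{C}$. A reductive symmetric pair $(G,\theta)$ consists of a reductive complex algebraic group $G$ and an involution $\theta$ of $G$; $K=(G^\theta)^\circ$; $\mathfrak{g}=\mathfrak{k}\oplus\mathfrak{p}$ is the decomposition of the Lie algebra of $G$ into $+1$ and $-1$ eigenspaces of the differential of $\theta$. A Cartan subspace of $\mathfrak{p}$ is a linear subspace of $\mathfrak{g}$ contained in $\mathfrak{p}$ and in some Cartan subalgebra of $\mathfrak{g}$, and maximal for inclusion among such subspaces. All Cartan subspaces are $K$-conjugate, of common dimension $r$, the rank of the pair. The variety of reductions $\mathfrak{R}$ is the closure, in the Grassmann variety $\mathrm{Gr}(r,\mathfrak{p})$, of the set of all Cartan subspaces; $K$ acts on it. *)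

theory Defs
  imports "HOL-Analysis.Analysis" "HOL-Algebra.Solvable_Groups" "HOL-Combinatorics.Permutations"
begin

text \<open>
  A reductive group is affine, so it is a Zariski closed subgroup of some
  \<open>GL\<^sub>n(\<complex>)\<close>, and its Lie algebra is a subalgebra of the algebra of all
  \<open>n \<times> n\<close> matrices.  All groups below are given in this form.  Beware that \<open>*\<close>, \<open>^\<close>,
  \<open>*s\<close> on the type of matrices act componentwise or rowwise; the matrix product is \<open>**\<close>.
\<close>

type_synonym 'n cmat = "complex ^ 'n ^ 'n"

definition cscale :: "complex \<Rightarrow> 'n::finite cmat \<Rightarrow> 'n cmat" (infixr "*\<^sub>C" 75)
  where "c *\<^sub>C A = (\<chi> i j. c * A $ i $ j)"

text \<open>Linear algebra over the complex numbers, as opposed to the real vector space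
  structure that the type of matrices carries in \<^theory>\<open>HOL-Analysis.Analysis\<close>.\<close>

global_interpretation cmat: vector_space "cscale :: complex \<Rightarrow> 'n::finite cmat \<Rightarrow> 'n cmat"
  by unfold_locales (simp_all add: cscale_def vec_eq_iff algebra_simps)


section \<open>Polynomial functions and the Zariski topology on the general linear group\<close>

inductive poly_fun :: "(('i \<Rightarrow> complex) \<Rightarrow> complex) \<Rightarrow> bool" where
  const: "poly_fun (\<lambda>_. c)"
| coord: "poly_fun (\<lambda>x. x i)"
| add: "poly_fun F \<Longrightarrow> poly_fun H \<Longrightarrow> poly_fun (\<lambda>x. F x + H x)"
| mult: "poly_fun F \<Longrightarrow> poly_fun H \<Longrightarrow> poly_fun (\<lambda>x. F x * H x)"

definition entries :: "'n::finite cmat \<Rightarrow> 'n \<times> 'n \<Rightarrow> complex"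
  where "entries A = (\<lambda>(i, j). A $ i $ j)"

definition GL :: "'n::finite cmat monoid"
  where "GL = \<lparr>carrier = {A. invertible A}, mult = (**), one = mat 1\<rparr>"

text \<open>The principal open sets form a basis of the Zariski topology.\<close>

definition zariski_GL :: "'n::finite cmat topology"
  where "zariski_GL =
    topology_generated_by {{A. invertible A \<and> F (entries A) \<noteq> 0} | F. poly_fun F}"

lemma openin_topology_generated_by_base:
  assumes "\<And>S T. S \<in> B \<Longrightarrow> T \<in> B \<Longrightarrow> S \<inter> T \<in> B"
  shows "openin (topology_generated_by B) U \<longleftrightarrow> (\<exists>C\<subseteq>B. U = \<Union>C)"
proof
  assume "openin (topology_generated_by B) U"
  then have "generate_topology_on B U" by (simp add: openin_topology_generated_by)
  then show "\<exists>C\<subseteq>B. U = \<Union>C"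
  proof induction
    case Empty then show ?case by (intro exI[of _ "{}"]) auto
  next
    case (Int a b)
    then obtain C D where "C \<subseteq> B" "a = \<Union>C" "D \<subseteq> B" "b = \<Union>D" by auto
    moreover from this have "(\<lambda>(S, T). S \<inter> T) ` (C \<times> D) \<subseteq> B"
      using assms by (auto dest!: subsetD)
    moreover have "\<Union>C \<inter> \<Union>D = \<Union>((\<lambda>(S, T). S \<inter> T) ` (C \<times> D))" by auto
    ultimately show ?case by (intro exI[of _ "(\<lambda>(S, T). S \<inter> T) ` (C \<times> D)"]) simp
  next
    case (UN K)
    then obtain c where c: "\<And>k. k \<in> K \<Longrightarrow> c k \<subseteq> B" "\<And>k. k \<in> K \<Longrightarrow> \<Union>(c k) = k"
      by metis
    have "\<Union>(c ` K) \<subseteq> B" using c(1) by blast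
    moreover have "\<Union>K = \<Union>(\<Union>(c ` K))"
    proof -
      have "\<Union>(\<Union>(c ` K)) = (\<Union>k\<in>K. \<Union>(c k))" by blast
      also have "\<dots> = (\<Union>k\<in>K. k)" by (rule SUP_cong[OF refl c(2)])
      finally show ?thesis by simp
    qed
    ultimately show ?case by (intro exI[of _ "\<Union>(c ` K)"] conjI)
  next
    case (Basis s) then show ?case by (intro exI[of _ "{s}"]) auto
  qed
next
  assume "\<exists>C\<subseteq>B. U = \<Union>C"
  then obtain C where C: "C \<subseteq> B" "U = \<Union>C" by auto
  show "openin (topology_generated_by B) U"
    unfolding C(2) using C(1) by (intro openin_Union) (simp add: subset_iff topology_generated_by_Basis)
qed

lemma closedin_zariski_GL:
  "closedin zariski_GL Z \<longleftrightarrow>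
    (\<exists>S. (\<forall>F\<in>S. poly_fun F) \<and> Z = {A. invertible A \<and> (\<forall>F\<in>S. F (entries A) = 0)})"
proof -
  define D where "D F = {A :: 'a cmat. invertible A \<and> F (entries A) \<noteq> (0::complex)}" for F
  have D_iff: "A \<in> D F \<longleftrightarrow> invertible A \<and> F (entries A) \<noteq> 0" for A F
    by (simp add: D_def)
  have gen: "zariski_GL = topology_generated_by (D ` Collect poly_fun)"
    unfolding zariski_GL_def D_def by (rule arg_cong[where f = topology_generated_by]) auto
  have op: "openin zariski_GL U \<longleftrightarrow> (\<exists>C\<subseteq>D ` Collect poly_fun. U = \<Union>C)" for U
    unfolding gen
  proof (rule openin_topology_generated_by_base)
    fix S T assume "S \<in> D ` Collect poly_fun" "T \<in> D ` Collect poly_fun"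
    then obtain F H where FH: "poly_fun F" "poly_fun H" "S = D F" "T = D H" by auto
    have "S \<inter> T = D (\<lambda>x. F x * H x)" using FH(3,4) by (auto simp: D_iff)
    then show "S \<inter> T \<in> D ` Collect poly_fun"
      using poly_fun.mult[OF FH(1,2)] by simp
  qed
  have top: "topspace zariski_GL = {A :: 'a cmat. invertible A}"
  proof -
    have "D (\<lambda>_. 1) = {A. invertible A}" by (simp add: D_def)
    moreover have "D (\<lambda>_. 1) \<subseteq> \<Union>(D ` Collect poly_fun)"
      using poly_fun.const[of 1] by (intro Union_upper imageI CollectI)
    moreover have "\<Union>(D ` Collect poly_fun) \<subseteq> {A. invertible A}" by (auto simp: D_iff)
    ultimately show ?thesis unfolding gen topology_generated_by_topspace by auto
  qed
  have zeros: "{A. invertible A \<and> (\<forall>F\<in>S. F (entries A) = 0)} =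
      {A. invertible A} - \<Union>(D ` S)" for S
    by (auto simp: D_iff)
  show ?thesis
  proof
    assume Z: "closedin zariski_GL Z"
    then have "openin zariski_GL (topspace zariski_GL - Z)" by (simp add: closedin_def)
    then obtain C where C: "C \<subseteq> D ` Collect poly_fun" "topspace zariski_GL - Z = \<Union>C"
      by (auto simp: op)
    obtain S where S: "S \<subseteq> Collect poly_fun" "C = D ` S"
      using C(1) by (auto simp: subset_image_iff)
    have "Z = topspace zariski_GL - (topspace zariski_GL - Z)"
      using closedin_subset[OF Z] by (simp add: double_diff)
    also have "\<dots> = {A. invertible A} - \<Union>(D ` S)" unfolding C(2) unfolding S(2) top ..
    finally show "\<exists>S. (\<forall>F\<in>S. poly_fun F) \<and>
        Z = {A. invertible A \<and> (\<forall>F\<in>S. F (entries A) = 0)}"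
      unfolding zeros using S(1) by (intro exI[of _ S]) auto
  next
    assume "\<exists>S. (\<forall>F\<in>S. poly_fun F) \<and>
        Z = {A. invertible A \<and> (\<forall>F\<in>S. F (entries A) = 0)}"
    then obtain S where S: "\<forall>F\<in>S. poly_fun F" "Z = {A. invertible A} - \<Union>(D ` S)"
      unfolding zeros by auto
    have "openin zariski_GL (\<Union>(D ` S))"
      unfolding op using S(1) by (intro exI[of _ "D ` S"]) auto
    then show "closedin zariski_GL Z"
      unfolding S(2) top[symmetric] by (intro closedin_diff closedin_topspace)
  qed
qed

text \<open>The regular functions on \<open>GL\<^sub>n\<close> are the elements of \<open>\<complex>[x\<^sub>i\<^sub>j, 1/det]\<close>.\<close>

definition regular_GL :: "('n::finite cmat \<Rightarrow> complex) \<Rightarrow> bool"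
  where "regular_GL f \<longleftrightarrow>
    (\<exists>F k. poly_fun F \<and> (\<forall>A. invertible A \<longrightarrow> f A = F (entries A) / det A ^ k))"


section \<open>Linear algebraic groups\<close>

definition algebraic_group :: "'n::finite cmat set \<Rightarrow> bool"
  where "algebraic_group G \<longleftrightarrow> subgroup G GL \<and> closedin zariski_GL G"

definition nilpotent_mat :: "'n::finite cmat \<Rightarrow> bool"
  where "nilpotent_mat A \<longleftrightarrow> (\<exists>k. (((**) A) ^^ k) (mat 1) = 0)"

definition unipotent_group :: "'n::finite cmat set \<Rightarrow> bool"
  where "unipotent_group G \<longleftrightarrow> algebraic_group G \<and> (\<forall>g\<in>G. nilpotent_mat (g - mat 1))"

text \<open>Trivial unipotent radical, respectively trivial radical: the (unipotent) radical is the
  largest connected normal closed subgroup which is solvable (unipotent).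
  As usual, connectedness of the group itself is not part of either notion.\<close>

definition reductive_group :: "'n::finite cmat set \<Rightarrow> bool"
  where "reductive_group G \<longleftrightarrow> algebraic_group G \<and>
    (\<forall>N. algebraic_group N \<and> connectedin zariski_GL N \<and> N \<lhd> (GL\<lparr>carrier := G\<rparr>) \<and>
         unipotent_group N \<longrightarrow> N = {mat 1})"

definition semisimple_group :: "'n::finite cmat set \<Rightarrow> bool"
  where "semisimple_group G \<longleftrightarrow> algebraic_group G \<and>
    (\<forall>N. algebraic_group N \<and> connectedin zariski_GL N \<and> N \<lhd> (GL\<lparr>carrier := G\<rparr>) \<and>
         solvable (GL\<lparr>carrier := N\<rparr>) \<longrightarrow> N = {mat 1})"

definition identity_component :: "'n::finite cmat set \<Rightarrow> 'n cmat set"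
  where "identity_component G = connected_component_of_set (subtopology zariski_GL G) (mat 1)"

text \<open>The Zariski tangent space at the identity: the tangent vectors annihilated by the
  differentials of all polynomials vanishing on \<open>G\<close>.\<close>

definition lie_algebra :: "'n::finite cmat set \<Rightarrow> 'n cmat set"
  where "lie_algebra G =
    {X. \<forall>F. poly_fun F \<and> (\<forall>g\<in>G. F (entries g) = 0) \<longrightarrow>
        ((\<lambda>t. F (entries (mat 1 + t *\<^sub>C X))) has_field_derivative 0) (at 0)}"

text \<open>A morphism of varieties from the closed subset \<open>G\<close> of \<open>GL\<^sub>n\<close> to the space of matrices is
  the restriction of a regular map on \<open>GL\<^sub>n\<close>.  Its differential on the tangent space at the
  identity does not depend on the chosen extension.\<close>

definition regular_extension ::
    "'n::finite cmat set \<Rightarrow> ('n cmat \<Rightarrow> 'n cmat) \<Rightarrow> ('n cmat \<Rightarrow> 'n cmat) \<Rightarrow> bool"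
  where "regular_extension G \<phi> \<Phi> \<longleftrightarrow>
    (\<forall>i j. regular_GL (\<lambda>A. \<Phi> A $ i $ j)) \<and> (\<forall>g\<in>G. \<Phi> g = \<phi> g)"

definition differential ::
    "'n::finite cmat set \<Rightarrow> ('n cmat \<Rightarrow> 'n cmat) \<Rightarrow> 'n cmat \<Rightarrow> 'n cmat"
  where "differential G \<phi> X =
    (THE Y. \<forall>\<Phi>. regular_extension G \<phi> \<Phi> \<longrightarrow>
       (\<forall>i j. ((\<lambda>t. \<Phi> (mat 1 + t *\<^sub>C X) $ i $ j) has_field_derivative Y $ i $ j) (at 0)))"

definition algebraic_hom ::
    "'n::finite cmat set \<Rightarrow> 'n cmat set \<Rightarrow> ('n cmat \<Rightarrow> 'n cmat) \<Rightarrow> bool"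
  where "algebraic_hom G H \<phi> \<longleftrightarrow>
    \<phi> \<in> hom (GL\<lparr>carrier := G\<rparr>) (GL\<lparr>carrier := H\<rparr>) \<and> (\<exists>\<Phi>. regular_extension G \<phi> \<Phi>)"


section \<open>Cartan subalgebras and the nilpotent cone\<close>

definition bracket :: "'n::finite cmat \<Rightarrow> 'n cmat \<Rightarrow> 'n cmat"
  where "bracket X Y = X ** Y - Y ** X"

definition lie_subalgebra :: "'n::finite cmat set \<Rightarrow> 'n cmat set \<Rightarrow> bool"
  where "lie_subalgebra \<hh> \<gg> \<longleftrightarrow>
    \<hh> \<subseteq> \<gg> \<and> cmat.subspace \<hh> \<and> (\<forall>X\<in>\<hh>. \<forall>Y\<in>\<hh>. bracket X Y \<in> \<hh>)"

primrec lower_central_series :: "'n::finite cmat set \<Rightarrow> nat \<Rightarrow> 'n cmat set" where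
  "lower_central_series \<hh> 0 = \<hh>"
| "lower_central_series \<hh> (Suc k) =
     cmat.span {bracket X Y | X Y. X \<in> \<hh> \<and> Y \<in> lower_central_series \<hh> k}"

definition nilpotent_lie_algebra :: "'n::finite cmat set \<Rightarrow> bool"
  where "nilpotent_lie_algebra \<hh> \<longleftrightarrow> (\<exists>k. lower_central_series \<hh> k = {0})"

definition cartan_subalgebra :: "'n::finite cmat set \<Rightarrow> 'n cmat set \<Rightarrow> bool"
  where "cartan_subalgebra \<hh> \<gg> \<longleftrightarrow>
    lie_subalgebra \<hh> \<gg> \<and> nilpotent_lie_algebra \<hh> \<and>
    {X \<in> \<gg>. \<forall>Y\<in>\<hh>. bracket X Y \<in> \<hh>} = \<hh>"

text \<open>Nilpotency in the Lie algebra of a linear algebraic group is nilpotency of the matrix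
  (it does not depend on the embedding of the group).\<close>

definition nilpotent_cone :: "'n::finite cmat set \<Rightarrow> 'n cmat set"
  where "nilpotent_cone \<gg> = {X \<in> \<gg>. nilpotent_mat X}"


section \<open>Grassmann varieties\<close>

definition Gr :: "nat \<Rightarrow> 'n::finite cmat set \<Rightarrow> 'n cmat set set"
  where "Gr r V = {U. cmat.subspace U \<and> U \<subseteq> V \<and> cmat.dim U = r}"

definition is_basis :: "nat \<Rightarrow> (nat \<Rightarrow> 'n::finite cmat) \<Rightarrow> 'n cmat set \<Rightarrow> bool"
  where "is_basis r b U \<longleftrightarrow>
    inj_on b {..<r} \<and> cmat.independent (b ` {..<r}) \<and> cmat.span (b ` {..<r}) = U"

text \<open>The Pluecker coordinates: the \<open>r \<times> r\<close> minors of the family \<open>b\<^sub>0, \<dots>, b\<^sub>r\<^sub>-\<^sub>1\<close> of vectors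
  in \<open>\<complex>\<^bsup>n \<times> n\<^esup>\<close>.  The minor indexed by \<open>s\<close> uses the entries at the positions
  \<open>s 0, \<dots>, s (r - 1)\<close>.  All sequences of positions are allowed, not just increasing ones;
  the additional coordinates vanish or repeat others up to sign.\<close>

definition pluecker :: "nat \<Rightarrow> (nat \<Rightarrow> 'n::finite cmat) \<Rightarrow> (nat \<Rightarrow> 'n \<times> 'n) \<Rightarrow> complex"
  where "pluecker r b s =
    (\<Sum>\<sigma> | \<sigma> permutes {..<r}. of_int (sign \<sigma>) * (\<Prod>j<r. entries (b (\<sigma> j)) (s j)))"

definition homogeneous :: "nat \<Rightarrow> (('i \<Rightarrow> complex) \<Rightarrow> complex) \<Rightarrow> bool"
  where "homogeneous d F \<longleftrightarrow> (\<forall>c x. F (\<lambda>i. c * x i) = c ^ d * F x)"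

text \<open>The Zariski topology induced by the Pluecker embedding.  A change of basis multiplies all
  Pluecker coordinates by the same nonzero scalar, so the choice of \<open>b\<close> is irrelevant.\<close>

definition grassmannian :: "nat \<Rightarrow> 'n::finite cmat set \<Rightarrow> 'n cmat set topology"
  where "grassmannian r V = topology_generated_by
    {{U \<in> Gr r V. \<forall>b. is_basis r b U \<longrightarrow> F (pluecker r b) \<noteq> 0} |
       F. poly_fun F \<and> (\<exists>d. homogeneous d F)}"


section \<open>Symmetric pairs and the variety of reductions\<close>

definition reductive_symmetric_pair ::
    "'n::finite cmat set \<Rightarrow> ('n cmat \<Rightarrow> 'n cmat) \<Rightarrow> bool"
  where "reductive_symmetric_pair G \<theta> \<longleftrightarrow>
    reductive_group G \<and> algebraic_hom G G \<theta> \<and> (\<forall>g\<in>G. \<theta> (\<theta> g) = g)"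

definition symK :: "'n::finite cmat set \<Rightarrow> ('n cmat \<Rightarrow> 'n cmat) \<Rightarrow> 'n cmat set"
  where "symK G \<theta> = identity_component {g \<in> G. \<theta> g = g}"

definition sym_p :: "'n::finite cmat set \<Rightarrow> ('n cmat \<Rightarrow> 'n cmat) \<Rightarrow> 'n cmat set"
  where "sym_p G \<theta> = {X \<in> lie_algebra G. differential G \<theta> X = - X}"

definition pre_cartan_subspace ::
    "'n::finite cmat set \<Rightarrow> ('n cmat \<Rightarrow> 'n cmat) \<Rightarrow> 'n cmat set \<Rightarrow> bool"
  where "pre_cartan_subspace G \<theta> \<aa> \<longleftrightarrow> cmat.subspace \<aa> \<and> \<aa> \<subseteq> sym_p G \<theta> \<and>
    (\<exists>\<hh>. cartan_subalgebra \<hh> (lie_algebra G) \<and> \<aa> \<subseteq> \<hh>)"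

definition cartan_subspace ::
    "'n::finite cmat set \<Rightarrow> ('n cmat \<Rightarrow> 'n cmat) \<Rightarrow> 'n cmat set \<Rightarrow> bool"
  where "cartan_subspace G \<theta> \<aa> \<longleftrightarrow> pre_cartan_subspace G \<theta> \<aa> \<and>
    (\<forall>\<bb>. pre_cartan_subspace G \<theta> \<bb> \<and> \<aa> \<subseteq> \<bb> \<longrightarrow> \<bb> = \<aa>)"

text \<open>Well defined, since all Cartan subspaces are conjugate under \<^const>\<open>symK\<close>.\<close>

definition pair_rank :: "'n::finite cmat set \<Rightarrow> ('n cmat \<Rightarrow> 'n cmat) \<Rightarrow> nat"
  where "pair_rank G \<theta> = (THE r. \<exists>\<aa>. cartan_subspace G \<theta> \<aa> \<and> cmat.dim \<aa> = r)"

abbreviation pair_grassmannian ::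
    "'n::finite cmat set \<Rightarrow> ('n cmat \<Rightarrow> 'n cmat) \<Rightarrow> 'n cmat set topology"
  where "pair_grassmannian G \<theta> \<equiv> grassmannian (pair_rank G \<theta>) (sym_p G \<theta>)"

definition variety_of_reductions ::
    "'n::finite cmat set \<Rightarrow> ('n cmat \<Rightarrow> 'n cmat) \<Rightarrow> 'n cmat set set"
  where "variety_of_reductions G \<theta> =
    (pair_grassmannian G \<theta>) closure_of {\<aa>. cartan_subspace G \<theta> \<aa>}"

definition Ad :: "'n::finite cmat \<Rightarrow> 'n cmat \<Rightarrow> 'n cmat"
  where "Ad g X = g ** X ** matrix_inv g"

definition K_orbit ::
    "'n::finite cmat set \<Rightarrow> ('n cmat \<Rightarrow> 'n cmat) \<Rightarrow> 'n cmat set \<Rightarrow> 'n cmat set set"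
  where "K_orbit G \<theta> U = {Ad k ` U | k. k \<in> symK G \<theta>}"

definition closed_K_orbit ::
    "'n::finite cmat set \<Rightarrow> ('n cmat \<Rightarrow> 'n cmat) \<Rightarrow> 'n cmat set set \<Rightarrow> bool"
  where "closed_K_orbit G \<theta> \<O> \<longleftrightarrow>
    (\<exists>U \<in> variety_of_reductions G \<theta>. \<O> = K_orbit G \<theta> U) \<and>
    closedin (subtopology (pair_grassmannian G \<theta>) (variety_of_reductions G \<theta>)) \<O>"

end

theory Submission
  imports Defs "HOL-Complex_Analysis.Complex_Analysis"
    "HOL-Computational_Algebra.Fundamental_Theorem_Algebra" "Jordan_Normal_Form.Determinant"
begin

text \<open>
  Let \<open>U\<close> be a point of \<open>\<RR>\<close> whose \<open>K\<close>-orbit is closed.  The idea is that the semisimple parts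
  of the elements of \<open>U\<close> are rigidly attached to the subspace \<open>U\<close>, so that they inherit the
  compactness of the orbit; but a bounded orbit of \<open>K\<close> in an affine space is a point, and in a
  semisimple Lie algebra this leaves no room for a nonzero semisimple part.

  Elements \<open>X\<close>, \<open>Y\<close> of a Cartan subspace lie in a common nilpotent Lie algebra, so that
  \<open>(ad X)\<^sup>N Y = 0\<close> for an exponent \<open>N\<close> which only depends on the size of the matrices.  This is a
  polynomial condition on Pluecker coordinates and therefore holds on all of \<open>\<RR>\<close>
  (\<open>closure_bracket_power_zero\<close>, \<open>reductions_ad_nilpotent\<close>).  It forces the projections onto the
  generalized eigenspaces of \<open>X\<close> to commute with \<open>U\<close>.  If moreover \<open>X\<close> has as many eigenvalues as
  an element of \<open>U\<close> can have, then its projections depend on \<open>U\<close> alone (\<open>generic_spectral_proj_eq\<close>).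

  The orbit is sequentially compact (\<open>closedin_grassmannian_compact\<close>), and the projections of a
  matrix vary continuously as long as the number of eigenvalues stays the same
  (\<open>spectral_proj_bounded_along_subsequence\<close>).  Hence the \<open>K\<close>-orbit of such a projection \<open>e\<close> is bounded
  (\<open>orbit_spectral_proj_bounded\<close>).  For \<open>Y \<in> \<kk>\<close> the entire function \<open>t \<mapsto> exp (t Y) e exp (- t Y)\<close> is
  then constant by Liouville's theorem, so \<open>e\<close> commutes with \<open>\<kk>\<close>.  For \<open>Y \<in> \<pp>\<close> the bracket \<open>[X, Y]\<close>
  lies in \<open>\<kk>\<close>, whence \<open>[e, [X, Y]] = 0\<close>, and this already implies \<open>[e, Y] = 0\<close>
  (\<open>idempotent_commutant\<close>).

  Thus the semisimple part of \<open>X\<close> commutes with \<open>\<gg>\<close>.  It belongs to \<open>\<gg>\<close> because \<open>\<gg>\<close> is the Lie algebra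
  of an algebraic group (\<open>semisimple_part_in_lie_algebra\<close>), and the center of \<open>\<gg>\<close> is zero because
  the Zariski closure of its exponentials is a connected commutative normal subgroup
  (\<open>semisimple_center_trivial\<close>).  So \<open>X\<close> is nilpotent.  The greatest number of eigenvalues in \<open>U\<close> is
  then one, every element of \<open>U\<close> attains it, and the argument applies to all of them.
\<close>

no_notation fps_nth (infixl "$" 75)
no_notation vec_index (infixl "$" 100)
(* Matrices and vectors are throughout those indexed by a finite type. *)
hide_const (open) Module.smult Matrix.mat Matrix.vec Matrix.row Matrix.col Determinant.det Coset.order
hide_fact (open) Matrix.vec_eq_iff Matrix.mat_def Determinant.det_def

section \<open>Calculating with complex matrices\<close>

lemma cscale_nth [simp]: "(c *\<^sub>C A) $ i $ j = c * A $ i $ j"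
  by (simp add: cscale_def)

lemma matmul_nth: "(A ** B) $ i $ j = (\<Sum>k\<in>UNIV. A $ i $ k * B $ k $ j)"
  by (simp add: matrix_matrix_mult_def)

lemma matmul_ring:
  fixes A B C :: "'n::finite cmat"
  shows "(A + B) ** C = A ** C + B ** C" "A ** (B + C) = A ** B + A ** C"
    "(A - B) ** C = A ** C - B ** C" "A ** (B - C) = A ** B - A ** C"
    "(- A) ** C = - (A ** C)" "A ** (- C) = - (A ** C)"
    "(c *\<^sub>C A) ** C = c *\<^sub>C (A ** C)" "A ** (c *\<^sub>C C) = c *\<^sub>C (A ** C)"
    "(A ** B) ** C = A ** (B ** C)"
  by (simp_all add: vec_eq_iff matmul_nth algebra_simps sum.distrib sum_subtractf
      sum_negf sum_distrib_left matrix_mul_assoc[symmetric])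

lemma matmul_zero [simp]: "A ** (0 :: 'n::finite cmat) = 0" "(0 :: 'n cmat) ** A = 0"
  by (simp_all add: vec_eq_iff matmul_nth)

lemma matmul_sum_left:
  fixes f :: "'i \<Rightarrow> 'n::finite cmat"
  shows "(\<Sum>i\<in>S. f i) ** (A :: 'n cmat) = (\<Sum>i\<in>S. f i ** A)"
  by (induction S rule: infinite_finite_induct) (simp_all add: matmul_ring)

lemma matmul_sum_right:
  fixes f :: "'i \<Rightarrow> 'n::finite cmat"
  shows "(A :: 'n cmat) ** (\<Sum>i\<in>S. f i) = (\<Sum>i\<in>S. A ** f i)"
  by (induction S rule: infinite_finite_induct) (simp_all add: matmul_ring)

lemma cscale_of_real: "complex_of_real r *\<^sub>C A = r *\<^sub>R A"
  by (simp add: vec_eq_iff) (simp add: scaleR_conv_of_real)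

lemma csubspace_imp_subspace: "cmat.subspace S \<Longrightarrow> subspace S"
  unfolding cmat.subspace_def subspace_def by (metis cscale_of_real)

lemma invertible_matmul_left_cancel:
  assumes "invertible (A :: 'n::finite cmat)" "A ** B = A ** C" shows "B = C"
proof -
  obtain D where "D ** A = mat 1" using assms(1) by (auto simp: invertible_def)
  then show ?thesis using assms(2) by (metis matrix_mul_assoc matrix_mul_lid)
qed

lemma invertible_mat_1: "invertible (mat 1 :: 'n::finite cmat)"
  unfolding invertible_def by (rule exI[of _ "mat 1"]) simp

definition matpow :: "'n::finite cmat \<Rightarrow> nat \<Rightarrow> 'n cmat"
  where "matpow A k = (((**) A) ^^ k) (mat 1)"

lemma matpow_0 [simp]: "matpow A 0 = mat 1"
  and matpow_Suc [simp]: "matpow A (Suc k) = A ** matpow A k"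
  by (simp_all add: matpow_def)

lemma nilpotent_mat_iff: "nilpotent_mat A \<longleftrightarrow> (\<exists>k. matpow A k = 0)"
  by (simp add: nilpotent_mat_def matpow_def)

lemma matpow_commute:
  assumes "A ** B = B ** A" shows "matpow A k ** B = B ** matpow A k"
proof (induction k)
  case (Suc k)
  have "matpow A (Suc k) ** B = A ** (matpow A k ** B)" by (simp add: matmul_ring)
  also have "\<dots> = (A ** B) ** matpow A k" unfolding Suc by (simp add: matmul_ring)
  also have "\<dots> = B ** matpow A (Suc k)" unfolding assms by (simp add: matmul_ring)
  finally show ?case .
qed simp

lemma matpow_add: "matpow A (i + j) = matpow A i ** matpow A j"
  by (induction i) (simp_all add: matmul_ring)

lemma bracket_simps:
  "bracket X (Y + Z) = bracket X Y + bracket X Z" "bracket X (c *\<^sub>C Y) = c *\<^sub>C bracket X Y"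
  "bracket (X + Y) Z = bracket X Z + bracket Y Z" "bracket (c *\<^sub>C X) Y = c *\<^sub>C bracket X Y"
  "bracket X 0 = 0" "bracket 0 X = 0" "bracket X (- Y) = - bracket X Y" "bracket (- X) Y = - bracket X Y"
  by (simp_all add: bracket_def matmul_ring cmat.scale_right_diff_distrib cmat.scale_right_distrib)

lemma bracket_zero_iff: "bracket X Y = 0 \<longleftrightarrow> X ** Y = Y ** X"
  by (simp add: bracket_def)

lemma continuous_matmul:
  "(f \<longlongrightarrow> A) F \<Longrightarrow> (g \<longlongrightarrow> (B :: 'n::finite cmat)) F \<Longrightarrow> ((\<lambda>x. f x ** g x) \<longlongrightarrow> A ** B) F"
  by (intro vec_tendstoI) (simp add: matmul_nth tendsto_intros)

lemma continuous_cscale: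
  "(f \<longlongrightarrow> c) F \<Longrightarrow> (g \<longlongrightarrow> (B :: 'n::finite cmat)) F \<Longrightarrow> ((\<lambda>x. f x *\<^sub>C g x) \<longlongrightarrow> c *\<^sub>C B) F"
  by (intro vec_tendstoI) (simp add: tendsto_intros)

lemma matrix_inv_mult:
  assumes "invertible (g :: 'n::finite cmat)"
  shows "g ** matrix_inv g = mat 1" "matrix_inv g ** g = mat 1"
  using someI_ex[of "\<lambda>h. g ** h = mat 1 \<and> h ** g = mat 1"] assms
  unfolding matrix_inv_def invertible_def by blast+

lemma matrix_inv_eqI: "(g :: 'n::finite cmat) ** h = mat 1 \<Longrightarrow> matrix_inv g = h"
  by (metis invertible_right_inverse matrix_inv_mult(2) matrix_mul_assoc matrix_mul_lid matrix_mul_rid)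

lemma invertible_matrix_inv: "invertible (g :: 'n::finite cmat) \<Longrightarrow> invertible (matrix_inv g)"
  using matrix_inv_mult[of g] unfolding invertible_def by blast

lemma Ad_simps:
  assumes "invertible (g :: 'n::finite cmat)"
  shows "Ad g (A + B) = Ad g A + Ad g B" "Ad g (c *\<^sub>C A) = c *\<^sub>C Ad g A"
    "Ad g (A ** B) = Ad g A ** Ad g B" "Ad g (mat 1) = mat 1" "Ad g 0 = 0"
    "Ad g (A - B) = Ad g A - Ad g B"
    "Ad (matrix_inv g) (Ad g A) = A" "Ad g (Ad (matrix_inv g) A) = A"
proof -
  note inv = matrix_inv_mult[OF assms]
  have inv': "matrix_inv g ** (g ** Z) = Z" "g ** (matrix_inv g ** Z) = Z" for Z :: "'n cmat"
    using inv by (metis matrix_mul_assoc matrix_mul_lid)+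
  have ii: "matrix_inv (matrix_inv g) = g" using inv(2) by (rule matrix_inv_eqI)
  show "Ad g (A + B) = Ad g A + Ad g B" "Ad g (c *\<^sub>C A) = c *\<^sub>C Ad g A"
    "Ad g (A ** B) = Ad g A ** Ad g B" "Ad g (mat 1) = mat 1" "Ad g 0 = 0"
    "Ad g (A - B) = Ad g A - Ad g B"
    "Ad (matrix_inv g) (Ad g A) = A" "Ad g (Ad (matrix_inv g) A) = A"
    by (simp_all add: Ad_def matmul_ring inv inv' ii)
qed

lemma bounded_family_convergent_subseq:
  fixes f :: "nat \<Rightarrow> 'i \<Rightarrow> 'a::heine_borel"
  assumes "finite I" "\<And>i. i \<in> I \<Longrightarrow> bounded (range (\<lambda>n. f n i))"
  shows "\<exists>\<sigma>. strict_mono \<sigma> \<and> (\<forall>i\<in>I. convergent (\<lambda>n. f (\<sigma> n) i))"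
  using assms
proof (induction I rule: finite_induct)
  case empty
  show ?case by (rule exI[of _ id]) (simp add: strict_mono_def)
next
  case (insert j I)
  then obtain \<sigma> :: "nat \<Rightarrow> nat" where s: "strict_mono \<sigma>" "\<forall>i\<in>I. convergent (\<lambda>n. f (\<sigma> n) i)" by auto
  have "bounded (range (\<lambda>n. f (\<sigma> n) j))"
    by (rule bounded_subset[OF insert.prems[of j]]) auto
  then obtain l \<rho> where r: "strict_mono (\<rho> :: nat \<Rightarrow> nat)" "((\<lambda>n. f (\<sigma> n) j) \<circ> \<rho>) \<longlonglongrightarrow> l"
    using bounded_imp_convergent_subsequence by blast
  have "convergent (\<lambda>n. f ((\<sigma> \<circ> \<rho>) n) i)" if i: "i \<in> insert j I" for i
  proof (cases "i = j")
    case True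
    then show ?thesis using r(2) by (auto simp: o_def convergent_def)
  next
    case False
    then show ?thesis
      using s(2) i convergent_subseq_convergent[OF _ r(1), of "\<lambda>n. f (\<sigma> n) i"] by (auto simp: o_def)
  qed
  then show ?case using strict_mono_o[OF s(1) r(1)] by blast
qed

section \<open>Polynomial functions\<close>

definition mat_poly_fun :: "(('i \<Rightarrow> complex) \<Rightarrow> 'n::finite cmat) \<Rightarrow> bool"
  where "mat_poly_fun M \<longleftrightarrow> (\<forall>i j. poly_fun (\<lambda>x. M x $ i $ j))"

lemma poly_fun_sum: "(\<And>i. i \<in> I \<Longrightarrow> poly_fun (f i)) \<Longrightarrow> poly_fun (\<lambda>x. \<Sum>i\<in>I. f i x)"
  by (induction I rule: infinite_finite_induct) (simp_all add: poly_fun.const poly_fun.add)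

lemma poly_fun_prod: "(\<And>i. i \<in> I \<Longrightarrow> poly_fun (f i)) \<Longrightarrow> poly_fun (\<lambda>x. \<Prod>i\<in>I. f i x)"
  by (induction I rule: infinite_finite_induct) (simp_all add: poly_fun.const poly_fun.mult)

lemma poly_fun_diff:
  assumes "poly_fun F" "poly_fun H" shows "poly_fun (\<lambda>x. F x - H x)"
  using poly_fun.add[OF assms(1) poly_fun.mult[OF poly_fun.const[of "- 1"] assms(2)]] by simp

lemma mat_poly_fun_mult: "mat_poly_fun M \<Longrightarrow> mat_poly_fun M' \<Longrightarrow> mat_poly_fun (\<lambda>x. M x ** M' x)"
  by (simp add: mat_poly_fun_def matmul_nth poly_fun_sum poly_fun.mult)

lemma mat_poly_fun_diff: "mat_poly_fun M \<Longrightarrow> mat_poly_fun M' \<Longrightarrow> mat_poly_fun (\<lambda>x. M x - M' x)"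
  by (simp add: mat_poly_fun_def poly_fun_diff)

lemma mat_poly_fun_const: "mat_poly_fun (\<lambda>x. A)"
  by (simp add: mat_poly_fun_def poly_fun.const)

lemma mat_poly_fun_cscale: "mat_poly_fun M \<Longrightarrow> mat_poly_fun (\<lambda>x. c *\<^sub>C M x)"
  by (simp add: mat_poly_fun_def poly_fun.mult poly_fun.const)

lemma mat_poly_fun_sum: "(\<And>k. k \<in> I \<Longrightarrow> mat_poly_fun (M k)) \<Longrightarrow> mat_poly_fun (\<lambda>x. \<Sum>k\<in>I. M k x)"
  by (simp add: mat_poly_fun_def poly_fun_sum)

lemma poly_fun_tendsto:
  assumes "poly_fun F" "\<And>i. (\<lambda>n. x n i) \<longlonglongrightarrow> y i" shows "(\<lambda>n. F (x n)) \<longlonglongrightarrow> F y"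
  using assms(1) by induction (auto intro: tendsto_intros assms(2))

section \<open>Spectral projections\<close>

definition peval :: "complex poly \<Rightarrow> 'n::finite cmat \<Rightarrow> 'n cmat"
  where "peval p A = (\<Sum>i\<le>degree p. coeff p i *\<^sub>C matpow A i)"

lemma peval_bound: "degree p \<le> n \<Longrightarrow> peval p A = (\<Sum>i\<le>n. coeff p i *\<^sub>C matpow A i)"
  unfolding peval_def by (rule sum.mono_neutral_left) (auto simp: coeff_eq_0)

lemma peval_pCons: "peval (pCons a p) A = a *\<^sub>C mat 1 + A ** peval p A"
proof -
  have "peval (pCons a p) A = (\<Sum>i\<le>Suc (degree p). coeff (pCons a p) i *\<^sub>C matpow A i)"
    by (rule peval_bound) (rule degree_pCons_le)
  then show ?thesis
    by (simp add: sum.atMost_Suc_shift peval_def matmul_sum_right matmul_ring del: sum.atMost_Suc)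
qed

lemma peval_0 [simp]: "peval 0 A = 0" by (simp add: peval_def)

lemma peval_1 [simp]: "peval 1 A = mat 1" by (simp add: peval_def)

lemma peval_linear: "peval [:a, b:] A = a *\<^sub>C mat 1 + b *\<^sub>C A"
  by (simp add: peval_pCons matmul_ring)

lemma peval_add: "peval (p + q) A = peval p A + peval q A"
  by (induction p q rule: poly_induct2)
     (simp_all add: peval_pCons matmul_ring cmat.scale_left_distrib)

lemma peval_smult: "peval (smult c p) A = c *\<^sub>C peval p A"
  by (induction p) (simp_all add: peval_pCons matmul_ring cmat.scale_right_distrib)

lemma peval_mult: "peval (p * q) A = peval p A ** peval q A"
  by (induction p) (simp_all add: peval_pCons peval_add peval_smult matmul_ring)

lemma peval_diff: "peval (p - q) A = peval p A - peval q A"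
proof -
  have "peval (p - q) A = peval (p + smult (- 1) q) A" by simp
  then show ?thesis by (simp only: peval_add peval_smult) simp
qed

lemma peval_power: "peval (p ^ k) A = matpow (peval p A) k"
  by (induction k) (simp_all add: peval_mult)

lemma peval_sum: "peval (\<Sum>i\<in>S. f i) A = (\<Sum>i\<in>S. peval (f i) A)"
  by (induction S rule: infinite_finite_induct) (simp_all add: peval_add)

lemma peval_commute:
  assumes "A ** B = B ** A" shows "peval p A ** B = B ** peval p A"
  unfolding peval_def matmul_sum_left matmul_sum_right matmul_ring matpow_commute[OF assms] ..

lemma peval_dvd_zero: "p dvd q \<Longrightarrow> peval p A = 0 \<Longrightarrow> peval q A = 0"
  by (auto simp: peval_mult elim!: dvdE)

definition cspec :: "'n::finite cmat \<Rightarrow> complex set"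
  where "cspec A = {\<mu>. \<not> invertible (A - \<mu> *\<^sub>C mat 1)}"

text \<open>The exponents below have to be the same for all matrices of a given size in order to
  survive a passage to the limit.  The real dimension of the space of matrices is large enough:
  it bounds the degree of some annihilating polynomial of each matrix.\<close>

definition matdim :: "'n::finite itself \<Rightarrow> nat"
  where "matdim _ = DIM('n cmat)"

lemma matdim_pos: "matdim TYPE('n::finite) > 0"
  unfolding matdim_def by (rule DIM_positive)

lemma exists_linear_relation:
  fixes w :: "nat \<Rightarrow> 'a::euclidean_space"
  shows "\<exists>c. (\<exists>i\<le>DIM('a). c i \<noteq> 0) \<and> (\<Sum>i\<le>DIM('a). c i *\<^sub>R w i) = 0"
proof (cases "inj_on w {..DIM('a)}")
  case False
  then obtain i j where ij: "i \<in> {..DIM('a)}" "j \<in> {..DIM('a)}" "w i = w j" "i \<noteq> j"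
    by (auto simp: inj_on_def)
  define c where "c l = (if l = i then 1 else if l = j then - 1 else 0 :: real)" for l
  have "(\<Sum>l\<le>DIM('a). c l *\<^sub>R w l) = (\<Sum>l\<in>{i, j}. c l *\<^sub>R w l)"
    by (rule sum.mono_neutral_right) (use ij in \<open>auto simp: c_def\<close>)
  also have "\<dots> = 0" using ij by (simp add: c_def)
  finally show ?thesis using ij(1) by (intro exI[of _ c]) (auto simp: c_def)
next
  case True
  let ?S = "w ` {..DIM('a)}"
  have "\<not> card ?S \<le> DIM('a)" using True by (simp add: card_image)
  then have "dependent ?S" using independent_bound[of ?S] by blast
  then obtain u where u: "\<exists>v\<in>?S. u v \<noteq> 0" "(\<Sum>v\<in>?S. u v *\<^sub>R v) = 0"
    using dependent_finite[of ?S] by auto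
  then have "(\<Sum>i\<le>DIM('a). u (w i) *\<^sub>R w i) = 0" by (simp add: sum.reindex[OF True])
  then show ?thesis using u(1) by (intro exI[of _ "\<lambda>i. u (w i)"]) auto
qed

lemma exists_annihilating_poly:
  fixes A :: "'n::finite cmat"
  shows "\<exists>q. q \<noteq> 0 \<and> degree q \<le> matdim TYPE('n) \<and> peval q A = 0"
proof -
  let ?N = "matdim TYPE('n)"
  obtain c where c: "\<exists>i\<le>?N. c i \<noteq> 0" "(\<Sum>i\<le>?N. c i *\<^sub>R matpow A i) = 0"
    using exists_linear_relation[of "matpow A"] unfolding matdim_def by blast
  define q :: "complex poly" where "q = (\<Sum>i\<le>?N. monom (complex_of_real (c i)) i)"
  have co: "coeff q i = (if i \<le> ?N then of_real (c i) else 0)" for i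
    unfolding q_def by (auto simp add: coeff_sum sum.delta)
  have dq: "degree q \<le> ?N"
    by (rule degree_le) (simp add: co)
  have "peval q A = (\<Sum>i\<le>?N. c i *\<^sub>R matpow A i)"
    unfolding peval_bound[OF dq] by (rule sum.cong) (auto simp: co cscale_of_real)
  then have "peval q A = 0" using c(2) by simp
  moreover obtain i where "i \<le> ?N" "c i \<noteq> 0" using c(1) by blast
  then have "coeff q i \<noteq> 0" by (simp add: co)
  then have "q \<noteq> 0" by auto
  ultimately show ?thesis using dq by blast
qed

lemma cspec_root:
  assumes "peval q A = 0" "\<mu> \<in> cspec A" shows "poly q \<mu> = 0"
proof (rule ccontr)
  assume nz: "poly q \<mu> \<noteq> 0"
  have "[:-\<mu>, 1:] dvd q - [:poly q \<mu>:]" by (subst poly_eq_0_iff_dvd[symmetric]) simp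
  then obtain h where h: "q - [:poly q \<mu>:] = [:-\<mu>, 1:] * h" by (elim dvdE)
  have "- (poly q \<mu> *\<^sub>C mat 1) = (A - \<mu> *\<^sub>C mat 1) ** peval h A"
    using arg_cong[OF h, of "\<lambda>p. peval p A"] assms(1)
    by (simp add: peval_diff peval_mult peval_smult peval_pCons matmul_ring)
  then have "(A - \<mu> *\<^sub>C mat 1) ** ((- 1 / poly q \<mu>) *\<^sub>C peval h A) = mat 1"
    using nz by (simp add: matmul_ring flip: cmat.scale_right_diff_distrib)
      (simp add: vec_eq_iff field_simps)
  then show False using assms(2) invertible_right_inverse by (auto simp: cspec_def)
qed

lemma cspec_finite_card:
  fixes A :: "'n::finite cmat"
  shows "finite (cspec A)" "card (cspec A) \<le> matdim TYPE('n)"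
proof -
  obtain q where q: "q \<noteq> 0" "degree q \<le> matdim TYPE('n)" "peval q A = 0"
    using exists_annihilating_poly by blast
  have sub: "cspec A \<subseteq> {z. poly q z = 0}" using cspec_root[OF q(3)] by auto
  have fin: "finite {z. poly q z = 0}" using q(1) by (simp add: poly_roots_finite)
  show "finite (cspec A)" using sub fin by (rule finite_subset)
  have "card (cspec A) \<le> card {z. poly q z = 0}" using fin sub by (rule card_mono)
  also have "\<dots> \<le> degree q" using q(1) by (rule card_poly_roots_bound)
  finally show "card (cspec A) \<le> matdim TYPE('n)" using q(2) by simp
qed

definition roots_poly :: "nat \<Rightarrow> complex set \<Rightarrow> complex poly"
  where "roots_poly N S = (\<Prod>\<nu>\<in>S. [:-\<nu>, 1:] ^ N)"

lemma invertible_matpow: "invertible A \<Longrightarrow> invertible (matpow (A :: 'n::finite cmat) k)"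
  by (induction k) (simp_all add: invertible_mult invertible_mat_1)

text \<open>In an annihilating polynomial, the linear factors at points outside the spectrum are invertible
  and can be cancelled; all multiplicities may be raised to the bound for the degree.\<close>

lemma roots_poly_cspec:
  fixes A :: "'n::finite cmat"
  shows "peval (roots_poly (matdim TYPE('n)) (cspec A)) A = 0"
proof -
  let ?N = "matdim TYPE('n)"
  obtain q where q: "q \<noteq> 0" "degree q \<le> matdim TYPE('n)" "peval q A = 0"
    using exists_annihilating_poly by blast
  define R where "R = {z. poly q z = 0}"
  have fin: "finite R" using q(1) by (simp add: R_def poly_roots_finite)
  have sub: "cspec A \<subseteq> R" using cspec_root[OF q(3)] by (auto simp: R_def)
  have "q dvd roots_poly ?N R"
  proof -
    have "(\<Prod>z\<in>R. [:-z, 1:] ^ Polynomial.order z q) dvd roots_poly ?N R"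
      unfolding roots_poly_def
      by (rule prod_dvd_prod) (use order_degree[OF q(1)] q(2) in \<open>meson le_imp_power_dvd le_trans\<close>)
    then have "smult (lead_coeff q) (\<Prod>z\<in>R. [:-z, 1:] ^ Polynomial.order z q) dvd roots_poly ?N R"
      using q(1) by (simp add: smult_dvd_iff)
    then show ?thesis unfolding R_def complex_poly_decompose .
  qed
  then have zero: "peval (roots_poly ?N R) A = 0" using q(3) by (rule peval_dvd_zero)
  have inv: "invertible (peval (roots_poly ?N T) A)" if "finite T" "T \<inter> cspec A = {}" for T
    using that
  proof (induction T rule: finite_induct)
    case empty
    then show ?case by (simp add: roots_poly_def invertible_mat_1)
  next
    case (insert z T)
    have "invertible (A - z *\<^sub>C mat 1)" using insert by (auto simp: cspec_def)
    then have "invertible (peval ([:-z, 1:] ^ ?N) A)"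
      by (simp add: peval_power peval_linear invertible_matpow)
    then have "invertible (peval ([:-z, 1:] ^ ?N) A ** peval (roots_poly ?N T) A)"
      using insert by (intro invertible_mult) auto
    moreover have "peval (roots_poly ?N (insert z T)) A = peval ([:-z, 1:] ^ ?N) A ** peval (roots_poly ?N T) A"
      using insert by (simp add: roots_poly_def peval_mult)
    ultimately show ?case by simp
  qed
  have "roots_poly ?N R = roots_poly ?N (R - cspec A) * roots_poly ?N (cspec A)"
    unfolding roots_poly_def using prod.subset_diff[OF sub fin] by blast
  then have "peval (roots_poly ?N (R - cspec A)) A ** peval (roots_poly ?N (cspec A)) A
      = peval (roots_poly ?N (R - cspec A)) A ** 0"
    using zero by (simp add: peval_mult)
  moreover have "invertible (peval (roots_poly ?N (R - cspec A)) A)" by (rule inv) (use fin in auto)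
  ultimately show ?thesis by (rule invertible_matmul_left_cancel[rotated])
qed

lemma cspec_nonempty: "cspec (A :: 'n::finite cmat) \<noteq> {}"
proof
  assume "cspec A = {}"
  then have "mat 1 = (0 :: 'n cmat)" using roots_poly_cspec[of A] by (simp add: roots_poly_def)
  then have "(mat 1 :: 'n cmat) $ i $ i = 0" for i by simp
  then show False by (simp add: mat_def)
qed

text \<open>The Lagrange polynomial \<open>L\<close> at \<open>\<mu>\<close> is \<open>1\<close> at \<open>\<mu>\<close> and \<open>0\<close> at the other points of \<open>S\<close>, and
  \<open>1 - (1 - L\<^sup>N)\<^sup>N\<close> takes the same values to order \<open>N\<close>.  This formula for the spectral projections
  is explicit enough to show that they depend continuously on the matrix and its eigenvalues.\<close>

definition lagrange_poly :: "complex set \<Rightarrow> complex \<Rightarrow> complex poly"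
  where "lagrange_poly S \<mu> = (\<Prod>\<nu>\<in>S - {\<mu>}. smult (1 / (\<mu> - \<nu>)) [:-\<nu>, 1:])"

definition spectral_poly :: "nat \<Rightarrow> complex set \<Rightarrow> complex \<Rightarrow> complex poly"
  where "spectral_poly N S \<mu> = 1 - (1 - lagrange_poly S \<mu> ^ N) ^ N"

lemma spectral_poly_dvd_other:
  assumes "finite S" "\<nu> \<in> S" "\<nu> \<noteq> \<mu>" "N > 0"
  shows "[:-\<nu>, 1:] ^ N dvd spectral_poly N S \<mu>"
proof -
  have "smult (1 / (\<mu> - \<nu>)) [:-\<nu>, 1:] dvd lagrange_poly S \<mu>"
    unfolding lagrange_poly_def using assms by (intro dvd_prodI) auto
  then have "[:-\<nu>, 1:] dvd lagrange_poly S \<mu>"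
    using assms(3) unfolding smult_dvd_iff by simp
  then have "[:-\<nu>, 1:] ^ N dvd lagrange_poly S \<mu> ^ N" by (rule dvd_power_same)
  moreover have "lagrange_poly S \<mu> ^ N dvd 1 - (1 - lagrange_poly S \<mu> ^ N) ^ N"
    using one_diff_power_eq[of "1 - lagrange_poly S \<mu> ^ N" N] by simp
  ultimately show ?thesis unfolding spectral_poly_def by (rule dvd_trans)
qed

lemma spectral_poly_dvd_self:
  assumes "finite S" shows "[:-\<mu>, 1:] ^ N dvd 1 - spectral_poly N S \<mu>"
proof -
  have "poly (lagrange_poly S \<mu>) \<mu> = 1" unfolding lagrange_poly_def poly_prod
    by (intro prod.neutral) (auto simp: diff_divide_distrib[symmetric])
  then have "[:-\<mu>, 1:] dvd 1 - lagrange_poly S \<mu> ^ N" by (subst poly_eq_0_iff_dvd[symmetric]) simp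
  then show ?thesis by (simp add: spectral_poly_def dvd_power_same)
qed

text \<open>Powers of different linear polynomials are coprime.\<close>

lemma roots_poly_dvd:
  assumes "finite S" "\<And>\<nu>. \<nu> \<in> S \<Longrightarrow> [:-\<nu>, 1:] ^ N dvd p" shows "roots_poly N S dvd p"
  using assms
proof (induction S arbitrary: p rule: finite_induct)
  case (insert z S)
  obtain r where r: "p = [:-z, 1:] ^ N * r" using insert.prems[of z] by (auto elim: dvdE)
  have "roots_poly N S dvd r"
  proof (rule insert.IH)
    fix w assume w: "w \<in> S"
    then have "z \<noteq> w" using insert by auto
    then have "poly ([:-z, 1:] ^ N) w \<noteq> 0" by simp
    then have o: "Polynomial.order w ([:-z, 1:] ^ N) = 0" by (rule order_0I)
    have "[:-w, 1:] ^ N dvd p" using insert.prems w by simp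
    then show "[:-w, 1:] ^ N dvd r"
      unfolding order_divides r by (cases "r = 0") (simp_all add: order_mult o)
  qed
  then show ?case using insert by (simp add: roots_poly_def r mult_dvd_mono)
qed (simp add: roots_poly_def)

definition spectral_proj :: "'n::finite cmat \<Rightarrow> complex \<Rightarrow> 'n cmat"
  where "spectral_proj A \<mu> = peval (spectral_poly (matdim TYPE('n)) (cspec A) \<mu>) A"

lemma peval_zeroI:
  fixes A :: "'n::finite cmat"
  assumes "\<And>\<nu>. \<nu> \<in> cspec A \<Longrightarrow> [:-\<nu>, 1:] ^ matdim TYPE('n) dvd p"
  shows "peval p A = 0"
  by (rule peval_dvd_zero[OF roots_poly_dvd[OF cspec_finite_card(1) assms] roots_poly_cspec])

lemma spectral_proj_orthogonal:
  assumes "\<mu> \<noteq> \<nu>" shows "spectral_proj A \<mu> ** spectral_proj A \<nu> = 0"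
proof -
  have "peval (spectral_poly N (cspec A) \<mu> * spectral_poly N (cspec A) \<nu>) A = 0"
    if "N = matdim TYPE('a)" for N
    unfolding that
  proof (rule peval_zeroI)
    fix \<xi> assume "\<xi> \<in> cspec A"
    then show "[:-\<xi>, 1:] ^ matdim TYPE('a) dvd
        spectral_poly (matdim TYPE('a)) (cspec A) \<mu> * spectral_poly (matdim TYPE('a)) (cspec A) \<nu>"
      using spectral_poly_dvd_other[OF cspec_finite_card(1) _ _ matdim_pos, of \<xi> A] assms
      by (cases "\<xi> = \<mu>") (auto intro: dvd_mult dvd_mult2)
  qed
  then show ?thesis by (simp add: spectral_proj_def peval_mult)
qed

lemma spectral_proj_sum: "(\<Sum>\<mu>\<in>cspec A. spectral_proj A \<mu>) = mat 1"
proof -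
  let ?P = "spectral_poly (matdim TYPE('a)) (cspec A)"
  have "peval (1 - (\<Sum>\<mu>\<in>cspec A. ?P \<mu>)) A = 0"
  proof (rule peval_zeroI)
    fix \<xi> assume xi: "\<xi> \<in> cspec A"
    have "1 - (\<Sum>\<mu>\<in>cspec A. ?P \<mu>) = (1 - ?P \<xi>) - (\<Sum>\<mu>\<in>cspec A - {\<xi>}. ?P \<mu>)"
      by (subst sum.remove[OF cspec_finite_card(1) xi]) simp
    also have "[:-\<xi>, 1:] ^ matdim TYPE('a) dvd \<dots>"
      using xi by (intro dvd_diff dvd_sum spectral_poly_dvd_self spectral_poly_dvd_other cspec_finite_card matdim_pos) auto
    finally show "[:-\<xi>, 1:] ^ matdim TYPE('a) dvd 1 - (\<Sum>\<mu>\<in>cspec A. ?P \<mu>)" .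
  qed
  then show ?thesis by (simp add: spectral_proj_def peval_diff peval_sum)
qed

lemma spectral_proj_idem:
  assumes "\<mu> \<in> cspec A" shows "spectral_proj A \<mu> ** spectral_proj A \<mu> = spectral_proj A \<mu>"
proof -
  have "spectral_proj A \<mu> = spectral_proj A \<mu> ** (\<Sum>\<nu>\<in>cspec A. spectral_proj A \<nu>)" by (simp add: spectral_proj_sum)
  also have "\<dots> = spectral_proj A \<mu> ** spectral_proj A \<mu> + (\<Sum>\<nu>\<in>cspec A - {\<mu>}. spectral_proj A \<mu> ** spectral_proj A \<nu>)"
    unfolding matmul_sum_right by (rule sum.remove[OF cspec_finite_card(1) assms])
  also have "(\<Sum>\<nu>\<in>cspec A - {\<mu>}. spectral_proj A \<mu> ** spectral_proj A \<nu>) = 0"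
    by (rule sum.neutral) (auto intro: spectral_proj_orthogonal)
  finally show ?thesis by simp
qed

lemma spectral_proj_nilpotent:
  fixes A :: "'n::finite cmat"
  assumes "\<mu> \<in> cspec A"
  shows "matpow (A - \<mu> *\<^sub>C mat 1) (matdim TYPE('n)) ** spectral_proj A \<mu> = 0"
proof -
  have "peval ([:-\<mu>, 1:] ^ matdim TYPE('n) * spectral_poly (matdim TYPE('n)) (cspec A) \<mu>) A = 0"
  proof (rule peval_zeroI)
    fix \<xi> assume "\<xi> \<in> cspec A"
    then show "[:-\<xi>, 1:] ^ matdim TYPE('n) dvd
        [:-\<mu>, 1:] ^ matdim TYPE('n) * spectral_poly (matdim TYPE('n)) (cspec A) \<mu>"
      using spectral_poly_dvd_other[OF cspec_finite_card(1) _ _ matdim_pos, of \<xi> A]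
      by (cases "\<xi> = \<mu>") (auto intro: dvd_mult dvd_mult2)
  qed
  moreover have "peval [:-\<mu>, 1:] A = A - \<mu> *\<^sub>C mat 1" by (simp add: peval_linear)
  ultimately show ?thesis by (simp only: spectral_proj_def peval_mult peval_power)
qed

lemma spectral_proj_commute: "A ** B = B ** A \<Longrightarrow> spectral_proj A \<mu> ** B = B ** spectral_proj A \<mu>"
  unfolding spectral_proj_def by (rule peval_commute)

lemma spectral_proj_nonzero:
  assumes "\<mu> \<in> cspec A" shows "spectral_proj A \<mu> \<noteq> 0"
proof
  assume zero: "spectral_proj A \<mu> = 0"
  let ?P = "spectral_poly (matdim TYPE('a)) (cspec A) \<mu>"
  have "[:-\<mu>, 1:] dvd 1 - ?P"
    by (rule dvd_trans[OF dvd_power[OF disjI1[OF matdim_pos]] spectral_poly_dvd_self[OF cspec_finite_card(1)]])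
  then obtain h where h: "1 - ?P = [:-\<mu>, 1:] * h" by (elim dvdE)
  have "peval (1 - ?P) A = peval [:-\<mu>, 1:] A ** peval h A" unfolding h by (rule peval_mult)
  then have "mat 1 = (A - \<mu> *\<^sub>C mat 1) ** peval h A"
    using zero by (simp add: peval_diff peval_linear spectral_proj_def)
  then show False using assms invertible_right_inverse[of "A - \<mu> *\<^sub>C mat 1"] by (metis cspec_def mem_Collect_eq)
qed

section \<open>Traces of nilpotent and of idempotent matrices\<close>

lemma det_poly: "\<exists>q. \<forall>t. det (mat 1 + t *\<^sub>C (A :: 'n::finite cmat)) = poly q t"
proof (intro exI allI)
  fix t
  let ?e = "\<lambda>i j. [:(mat 1 :: 'n cmat) $ i $ j, A $ i $ j:]"
  show "det (mat 1 + t *\<^sub>C A) =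
      poly (\<Sum>p | p permutes UNIV. of_int (sign p) * (\<Prod>i\<in>UNIV. ?e i (p i))) t"
    by (simp add: det_def poly_sum poly_prod mult.commute)
qed

lemma det_deriv_at_1:
  "((\<lambda>t. det (mat 1 + t *\<^sub>C (A :: 'n::finite cmat))) has_field_derivative trace A) (at 0)"
proof -
  let ?I = "mat 1 :: 'n cmat"
  let ?d = "\<lambda>p. \<Sum>i\<in>UNIV. A $ i $ p i * (\<Prod>j\<in>UNIV - {i}. ?I $ j $ p j)"
  have "((\<lambda>t. det (?I + t *\<^sub>C A)) has_field_derivative
      (\<Sum>p | p permutes UNIV. of_int (sign p) * ?d p)) (at 0)"
    unfolding det_def 
    by (intro derivative_eq_intros refl) (auto intro!: derivative_eq_intros has_field_derivative_prod)
  moreover have "(\<Sum>p | p permutes UNIV. of_int (sign p) * ?d p) = trace A"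
  proof -
    have "?d p = 0" if p: "p permutes UNIV" "p \<noteq> id" for p
    proof (rule sum.neutral, rule ballI)
      fix i
      obtain j where j: "p j \<noteq> j" using p(2) by (metis eq_id_iff)
      then have j': "p (p j) \<noteq> p j" using permutes_inj[OF p(1)] by (auto dest: injD)
      have "\<exists>j. p j \<noteq> j \<and> j \<noteq> i" using j j' by (cases "j = i") auto
      then obtain k where "p k \<noteq> k" "k \<noteq> i" by auto
      then have "(\<Prod>j\<in>UNIV - {i}. ?I $ j $ p j) = 0"
        by (intro prod_zero) (auto simp: mat_def intro!: bexI[of _ k])
      then show "A $ i $ p i * (\<Prod>j\<in>UNIV - {i}. ?I $ j $ p j) = 0" by simp
    qed
    then have "(\<Sum>p | p permutes UNIV. of_int (sign p) * ?d p)
        = (\<Sum>p\<in>{id}. of_int (sign p) * ?d p)"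
      by (intro sum.mono_neutral_right) (auto simp: permutes_id)
    also have "\<dots> = trace A" by (simp add: trace_def mat_def)
    finally show ?thesis .
  qed
  ultimately show ?thesis by simp
qed

lemma trace_cscale: "trace (c *\<^sub>C A) = c * trace A"
  by (simp add: trace_def sum_distrib_left)

text \<open>For nilpotent \<open>A\<close>, the polynomial \<open>det (1 + t A)\<close> has no complex root, so it is constant; the trace is
  its derivative at \<open>0\<close>.\<close>

lemma trace_nilpotent:
  assumes "matpow (A :: 'n::finite cmat) k = 0" shows "trace A = 0"
proof -
  obtain q where q: "\<And>t. det (mat 1 + t *\<^sub>C A) = poly q t" using det_poly[of A] by blast
  have nz: "poly q t \<noteq> 0" for t
  proof (cases "t = 0")
    case False
    have "peval ([:0, 1:] ^ k) A = 0" using assms by (simp add: peval_power peval_linear)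
    then have "- 1 / t \<notin> cspec A" using False by (auto dest: cspec_root)
    then obtain B where B: "(A - (- 1 / t) *\<^sub>C mat 1) ** B = mat 1"
      by (auto simp: cspec_def invertible_right_inverse)
    have "mat 1 + t *\<^sub>C A = t *\<^sub>C (A - (- 1 / t) *\<^sub>C mat 1)"
      using False by (simp add: cmat.scale_right_distrib)
    then have "(mat 1 + t *\<^sub>C A) ** ((1 / t) *\<^sub>C B) = mat 1"
      using False B by (simp add: matmul_ring)
    then have "invertible (mat 1 + t *\<^sub>C A)" using invertible_right_inverse by blast
    then show ?thesis unfolding q[symmetric] by (simp add: invertible_det_nz)
  qed (simp add: q[symmetric])
  then have "constant (poly q)" using fundamental_theorem_of_algebra by blast
  then have "det (mat 1 + t *\<^sub>C A) = 1" for t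
    unfolding q constant_def using q[of 0] by (metis add.right_neutral cmat.scale_zero_left det_I)
  then have "((\<lambda>t :: complex. 1) has_field_derivative trace A) (at 0)"
    using det_deriv_at_1[of A] by simp
  then show ?thesis using DERIV_unique DERIV_const by blast
qed

text \<open>The polynomial \<open>det (1 + (u - 1) e)\<close> is multiplicative in \<open>u\<close>.  Were its derivative \<open>tr e\<close> at \<open>u = 1\<close>
  zero, it would be constant, contradicting \<open>det (1 - e) = 0\<close>.\<close>

lemma trace_idempotent:
  assumes "e ** e = (e :: 'n::finite cmat)" "e \<noteq> 0" shows "trace e \<noteq> 0"
proof
  assume tr: "trace e = 0"
  obtain q where q: "\<And>t. det (mat 1 + t *\<^sub>C e) = poly q t" using det_poly[of e] by blast
  have mult: "poly q t * poly q s = poly q (t + s * (1 + t))" for s t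
    unfolding q[symmetric] det_mul[symmetric]
    by (rule arg_cong[of _ _ det])
      (simp add: matmul_ring assms(1) cmat.scale_left_distrib algebra_simps)
  have q0: "poly (pderiv q) 0 = 0"
    using det_deriv_at_1[of e] unfolding q tr using DERIV_unique poly_DERIV by blast
  have "poly (pderiv q) t * (1 + t) = 0" for t
  proof -
    have 1: "((\<lambda>s. poly q t * poly q s) has_field_derivative poly q t * poly (pderiv q) 0) (at 0)"
      by (intro DERIV_cmult poly_DERIV)
    have 2: "((\<lambda>s. poly q (t + s * (1 + t))) has_field_derivative
        poly (pderiv q) (t + 0 * (1 + t)) * (1 + t)) (at 0)"
      by (rule DERIV_chain2[OF poly_DERIV]) (auto intro!: derivative_eq_intros)
    show ?thesis using DERIV_unique[OF 1[unfolded mult] 2] by (simp add: q0)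
  qed
  then have "pderiv q * [:1, 1:] = 0" 
    unfolding poly_eq_poly_eq_iff[symmetric] by (auto simp: algebra_simps fun_eq_iff)
  then have "pderiv q = 0" unfolding mult_eq_0_iff by (simp only: pCons_eq_0_iff) simp
  then have "degree q = 0" by (simp add: pderiv_eq_0_iff)
  then obtain c where "q = [:c:]" by (elim degree_eq_zeroE)
  then have "det (mat 1 + (- 1) *\<^sub>C e) = 1"
    using q[of 0] q[of "- 1"] by simp
  then have "invertible (mat 1 - e)" by (simp add: invertible_det_nz)
  moreover have "(mat 1 - e) ** e = (mat 1 - e) ** 0" by (simp add: matmul_ring assms(1))
  ultimately show False using invertible_matmul_left_cancel assms(2) by blast
qed

lemma matpow_mult_idempotent:
  assumes "e ** e = (e :: 'n::finite cmat)" "A ** e = e ** A"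
  shows "matpow (A ** e) (Suc k) = matpow A (Suc k) ** e"
proof (induction k)
  case (Suc k)
  have "matpow (A ** e) (Suc (Suc k)) = A ** e ** (matpow A (Suc k) ** e)"
    using Suc by (simp only: matpow_Suc)
  also have "\<dots> = A ** (e ** matpow A (Suc k)) ** e" by (simp add: matmul_ring)
  also have "e ** matpow A (Suc k) = matpow A (Suc k) ** e"
    by (rule matpow_commute[symmetric]) (rule assms)
  finally show ?case by (simp add: matmul_ring assms(1))
qed simp

text \<open>The eigenvalue of a block is a normalized trace.  Its merit is to be linear in \<open>A\<close>, even for
  matrices which do not commute.\<close>

lemma trace_block:
  assumes e: "e ** e = (e :: 'n::finite cmat)" "A ** e = e ** A"
    and nil: "matpow (A - \<mu> *\<^sub>C mat 1) k ** e = 0"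
  shows "trace (A ** e) = \<mu> * trace e"
proof -
  let ?B = "A - \<mu> *\<^sub>C mat 1"
  have "matpow (?B ** e) (Suc k) = matpow ?B (Suc k) ** e"
    by (rule matpow_mult_idempotent) (simp_all add: e matmul_ring)
  also have "\<dots> = 0" using nil by (simp add: matmul_ring)
  finally have "trace (?B ** e) = 0" by (rule trace_nilpotent)
  then show ?thesis by (simp add: matmul_ring trace_sub trace_cscale)
qed

section \<open>Spaces of matrices acting nilpotently on each other\<close>

text \<open>By the Jacobi identity \<open>[e, Y]\<close> commutes with \<open>X\<close>, hence with \<open>e\<close>; but \<open>[e, [e, Y]] = 0\<close> forces
  \<open>[e, Y] = 0\<close> for an idempotent.  This is how semisimplicity enters: if the bracket with \<open>X\<close>
  commutes with the spectral projections of \<open>X\<close>, then so does the element itself.\<close>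

lemma idempotent_commutant:
  assumes e: "e ** e = e" and X: "\<And>B. X ** B = B ** X \<Longrightarrow> e ** B = B ** e"
    and Y: "bracket e (bracket X Y) = 0"
  shows "e ** Y = Y ** e"
proof -
  let ?W = "bracket e Y"
  have eX: "e ** X = X ** e" by (rule X) (rule refl)
  then have eX': "e ** (X ** Z) = X ** (e ** Z)" for Z by (metis matrix_mul_assoc)
  have "X ** ?W - ?W ** X = bracket e (bracket X Y)"
    by (simp add: bracket_def matmul_ring eX eX')
  then have "X ** ?W = ?W ** X" using Y by simp
  then have eW: "e ** ?W = ?W ** e" by (rule X)
  have ee: "e ** (e ** Z) = e ** Z" for Z using e by (metis matrix_mul_assoc)
  have eq: "e ** Y - e ** (Y ** e) = e ** (Y ** e) - Y ** e"
    using eW by (simp add: bracket_def matmul_ring e ee)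
  have "e ** (e ** Y - e ** (Y ** e)) = e ** (e ** (Y ** e) - Y ** e)" unfolding eq ..
  then have "e ** Y = e ** (Y ** e)" by (simp add: matmul_ring ee)
  with eq show ?thesis by simp
qed

lemma spectral_proj_commute_ad_nilpotent:
  assumes "\<mu> \<in> cspec X" "(bracket X ^^ k) Y = 0"
  shows "spectral_proj X \<mu> ** Y = Y ** spectral_proj X \<mu>"
  using assms(2)
proof (induction k arbitrary: Y)
  case (Suc k)
  then have "(bracket X ^^ k) (bracket X Y) = 0" by (simp add: funpow_swap1)
  then have "bracket (spectral_proj X \<mu>) (bracket X Y) = 0" unfolding bracket_zero_iff by (rule Suc.IH)
  note br = this
  show ?case
  proof (rule idempotent_commutant[of _ X])
    show "spectral_proj X \<mu> ** spectral_proj X \<mu> = spectral_proj X \<mu>" using assms(1) by (rule spectral_proj_idem)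
    show "spectral_proj X \<mu> ** B = B ** spectral_proj X \<mu>" if "X ** B = B ** X" for B
      using that by (rule spectral_proj_commute)
    show "bracket (spectral_proj X \<mu>) (bracket X Y) = 0" by (rule br)
  qed
qed simp

definition ad_nilpotent_on :: "'n::finite cmat set \<Rightarrow> bool"
  where "ad_nilpotent_on U \<longleftrightarrow> (\<forall>X\<in>U. \<forall>Y\<in>U. \<exists>k. (bracket X ^^ k) Y = 0)"

text \<open>The number of eigenvalues is invariant under conjugation, and it cannot grow in a limit.\<close>

definition generic_in :: "'n::finite cmat set \<Rightarrow> 'n cmat \<Rightarrow> bool"
  where "generic_in U X \<longleftrightarrow> X \<in> U \<and> (\<forall>Z\<in>U. card (cspec Z) \<le> card (cspec X))"

lemma exists_generic:
  fixes U :: "'n::finite cmat set"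
  assumes "U \<noteq> {}" shows "\<exists>X. generic_in U X"
proof -
  obtain X where "X \<in> U" using assms by blast
  then show ?thesis
    using ex_has_greatest_nat[of "\<lambda>X. X \<in> U" X "\<lambda>X. card (cspec X)" "Suc (matdim TYPE('n))"]
      cspec_finite_card(2)[where 'n = 'n] by (auto simp: generic_in_def less_Suc_eq_le)
qed

lemma exists_nonzero_spectral_proj:
  assumes "(e :: 'n::finite cmat) \<noteq> 0" shows "\<exists>\<xi>\<in>cspec Z. e ** spectral_proj Z \<xi> \<noteq> 0"
proof (rule ccontr)
  assume "\<not> ?thesis"
  then have "(\<Sum>\<xi>\<in>cspec Z. e ** spectral_proj Z \<xi>) = 0" by (intro sum.neutral) auto
  then have "e ** mat 1 = 0" unfolding matmul_sum_right[symmetric] spectral_proj_sum .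
  then show False using assms by simp
qed

lemma idempotent_mult:
  assumes "e ** e = (e :: 'n::finite cmat)" "f ** f = f" "e ** f = f ** e"
  shows "(e ** f) ** (e ** f) = e ** f"
proof -
  have "(e ** f) ** (e ** f) = e ** (f ** e) ** f" by (simp add: matmul_ring)
  also have "\<dots> = (e ** e) ** (f ** f)" unfolding assms(3)[symmetric] by (simp add: matmul_ring)
  finally show ?thesis by (simp add: assms)
qed

text \<open>If a projection of \<open>X\<close> were cut into several pieces by the projections of \<open>Y\<close>, then \<open>X + c Y\<close> would
  have more eigenvalues than \<open>X\<close> for a general scalar \<open>c\<close>.\<close>

lemma generic_spectral_proj_le:
  assumes U: "cmat.subspace U" "ad_nilpotent_on U" and X: "generic_in U X" and Y: "Y \<in> U"
    and mu0: "\<mu>0 \<in> cspec X"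
  shows "\<exists>\<nu>\<in>cspec Y. spectral_proj X \<mu>0 ** spectral_proj Y \<nu> = spectral_proj X \<mu>0"
proof (rule ccontr)
  assume not: "\<not> ?thesis"
  have XU: "X \<in> U" using X by (simp add: generic_in_def)
  have comm: "spectral_proj A \<mu> ** B = B ** spectral_proj A \<mu>" if "A \<in> U" "B \<in> U" "\<mu> \<in> cspec A" for A B \<mu>
    using U(2) that spectral_proj_commute_ad_nilpotent unfolding ad_nilpotent_on_def by blast
  have comm2: "spectral_proj A \<mu> ** spectral_proj B \<nu> = spectral_proj B \<nu> ** spectral_proj A \<mu>"
    if "A \<in> U" "B \<in> U" "\<mu> \<in> cspec A" for A B \<mu> \<nu>
    using spectral_proj_commute[OF comm[OF that, symmetric]] by simp
  define P where "P = {(\<mu>, \<nu>) \<in> cspec X \<times> cspec Y. spectral_proj X \<mu> ** spectral_proj Y \<nu> \<noteq> 0}"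
  have finP: "finite P" unfolding P_def
    by (rule finite_subset[OF _ finite_cartesian_product[OF cspec_finite_card(1) cspec_finite_card(1)]]) auto
  obtain \<nu>1 where n1: "\<nu>1 \<in> cspec Y" "spectral_proj X \<mu>0 ** spectral_proj Y \<nu>1 \<noteq> 0"
    using exists_nonzero_spectral_proj[OF spectral_proj_nonzero[OF mu0]] by blast
  have "\<exists>\<nu>2\<in>cspec Y - {\<nu>1}. spectral_proj X \<mu>0 ** spectral_proj Y \<nu>2 \<noteq> 0"
  proof (rule ccontr)
    assume "\<not> ?thesis"
    then have "(\<Sum>\<nu>\<in>cspec Y - {\<nu>1}. spectral_proj X \<mu>0 ** spectral_proj Y \<nu>) = 0"
      by (intro sum.neutral) auto
    moreover have "spectral_proj X \<mu>0 = (\<Sum>\<nu>\<in>cspec Y. spectral_proj X \<mu>0 ** spectral_proj Y \<nu>)"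
      unfolding matmul_sum_right[symmetric] spectral_proj_sum by simp
    ultimately have "spectral_proj X \<mu>0 = spectral_proj X \<mu>0 ** spectral_proj Y \<nu>1"
      by (simp add: sum.remove[OF cspec_finite_card(1) n1(1)])
    then show False using not n1(1) by auto
  qed
  then obtain \<nu>2 where n2: "\<nu>2 \<in> cspec Y" "\<nu>2 \<noteq> \<nu>1" "spectral_proj X \<mu>0 ** spectral_proj Y \<nu>2 \<noteq> 0" by auto
  have "cspec X \<subseteq> fst ` (P - {(\<mu>0, \<nu>2)})"
  proof
    fix \<mu> assume m: "\<mu> \<in> cspec X"
    show "\<mu> \<in> fst ` (P - {(\<mu>0, \<nu>2)})"
    proof (cases "\<mu> = \<mu>0")
      case True
      then have "(\<mu>, \<nu>1) \<in> P - {(\<mu>0, \<nu>2)}" using mu0 n1 n2 by (auto simp: P_def)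
      then show ?thesis by force
    next
      case False
      obtain \<nu> where "\<nu> \<in> cspec Y" "spectral_proj X \<mu> ** spectral_proj Y \<nu> \<noteq> 0"
        using exists_nonzero_spectral_proj[OF spectral_proj_nonzero[OF m]] by blast
      then have "(\<mu>, \<nu>) \<in> P - {(\<mu>0, \<nu>2)}" using m False by (auto simp: P_def)
      then show ?thesis by force
    qed
  qed
  then have "card (cspec X) \<le> card (P - {(\<mu>0, \<nu>2)})"
    using finP by (meson card_image_le card_mono finite_Diff finite_imageI le_trans)
  moreover have "(\<mu>0, \<nu>2) \<in> P" using mu0 n2 by (simp add: P_def)
  ultimately have big: "card (cspec X) < card P"
    using finP by (metis card_Diff1_less le_less_trans)
  \<comment> \<open>Scalars for which two of the sums \<open>\<mu> + c \<nu>\<close> coincide.\<close>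
  define bad where "bad = (\<lambda>((a, b), (a', b')). (a - a') / (b' - b)) ` (P \<times> P)"
  have "finite bad" unfolding bad_def using finP by blast
  then obtain c :: complex where c: "c \<notin> bad"
    using ex_new_if_finite[OF infinite_UNIV_char_0] by blast
  define s where "s = (\<lambda>(a, b). a + c * b)"
  have inj: "inj_on s P"
  proof (rule inj_onI)
    fix p p' assume p: "p \<in> P" "p' \<in> P" "s p = s p'"
    obtain a b a' b' where ab: "p = (a, b)" "p' = (a', b')" by (cases p, cases p') auto
    have eq: "a - a' = c * (b' - b)" using p(3) by (simp add: s_def ab algebra_simps)
    show "p = p'"
    proof (cases "b = b'")
      case False
      then have "c = (a - a') / (b' - b)" using eq by simp
      then have "c \<in> bad" unfolding bad_def using p ab by (intro image_eqI[of _ _ "(p, p')"]) auto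
      then show ?thesis using c by simp
    qed (use eq ab in simp)
  qed
  define Z where "Z = X + c *\<^sub>C Y"
  have ZU: "Z \<in> U" unfolding Z_def using U(1) XU Y
    by (simp add: cmat.subspace_add cmat.subspace_scale)
  have "s ` P \<subseteq> cspec Z"
  proof
    fix x assume "x \<in> s ` P"
    then obtain a b where ab: "a \<in> cspec X" "b \<in> cspec Y" "spectral_proj X a ** spectral_proj Y b \<noteq> 0" "x = a + c * b"
      by (auto simp: P_def s_def)
    obtain \<xi> where xi: "\<xi> \<in> cspec Z" "(spectral_proj X a ** spectral_proj Y b) ** spectral_proj Z \<xi> \<noteq> 0"
      using exists_nonzero_spectral_proj[OF ab(3)] by blast
    let ?e = "spectral_proj X a" and ?f = "spectral_proj Y b" and ?h = "spectral_proj Z \<xi>"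
    let ?g = "(?e ** ?f) ** ?h"
    note id = spectral_proj_idem[OF ab(1)] spectral_proj_idem[OF ab(2)] spectral_proj_idem[OF xi(1)]
    have ef: "?e ** ?f = ?f ** ?e" and eh: "?e ** ?h = ?h ** ?e" and fh: "?f ** ?h = ?h ** ?f"
      using comm2 XU Y ZU ab xi by auto
    have efh: "(?e ** ?f) ** ?h = ?h ** (?e ** ?f)"
      by (metis eh fh matrix_mul_assoc)
    have g: "?g ** ?g = ?g" by (intro idempotent_mult id ef efh)
    have gc: "A ** ?g = ?g ** A" if "A \<in> U" for A
      using comm[OF XU that ab(1)] comm[OF Y that ab(2)] comm[OF ZU that xi(1)]
      by (metis matrix_mul_assoc)
    have k: "matpow (X - a *\<^sub>C mat 1) (matdim TYPE('a)) ** ?g = 0"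
      using spectral_proj_nilpotent[OF ab(1)] by (metis matmul_zero(2) matrix_mul_assoc)
    have "?g = ?f ** (?e ** ?h)" using ef by (metis matrix_mul_assoc)
    then have l: "matpow (Y - b *\<^sub>C mat 1) (matdim TYPE('a)) ** ?g = 0"
      using spectral_proj_nilpotent[OF ab(2)] by (metis matmul_zero(2) matrix_mul_assoc)
    have m: "matpow (Z - \<xi> *\<^sub>C mat 1) (matdim TYPE('a)) ** ?g = 0"
      using spectral_proj_nilpotent[OF xi(1)] efh by (metis matmul_zero(2) matrix_mul_assoc)
    \<comment> \<open>\<open>X\<close> and \<open>Y\<close> need not commute on the common block, so the eigenvalue of their
      combination is read off from the trace.\<close>
    have "\<xi> * trace ?g = trace (Z ** ?g)" by (rule trace_block[OF g gc[OF ZU] m, symmetric])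
    also have "\<dots> = trace (X ** ?g) + c * trace (Y ** ?g)"
      by (simp only: Z_def matmul_ring trace_add trace_cscale)
    also have "\<dots> = x * trace ?g"
      unfolding trace_block[OF g gc[OF XU] k] trace_block[OF g gc[OF Y] l] ab(4)
      by (simp add: algebra_simps)
    finally have "\<xi> = x" using trace_idempotent[OF g xi(2)] by simp
    then show "x \<in> cspec Z" using xi(1) by simp
  qed
  then have "card P \<le> card (cspec Z)"
    using card_image[OF inj] card_mono[OF cspec_finite_card(1)] by metis
  also have "\<dots> \<le> card (cspec X)" using X ZU by (simp add: generic_in_def)
  finally show False using big by simp
qed

lemma generic_spectral_proj_eq:
  assumes U: "cmat.subspace U" "ad_nilpotent_on U" and X: "generic_in U X" and Y: "generic_in U Y"
    and mu: "\<mu> \<in> cspec X"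
  shows "\<exists>\<nu>\<in>cspec Y. spectral_proj X \<mu> = spectral_proj Y \<nu>"
proof -
  have XU: "X \<in> U" "Y \<in> U" using X Y by (simp_all add: generic_in_def)
  obtain \<nu> where nu: "\<nu> \<in> cspec Y" "spectral_proj X \<mu> ** spectral_proj Y \<nu> = spectral_proj X \<mu>"
    using generic_spectral_proj_le[OF U X XU(2) mu] by blast
  obtain \<mu>' where mu': "\<mu>' \<in> cspec X" "spectral_proj Y \<nu> ** spectral_proj X \<mu>' = spectral_proj Y \<nu>"
    using generic_spectral_proj_le[OF U Y XU(1) nu(1)] by blast
  have "spectral_proj X \<mu> = spectral_proj X \<mu> ** spectral_proj Y \<nu> ** spectral_proj X \<mu>'"
    using nu(2) mu'(2) by (metis matrix_mul_assoc)
  also have "\<dots> = spectral_proj X \<mu> ** spectral_proj X \<mu>'" by (simp add: nu(2))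
  finally have "\<mu>' = \<mu>" using spectral_proj_orthogonal[of \<mu> \<mu>' X] spectral_proj_nonzero[OF mu] by metis
  moreover have "spectral_proj X \<mu> ** spectral_proj Y \<nu> = spectral_proj Y \<nu> ** spectral_proj X \<mu>"
  proof (rule spectral_proj_commute[symmetric])
    have "spectral_proj X \<mu> ** Y = Y ** spectral_proj X \<mu>"
      using spectral_proj_commute_ad_nilpotent[OF mu] U(2) XU unfolding ad_nilpotent_on_def by blast
    then show "Y ** spectral_proj X \<mu> = spectral_proj X \<mu> ** Y" by simp
  qed
  ultimately show ?thesis using nu mu'(2) by metis
qed

lemma peval_Ad:
  assumes "invertible g" shows "peval p (Ad g A) = Ad g (peval p A)"
  by (induction p) (simp_all add: peval_pCons Ad_simps[OF assms])

lemma bracket_Ad: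
  assumes "invertible g" shows "bracket (Ad g X) (Ad g Y) = Ad g (bracket X Y)"
  by (simp add: bracket_def Ad_simps[OF assms])

lemma cspec_Ad_subset:
  assumes "invertible g" shows "cspec (Ad g A) \<subseteq> cspec A"
proof
  fix \<mu> assume "\<mu> \<in> cspec (Ad g A)"
  then have "\<not> invertible (Ad g A - \<mu> *\<^sub>C mat 1)" by (simp add: cspec_def)
  moreover have "Ad g A - \<mu> *\<^sub>C mat 1 = Ad g (A - \<mu> *\<^sub>C mat 1)" by (simp add: Ad_simps[OF assms])
  moreover have "invertible (Ad g B)" if "invertible B" for B
    unfolding Ad_def by (intro invertible_mult assms that invertible_matrix_inv)
  ultimately show "\<mu> \<in> cspec A" by (auto simp: cspec_def)
qed

lemma cspec_Ad:
  assumes "invertible g" shows "cspec (Ad g A) = cspec A"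
proof
  show "cspec (Ad g A) \<subseteq> cspec A" by (rule cspec_Ad_subset[OF assms])
  show "cspec A \<subseteq> cspec (Ad g A)"
    using cspec_Ad_subset[OF invertible_matrix_inv[OF assms], of "Ad g A"]
    unfolding Ad_simps(7)[OF assms] .
qed

lemma spectral_proj_Ad: "invertible g \<Longrightarrow> spectral_proj (Ad g A) \<mu> = Ad g (spectral_proj A \<mu>)"
  unfolding spectral_proj_def by (simp only: cspec_Ad peval_Ad)

lemma ad_nilpotent_on_Ad:
  assumes "invertible g" "ad_nilpotent_on U" shows "ad_nilpotent_on (Ad g ` U)"
proof -
  have "(bracket (Ad g X) ^^ k) (Ad g Y) = Ad g ((bracket X ^^ k) Y)" for X Y k
    by (induction k) (simp_all add: bracket_Ad[OF assms(1)])
  note ad = this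
  show ?thesis unfolding ad_nilpotent_on_def
  proof (intro ballI)
    fix X Y assume "X \<in> Ad g ` U" "Y \<in> Ad g ` U"
    then obtain X' Y' where XY: "X' \<in> U" "Y' \<in> U" "X = Ad g X'" "Y = Ad g Y'" by blast
    then obtain k where k: "(bracket X' ^^ k) Y' = 0"
      using assms(2) unfolding ad_nilpotent_on_def by blast
    have "(bracket X ^^ k) Y = 0" unfolding XY(3,4) ad k by (rule Ad_simps(5)[OF assms(1)])
    then show "\<exists>k. (bracket X ^^ k) Y = 0" ..
  qed
qed

lemma generic_Ad:
  assumes "invertible g" "generic_in U X" shows "generic_in (Ad g ` U) (Ad g X)"
  unfolding generic_in_def
proof (intro conjI ballI)
  show "Ad g X \<in> Ad g ` U" using assms(2) by (simp add: generic_in_def)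
  fix Z assume "Z \<in> Ad g ` U"
  then obtain Z' where "Z' \<in> U" "Z = Ad g Z'" by blast
  then show "card (cspec Z) \<le> card (cspec (Ad g X))"
    using assms(2) by (simp add: generic_in_def cspec_Ad[OF assms(1)])
qed

lemma subspace_Ad:
  assumes "invertible g" "cmat.subspace U" shows "cmat.subspace (Ad g ` U)"
  unfolding cmat.subspace_def
proof (intro conjI ballI allI)
  show "0 \<in> Ad g ` U"
    using Ad_simps(5)[OF assms(1)] cmat.subspace_0[OF assms(2)] by (metis imageI)
next
  fix x y assume "x \<in> Ad g ` U" "y \<in> Ad g ` U"
  then obtain a b where "a \<in> U" "b \<in> U" "x = Ad g a" "y = Ad g b" by blast
  then show "x + y \<in> Ad g ` U"
    using cmat.subspace_add[OF assms(2)] by (auto simp: Ad_simps(1)[OF assms(1), symmetric])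
next
  fix c x assume "x \<in> Ad g ` U"
  then obtain a where "a \<in> U" "x = Ad g a" by blast
  then show "c *\<^sub>C x \<in> Ad g ` U"
    using cmat.subspace_scale[OF assms(2)] by (auto simp: Ad_simps(2)[OF assms(1), symmetric])
qed

section \<open>Continuity of spectral projections\<close>

text \<open>Without a bound on the degrees, coefficientwise convergence would not allow one to pass
  to the limit in the values at a matrix.\<close>

definition poly_tendsto :: "(nat \<Rightarrow> complex poly) \<Rightarrow> complex poly \<Rightarrow> bool"
  where "poly_tendsto p q \<longleftrightarrow> (\<exists>d. \<forall>n. degree (p n) \<le> d) \<and> (\<forall>k. (\<lambda>n. coeff (p n) k) \<longlonglongrightarrow> coeff q k)"

lemma poly_tendsto_const: "poly_tendsto (\<lambda>n. p) p" by (auto simp: poly_tendsto_def)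

lemma poly_tendsto_linear:
  assumes "a \<longlonglongrightarrow> l" shows "poly_tendsto (\<lambda>n. [:- a n, 1:]) [:- l, 1:]"
  unfolding poly_tendsto_def
proof (intro conjI allI)
  show "\<exists>d. \<forall>n. degree [:- a n, 1:] \<le> d" by (auto intro: exI[of _ 1])
  show "(\<lambda>n. coeff [:- a n, 1:] k) \<longlonglongrightarrow> coeff [:- l, 1:] k" for k
    using assms by (cases k) (auto simp: coeff_pCons intro: tendsto_intros)
qed

lemma poly_tendsto_diff: "poly_tendsto p q \<Longrightarrow> poly_tendsto p' q' \<Longrightarrow> poly_tendsto (\<lambda>n. p n - p' n) (q - q')"
  unfolding poly_tendsto_def
proof (intro conjI allI, goal_cases)
  case 1
  then obtain d d' where "\<forall>n. degree (p n) \<le> d" "\<forall>n. degree (p' n) \<le> d'" by auto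
  then have "\<forall>n. degree (p n - p' n) \<le> max d d'"
    by (meson degree_diff_le le_max_iff_disj)
  then show ?case by blast
qed (auto intro: tendsto_intros)

lemma poly_tendsto_smult: "c \<longlonglongrightarrow> l \<Longrightarrow> poly_tendsto p q \<Longrightarrow> poly_tendsto (\<lambda>n. smult (c n) (p n)) (smult l q)"
  unfolding poly_tendsto_def coeff_smult
  by (intro conjI allI tendsto_mult) (auto intro: order_trans[OF degree_smult_le])

lemma poly_tendsto_mult: "poly_tendsto p q \<Longrightarrow> poly_tendsto p' q' \<Longrightarrow> poly_tendsto (\<lambda>n. p n * p' n) (q * q')"
  unfolding poly_tendsto_def
proof (intro conjI allI, goal_cases)
  case 1
  then obtain d d' where "\<forall>n. degree (p n) \<le> d" "\<forall>n. degree (p' n) \<le> d'" by auto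
  then have "\<forall>n. degree (p n * p' n) \<le> d + d'"
    by (meson add_mono degree_mult_le le_trans)
  then show ?case by blast
next
  case (2 k)
  then show ?case unfolding coeff_mult by (intro tendsto_sum tendsto_mult) auto
qed

lemma poly_tendsto_power: "poly_tendsto p q \<Longrightarrow> poly_tendsto (\<lambda>n. p n ^ k) (q ^ k)"
proof (induction k)
  case (Suc k)
  show ?case unfolding power_Suc by (rule poly_tendsto_mult[OF Suc.prems Suc.IH[OF Suc.prems]])
qed (simp add: poly_tendsto_const)

lemma poly_tendsto_prod: "(\<And>i. i \<in> I \<Longrightarrow> poly_tendsto (\<lambda>n. p n i) (q i)) \<Longrightarrow> poly_tendsto (\<lambda>n. \<Prod>i\<in>I. p n i) (\<Prod>i\<in>I. q i)"
proof (induction I rule: infinite_finite_induct)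
  case (insert i I)
  have "poly_tendsto (\<lambda>n. p n i * (\<Prod>i\<in>I. p n i)) (q i * (\<Prod>i\<in>I. q i))"
    by (rule poly_tendsto_mult) (use insert in auto)
  then show ?case using insert by simp
qed (simp_all add: poly_tendsto_const)

lemma matpow_tendsto: "X \<longlonglongrightarrow> L \<Longrightarrow> (\<lambda>n. matpow (X n) k) \<longlonglongrightarrow> matpow L k"
  by (induction k) (simp_all add: continuous_matmul)

lemma peval_tendsto:
  assumes "poly_tendsto p q" "X \<longlonglongrightarrow> L" shows "(\<lambda>n. peval (p n) (X n)) \<longlonglongrightarrow> peval q L"
proof -
  obtain d where d: "\<And>n. degree (p n) \<le> d" using assms(1) unfolding poly_tendsto_def by blast
  have co: "(\<lambda>n. coeff (p n) k) \<longlonglongrightarrow> coeff q k" for k using assms(1) by (simp add: poly_tendsto_def)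
  have dq: "degree q \<le> d"
  proof (rule degree_le, intro allI impI)
    fix k assume "d < k"
    then have "coeff (p n) k = 0" for n using d[of n] by (intro coeff_eq_0) simp
    then show "coeff q k = 0" using co[of k] by (simp add: LIMSEQ_const_iff)
  qed
  show ?thesis unfolding peval_bound[OF d] peval_bound[OF dq]
    by (intro tendsto_sum continuous_cscale co matpow_tendsto assms(2))
qed

lemma cspec_bound:
  fixes A :: "'n::finite cmat"
  assumes "\<mu> \<in> cspec A" shows "cmod \<mu> \<le> real CARD('n) * norm A"
proof -
  have "\<not> (\<exists>B. B ** (A - \<mu> *\<^sub>C mat 1) = mat 1)"
    using assms by (simp add: cspec_def invertible_left_inverse)
  then obtain v where v: "(A - \<mu> *\<^sub>C mat 1) *v v = 0" "v \<noteq> 0"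
    unfolding matrix_left_invertible_ker by blast
  have eq: "\<mu> * v $ i = (\<Sum>j\<in>UNIV. A $ i $ j * v $ j)" for i
  proof -
    have "((\<mu> *\<^sub>C mat 1) *v v) $ i = (\<Sum>j\<in>UNIV. \<mu> * (if i = j then 1 else 0) * v $ j)"
      by (simp add: matrix_vector_mult_def mat_def)
    also have "\<dots> = (\<Sum>j\<in>UNIV. if i = j then \<mu> * v $ j else 0)" by (rule sum.cong) auto
    also have "\<dots> = \<mu> * v $ i" by simp
    finally have "((\<mu> *\<^sub>C mat 1) *v v) $ i = \<mu> * v $ i" .
    moreover have "A *v v = (\<mu> *\<^sub>C mat 1) *v v"
      using v(1) by (simp add: matrix_vector_mult_diff_rdistrib)
    ultimately have "(A *v v) $ i = \<mu> * v $ i" by metis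
    then show ?thesis by (simp add: matrix_vector_mult_def)
  qed
  let ?R = "range (\<lambda>j. cmod (v $ j))"
  have "Max ?R \<in> ?R" by (rule Max_in) auto
  then obtain i where i': "Max ?R = cmod (v $ i)" by blast
  have i: "cmod (v $ j) \<le> cmod (v $ i)" for j unfolding i'[symmetric] by (rule Max_ge) auto
  have pos: "cmod (v $ i) > 0"
  proof (rule ccontr)
    assume "\<not> ?thesis"
    then have "v $ j = 0" for j using i[of j] by simp
    then show False using v(2) by (simp add: vec_eq_iff)
  qed
  have "cmod \<mu> * cmod (v $ i) \<le> (\<Sum>j\<in>UNIV. cmod (A $ i $ j * v $ j))"
    unfolding norm_mult[symmetric] eq by (rule norm_sum)
  also have "\<dots> \<le> (\<Sum>j\<in>(UNIV :: 'n set). norm A * cmod (v $ i))"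
  proof (rule sum_mono)
    fix j
    have "cmod (A $ i $ j) \<le> norm A"
      using Finite_Cartesian_Product.norm_nth_le[of "A $ i" j] Finite_Cartesian_Product.norm_nth_le[of A i] by linarith
    then show "cmod (A $ i $ j * v $ j) \<le> norm A * cmod (v $ i)"
      unfolding norm_mult using i[of j] by (intro mult_mono) auto
  qed
  also have "\<dots> = (real CARD('n) * norm A) * cmod (v $ i)" by simp
  finally show ?thesis using pos by simp
qed

text \<open>Eigenvalues cannot merge in the limit when their number does not drop, so that the
  Lagrange denominators stay away from \<open>0\<close>.\<close>

lemma spectral_proj_bounded_along_subsequence:
  fixes X :: "nat \<Rightarrow> 'n::finite cmat"
  assumes lim: "X \<longlonglongrightarrow> L" and card: "\<And>n. card (cspec (X n)) \<le> card (cspec L)"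
  shows "\<exists>(\<sigma> :: nat \<Rightarrow> nat) B. strict_mono \<sigma> \<and> (\<forall>n. card (cspec (X (\<sigma> n))) = card (cspec L) \<and>
    (\<forall>\<nu>\<in>cspec (X (\<sigma> n)). norm (spectral_proj (X (\<sigma> n)) \<nu>) \<le> B))"
proof -
  define m where "m = card (cspec L)"
  let ?N = "matdim TYPE('n)"
  have "\<exists>f. f ` {..<m} = cspec (X n)" for n
  proof -
    obtain h where h: "bij_betw h {0..<card (cspec (X n))} (cspec (X n))"
      using ex_bij_betw_nat_finite[OF cspec_finite_card(1)] by blast
    have pos: "0 < card (cspec (X n))" 
      using cspec_nonempty[of "X n"] cspec_finite_card(1)[of "X n"] by (simp add: card_gt_0_iff)
    define f where "f i = (if i < card (cspec (X n)) then h i else h 0)" for i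
    have "f ` {..<m} \<subseteq> h ` {0..<card (cspec (X n))}" using pos by (auto simp: f_def)
    moreover have "h ` {0..<card (cspec (X n))} \<subseteq> f ` {..<m}"
    proof
      fix y assume "y \<in> h ` {0..<card (cspec (X n))}"
      then obtain i where "i < card (cspec (X n))" "y = h i" by auto
      then show "y \<in> f ` {..<m}" using card[of n] by (intro image_eqI[of _ _ i]) (auto simp: f_def m_def)
    qed
    ultimately show ?thesis using h by (auto simp: bij_betw_def)
  qed
  then obtain \<nu> where nu: "\<And>n. \<nu> n ` {..<m} = cspec (X n)" by metis
  obtain C where C: "\<And>n. norm (X n) \<le> C"
    using convergent_imp_Bseq[OF convergentI[OF lim]] by (auto simp: Bseq_def)
  have "bounded (range (\<lambda>n. \<nu> n i))" if "i \<in> {..<m}" for i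
  proof (rule boundedI)
    fix z assume "z \<in> range (\<lambda>n. \<nu> n i)"
    then obtain n where z: "z = \<nu> n i" by auto
    then have "z \<in> cspec (X n)" using nu[of n] that by auto
    then have "cmod z \<le> real CARD('n) * norm (X n)" by (rule cspec_bound)
    also have "\<dots> \<le> real CARD('n) * C" using C by (intro mult_left_mono) auto
    finally show "norm z \<le> real CARD('n) * C" .
  qed
  then obtain \<rho> where rho: "strict_mono \<rho>" "\<forall>i\<in>{..<m}. convergent (\<lambda>n. \<nu> (\<rho> n) i)"
    using bounded_family_convergent_subseq[of "{..<m}" \<nu>] by auto
  then obtain l where l: "\<And>i. i < m \<Longrightarrow> (\<lambda>n. \<nu> (\<rho> n) i) \<longlonglongrightarrow> l i"
    unfolding convergent_def by (metis lessThan_iff)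
  have limr: "(\<lambda>n. X (\<rho> n)) \<longlonglongrightarrow> L" using LIMSEQ_subseq_LIMSEQ[OF lim rho(1)] by (simp add: o_def)
  \<comment> \<open>In the limit the polynomial with roots \<open>l i\<close> annihilates \<open>L\<close>, so these \<open>m\<close> numbers
    exhaust the \<open>m\<close> eigenvalues of \<open>L\<close> and are pairwise different.\<close>
  define q where "q = (\<Prod>i<m. [:- l i, 1:] ^ ?N)"
  have "poly_tendsto (\<lambda>n. \<Prod>i<m. [:- \<nu> (\<rho> n) i, 1:] ^ ?N) q"
    unfolding q_def by (intro poly_tendsto_prod poly_tendsto_power poly_tendsto_linear l) auto
  moreover have "peval (\<Prod>i<m. [:- \<nu> (\<rho> n) i, 1:] ^ ?N) (X (\<rho> n)) = 0" for n
  proof (rule peval_zeroI)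
    fix \<xi> assume "\<xi> \<in> cspec (X (\<rho> n))"
    then obtain i where "i < m" "\<xi> = \<nu> (\<rho> n) i" using nu[of "\<rho> n"] by auto
    then show "[:-\<xi>, 1:] ^ ?N dvd (\<Prod>i<m. [:- \<nu> (\<rho> n) i, 1:] ^ ?N)"
      by (auto intro: dvd_prodI)
  qed
  ultimately have "(\<lambda>n. 0) \<longlonglongrightarrow> peval q L" using peval_tendsto[OF _ limr] by fastforce
  then have "peval q L = 0" by (simp add: LIMSEQ_const_iff)
  then have sub: "cspec L \<subseteq> l ` {..<m}"
    using cspec_root[of q L] by (auto simp: q_def poly_prod)
  have "m \<le> card (l ` {..<m})" unfolding m_def using card_mono[OF _ sub] by (simp add: m_def)
  then have "card (l ` {..<m}) = card {..<m}" using card_image_le[of "{..<m}" l] by simp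
  then have inj: "inj_on l {..<m}" by (intro eq_card_imp_inj_on) auto
  have "eventually (\<lambda>n. \<nu> (\<rho> n) i \<noteq> \<nu> (\<rho> n) j) sequentially" if "i < m" "j < m" "i \<noteq> j" for i j
  proof -
    have "(\<lambda>n. \<nu> (\<rho> n) i - \<nu> (\<rho> n) j) \<longlonglongrightarrow> l i - l j" using that by (intro tendsto_diff l)
    moreover have "l i - l j \<noteq> 0" using inj that by (auto simp: inj_on_def)
    ultimately have "eventually (\<lambda>n. \<nu> (\<rho> n) i - \<nu> (\<rho> n) j \<noteq> 0) sequentially"
      by (rule tendsto_imp_eventually_ne)
    then show ?thesis by simp
  qed
  then have "eventually (\<lambda>n. \<forall>i\<in>{..<m}. \<forall>j\<in>{..<m}. i \<noteq> j \<longrightarrow> \<nu> (\<rho> n) i \<noteq> \<nu> (\<rho> n) j) sequentially"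
    by (intro eventually_ball_finite ballI) (auto intro: always_eventually eventually_mono)
  then obtain n0 where "\<And>n. n \<ge> n0 \<Longrightarrow> \<forall>i\<in>{..<m}. \<forall>j\<in>{..<m}. i \<noteq> j \<longrightarrow> \<nu> (\<rho> n) i \<noteq> \<nu> (\<rho> n) j"
    unfolding eventually_sequentially by blast
  then have inj': "inj_on (\<nu> (\<rho> n)) {..<m}" if "n \<ge> n0" for n
    using that unfolding inj_on_def by blast
  define pp where "pp \<xi> i = 1 - (1 - (\<Prod>j\<in>{..<m} - {i}. smult (1 / (\<xi> i - \<xi> j)) [:-\<xi> j, 1:]) ^ ?N) ^ ?N"
    for \<xi> :: "nat \<Rightarrow> complex" and i
  have pp: "spectral_poly ?N (\<xi> ` {..<m}) (\<xi> i) = pp \<xi> i" if "inj_on \<xi> {..<m}" "i < m" for \<xi> i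
  proof -
    have "\<xi> ` {..<m} - {\<xi> i} = \<xi> ` ({..<m} - {i})" using that by (auto simp: inj_on_def)
    then have "lagrange_poly (\<xi> ` {..<m}) (\<xi> i) = (\<Prod>j\<in>{..<m} - {i}. smult (1 / (\<xi> i - \<xi> j)) [:-\<xi> j, 1:])"
      unfolding lagrange_poly_def using that by (simp add: prod.reindex inj_on_diff)
    then show ?thesis by (simp add: spectral_poly_def pp_def)
  qed
  have "Bseq (\<lambda>n. peval (pp (\<nu> (\<rho> n)) i) (X (\<rho> n)))" if i: "i < m" for i
  proof -
    have "(\<lambda>n. 1 / (\<nu> (\<rho> n) i - \<nu> (\<rho> n) j)) \<longlonglongrightarrow> 1 / (l i - l j)" if "j < m" "j \<noteq> i" for j
      using that i inj by (intro tendsto_intros l) (auto simp: inj_on_def)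
    then have "poly_tendsto (\<lambda>n. pp (\<nu> (\<rho> n)) i) (pp l i)"
      unfolding pp_def using i by (intro poly_tendsto_diff poly_tendsto_power poly_tendsto_prod poly_tendsto_smult poly_tendsto_linear poly_tendsto_const l) auto
    from peval_tendsto[OF this limr] show ?thesis
      by (intro convergent_imp_Bseq convergentI)
  qed
  then have "\<forall>i. \<exists>b. i < m \<longrightarrow> b > 0 \<and> (\<forall>n. norm (peval (pp (\<nu> (\<rho> n)) i) (X (\<rho> n))) \<le> b)"
    unfolding Bseq_def by blast
  then obtain b where b: "\<And>i. i < m \<Longrightarrow> b i > 0"
      "\<And>i n. i < m \<Longrightarrow> norm (peval (pp (\<nu> (\<rho> n)) i) (X (\<rho> n))) \<le> b i"
    by metis
  define \<sigma> where "\<sigma> n = \<rho> (n + n0)" for n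
  have "strict_mono \<sigma>" using rho(1) by (simp add: \<sigma>_def strict_mono_def)
  moreover have "card (cspec (X (\<sigma> n))) = card (cspec L)" for n
    using card_image[OF inj', of "n + n0"] nu[of "\<sigma> n"] by (simp add: m_def[symmetric] \<sigma>_def)
  moreover have "norm (spectral_proj (X (\<sigma> n)) \<xi>) \<le> (\<Sum>i<m. b i)" if xi: "\<xi> \<in> cspec (X (\<sigma> n))" for n \<xi>
  proof -
    obtain i where i: "i < m" "\<xi> = \<nu> (\<sigma> n) i" using xi nu[of "\<sigma> n"] by auto
    have "spectral_proj (X (\<sigma> n)) \<xi> = peval (pp (\<nu> (\<sigma> n)) i) (X (\<sigma> n))"
      unfolding spectral_proj_def nu[symmetric] i(2) using pp[OF inj' i(1)] by (simp add: \<sigma>_def)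
    then have "norm (spectral_proj (X (\<sigma> n)) \<xi>) \<le> b i" using b(2)[OF i(1)] by (simp add: \<sigma>_def)
    also have "\<dots> \<le> (\<Sum>i<m. b i)" using i(1) b(1) by (intro member_le_sum) (auto intro: less_imp_le)
    finally show ?thesis .
  qed
  ultimately have "strict_mono \<sigma> \<and> (\<forall>n. card (cspec (X (\<sigma> n))) = card (cspec L) \<and>
      (\<forall>\<xi>\<in>cspec (X (\<sigma> n)). norm (spectral_proj (X (\<sigma> n)) \<xi>) \<le> (\<Sum>i<m. b i)))"
    by simp
  then show ?thesis by blast
qed

section \<open>Pluecker coordinates\<close>

lemma entries_simps [simp]:
  "entries (A + B) e = entries A e + entries B e" "entries (A - B) e = entries A e - entries B e"
  "entries (c *\<^sub>C A) e = c * entries A e" "entries 0 e = 0"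
  by (cases e; simp add: entries_def)+

lemma entries_sum [simp]: "entries (\<Sum>i\<in>I. f i) e = (\<Sum>i\<in>I. entries (f i) e)"
  by (induction I rule: infinite_finite_induct) auto

lemma entries_eqI:
  assumes "\<And>e. entries A e = entries B e" shows "A = B"
proof -
  have "A $ i $ j = B $ i $ j" for i j using assms[of "(i, j)"] by (simp add: entries_def)
  then show ?thesis by (simp add: vec_eq_iff)
qed

lemma pluecker_det:
  "pluecker r b s = Determinant.det (Matrix.mat r r (\<lambda>(i, j). entries (b j) (s i)))"
proof -
  have "Determinant.det (Matrix.mat r r (\<lambda>(i, j). entries (b j) (s i))) =
      (\<Sum>p | p permutes {0..<r}. signof p * (\<Prod>i=0..<r. entries (b (p i)) (s i)))"
    by (subst det_def'[of _ r]) (auto intro!: sum.cong prod.cong simp: permutes_in_image)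
  then show ?thesis
    by (simp add: pluecker_def atLeast0LessThan)
qed

lemma pluecker_cong: "(\<And>i. i < r \<Longrightarrow> s i = s' i) \<Longrightarrow> pluecker r b s = pluecker r b s'"
  unfolding pluecker_def by (auto intro!: sum.cong prod.cong)

text \<open>Two rows of the determinant agree.\<close>

lemma pluecker_repeated:
  assumes "k < r" "l < r" "k \<noteq> l" "s k = s l" shows "pluecker r b s = 0"
  unfolding pluecker_det
  by (rule det_identical_rows[of _ r k l]) (use assms in \<open>auto intro!: eq_vecI\<close>)

lemma pluecker_linear_change:
  assumes "\<And>j. j < r \<Longrightarrow> b' j = (\<Sum>i<r. c j i *\<^sub>C b i)"
  shows "\<exists>d. \<forall>s. pluecker r b' s = d * pluecker r b s"
proof (intro exI allI)
  fix s
  let ?M = "Matrix.mat r r (\<lambda>(i, j). entries (b j) (s i))"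
  let ?C = "Matrix.mat r r (\<lambda>(i, j). c j i)"
  have "Matrix.mat r r (\<lambda>(i, j). entries (b' j) (s i)) = ?M * ?C"
    by (rule eq_matI) (auto simp: assms scalar_prod_def atLeast0LessThan mult.commute)
  then show "pluecker r b' s = Determinant.det ?C * pluecker r b s"
    unfolding pluecker_det by (simp add: det_mult[of _ r])
qed

lemma is_basis_coords:
  assumes "is_basis r b U" "x \<in> U" shows "\<exists>c. x = (\<Sum>i<r. c i *\<^sub>C b i)"
proof -
  have "x \<in> cmat.span (b ` {..<r})" and inj: "inj_on b {..<r}"
    using assms by (auto simp: is_basis_def)
  then obtain u where "x = (\<Sum>v\<in>b ` {..<r}. u v *\<^sub>C v)"
    unfolding cmat.span_finite[OF finite_imageI[OF finite_lessThan]] by blast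
  then have "x = (\<Sum>i<r. u (b i) *\<^sub>C b i)" by (simp add: sum.reindex[OF inj])
  then show ?thesis by (rule exI[of _ "\<lambda>i. u (b i)"])
qed

lemma is_basis_mem: "is_basis r b U \<Longrightarrow> i < r \<Longrightarrow> b i \<in> U"
  by (auto simp: is_basis_def intro: cmat.span_base)

lemma is_basis_subspace: "is_basis r b U \<Longrightarrow> cmat.subspace U"
  by (auto simp: is_basis_def)

lemma is_basis_combination:
  assumes "is_basis r b U" shows "(\<Sum>i<r. c i *\<^sub>C b i) \<in> U"
proof (rule cmat.subspace_sum[OF is_basis_subspace[OF assms]])
  fix i assume "i \<in> {..<r}"
  then have "b i \<in> U" using is_basis_mem[OF assms] by simp
  then show "c i *\<^sub>C b i \<in> U" by (rule cmat.subspace_scale[OF is_basis_subspace[OF assms]])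
qed

lemma pluecker_basis_change_mult:
  assumes "is_basis r b U" "is_basis r b' U"
  shows "\<exists>d. \<forall>s. pluecker r b' s = d * pluecker r b s"
proof -
  have "\<forall>j. \<exists>c. j < r \<longrightarrow> b' j = (\<Sum>i<r. c i *\<^sub>C b i)"
    using is_basis_coords[OF assms(1)] is_basis_mem[OF assms(2)] by blast
  then obtain c where "\<And>j. j < r \<Longrightarrow> b' j = (\<Sum>i<r. c j i *\<^sub>C b i)" by metis
  then show ?thesis by (rule pluecker_linear_change)
qed

definition dual_at :: "nat \<Rightarrow> (nat \<Rightarrow> 'n::finite cmat) \<Rightarrow> (nat \<Rightarrow> 'n \<times> 'n) \<Rightarrow> bool"
  where "dual_at r v s \<longleftrightarrow> (\<forall>k<r. \<forall>l<r. entries (v k) (s l) = (if k = l then 1 else 0))"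

lemma dual_at_independent:
  assumes "dual_at r v s" shows "inj_on v {..<r}" "cmat.independent (v ` {..<r})"
proof -
  show inj: "inj_on v {..<r}"
  proof (rule inj_onI)
    fix k l assume "k \<in> {..<r}" "l \<in> {..<r}" "v k = v l"
    then have "(if k = l then 1 else 0 :: complex) = (if l = l then 1 else 0)"
      using assms unfolding dual_at_def by (metis lessThan_iff)
    then show "k = l" by (simp split: if_splits)
  qed
  show "cmat.independent (v ` {..<r})"
  proof
    assume "cmat.dependent (v ` {..<r})"
    then obtain u where u: "\<exists>w\<in>v ` {..<r}. u w \<noteq> 0" "(\<Sum>w\<in>v ` {..<r}. u w *\<^sub>C w) = 0"
      unfolding cmat.dependent_finite[OF finite_imageI[OF finite_lessThan]] by blast
    then have z: "(\<Sum>k<r. u (v k) *\<^sub>C v k) = 0" by (simp add: sum.reindex[OF inj])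
    have "u (v l) = 0" if "l < r" for l
    proof -
      have "(\<Sum>k<r. u (v k) * entries (v k) (s l)) = (\<Sum>k<r. if k = l then u (v k) else 0)"
        using assms that by (intro sum.cong) (auto simp: dual_at_def)
      also have "\<dots> = u (v l)" using that by simp
      finally show ?thesis using arg_cong[OF z, of "\<lambda>A. entries A (s l)"] by simp
    qed
    then show False using u(1) by auto
  qed
qed

text \<open>A family of vectors which restricts to the standard basis at some \<open>r\<close> positions is independent, and
  \<open>r\<close> independent vectors span a space with a basis of length \<open>r\<close>.\<close>

lemma dual_at_basis:
  assumes b: "is_basis r b U" and v: "dual_at r v s" "\<And>k. k < r \<Longrightarrow> v k \<in> U"
  shows "is_basis r v U"
  unfolding is_basis_def
proof (intro conjI dual_at_independent[OF v(1)] equalityI subsetI)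
  fix x assume "x \<in> cmat.span (v ` {..<r})"
  then show "x \<in> U"
    using cmat.span_minimal[OF _ is_basis_subspace[OF b], of "v ` {..<r}"] v(2) by auto
next
  fix x assume x: "x \<in> U"
  show "x \<in> cmat.span (v ` {..<r})"
  proof (rule ccontr)
    assume not: "x \<notin> cmat.span (v ` {..<r})"
    then have ind: "cmat.independent (insert x (v ` {..<r}))"
      using dual_at_independent(2)[OF v(1)] by (rule cmat.independent_insertI)
    have "insert x (v ` {..<r}) \<subseteq> cmat.span (b ` {..<r})"
      using x v(2) b by (auto simp: is_basis_def)
    from cmat.independent_span_bound[OF _ ind this]
    have "card (insert x (v ` {..<r})) \<le> card (b ` {..<r})" by simp
    moreover have "x \<notin> v ` {..<r}" using not cmat.span_base[of x "v ` {..<r}"] by argo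
    moreover have "card (v ` {..<r}) = r" "card (b ` {..<r}) \<le> r"
      using card_image[OF dual_at_independent(1)[OF v(1)]] card_image_le[of "{..<r}" b] by auto
    ultimately show False by simp
  qed
qed

text \<open>Gauss elimination: the next vector is reduced by the previous ones, and any of its
  remaining nonzero entries serves as the next pivot.\<close>

lemma exists_dual_at:
  assumes "is_basis r b U" "m \<le> r"
  shows "\<exists>v s. dual_at m v s \<and> (\<forall>k<m. v k \<in> cmat.span (b ` {..<m}))"
  using assms(2)
proof (induction m)
  case 0
  then show ?case by (simp add: dual_at_def)
next
  case (Suc m)
  then obtain v s where v: "dual_at m v s" "\<And>k. k < m \<Longrightarrow> v k \<in> cmat.span (b ` {..<m})" by auto
  define w where "w = b m - (\<Sum>k<m. entries (b m) (s k) *\<^sub>C v k)"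
  have inj: "inj_on b {..<r}" and ind: "cmat.independent (b ` {..<r})"
    using assms(1) by (auto simp: is_basis_def)
  have sub: "cmat.span (b ` {..<m}) \<subseteq> cmat.span (b ` {..<Suc m})"
    by (rule cmat.span_mono) auto
  have comb: "(\<Sum>k<m. entries (b m) (s k) *\<^sub>C v k) \<in> cmat.span (b ` {..<m})"
    using v(2) by (intro cmat.span_sum cmat.span_scale) auto
  have "w \<noteq> 0"
  proof
    assume "w = 0"
    then have "b m \<in> cmat.span (b ` {..<m})" using comb by (simp add: w_def)
    moreover have "b ` {..<m} \<subseteq> b ` {..<r} - {b m}"
      using Suc.prems inj_onD[OF inj, of _ m] by fastforce
    ultimately have "b m \<in> cmat.span (b ` {..<r} - {b m})" by (meson cmat.span_mono subsetD)
    moreover have "b m \<in> b ` {..<r}" using Suc.prems by auto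
    ultimately show False using ind unfolding cmat.dependent_def by blast
  qed
  then obtain e where e: "entries w e \<noteq> 0" using entries_eqI[of w 0] by auto
  define x where "x = (1 / entries w e) *\<^sub>C w"
  have ws: "entries w (s l) = 0" if "l < m" for l
  proof -
    have "(\<Sum>k<m. entries (b m) (s k) * entries (v k) (s l)) = (\<Sum>k<m. if k = l then entries (b m) (s k) else 0)"
      using v(1) that by (intro sum.cong) (auto simp: dual_at_def)
    then show ?thesis using that by (simp add: w_def)
  qed
  have xspan: "x \<in> cmat.span (b ` {..<Suc m})"
    unfolding x_def w_def using comb sub
    by (intro cmat.span_scale cmat.span_diff) (auto intro: cmat.span_base)
  define v' where "v' k = (if k = m then x else v k - entries (v k) e *\<^sub>C x)" for k
  have "dual_at (Suc m) v' (s(m := e))"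
    using v(1) e ws unfolding dual_at_def v'_def x_def by (auto simp: less_Suc_eq)
  moreover have "v' k \<in> cmat.span (b ` {..<Suc m})" if "k < Suc m" for k
    unfolding v'_def using v(2)[of k] that xspan sub
    by (auto simp: less_Suc_eq intro!: cmat.span_diff cmat.span_scale)
  ultimately show ?case by blast
qed

lemma pluecker_dual_at:
  assumes "dual_at r v s" shows "pluecker r v s = 1"
proof -
  have "Matrix.mat r r (\<lambda>(i, j). entries (v j) (s i)) = 1\<^sub>m r"
    by (rule eq_matI) (use assms in \<open>auto simp: dual_at_def\<close>)
  then show ?thesis by (simp add: pluecker_det)
qed

lemma pluecker_nonzero:
  assumes "is_basis r b U" shows "\<exists>s. pluecker r b s \<noteq> 0"
proof -
  obtain v s where v: "dual_at r v s" "\<forall>k<r. v k \<in> cmat.span (b ` {..<r})"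
    using exists_dual_at[OF assms order_refl] by blast
  then have "is_basis r v U" using dual_at_basis[OF assms v(1)] assms by (simp add: is_basis_def)
  then obtain d where "pluecker r v s = d * pluecker r b s"
    using pluecker_basis_change_mult[OF assms] by blast
  then have "pluecker r b s \<noteq> 0" using pluecker_dual_at[OF v(1)] by auto
  then show ?thesis by (intro exI[of _ s])
qed

lemma pluecker_basis_change:
  assumes "is_basis r b U" "is_basis r b' U"
  shows "\<exists>d. d \<noteq> 0 \<and> pluecker r b' = (\<lambda>s. d * pluecker r b s)"
proof -
  obtain d where d: "\<forall>s. pluecker r b' s = d * pluecker r b s"
    using pluecker_basis_change_mult[OF assms] by blast
  moreover have "d \<noteq> 0" using d pluecker_nonzero[OF assms(2)] by auto
  ultimately show ?thesis by (auto simp: fun_eq_iff)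
qed

text \<open>Letting one position run over all entries turns a point in Pluecker coordinates into
  vectors of the subspace; if the coordinate at \<open>s\<close> is nonzero they form a basis
  (this is Cramer's rule).\<close>

definition pluecker_vec :: "((nat \<Rightarrow> 'n \<times> 'n) \<Rightarrow> complex) \<Rightarrow> (nat \<Rightarrow> 'n \<times> 'n) \<Rightarrow> nat \<Rightarrow> 'n::finite cmat"
  where "pluecker_vec x s k = (\<chi> i j. x (s(k := (i, j))))"

lemma entries_pluecker_vec: "entries (pluecker_vec x s k) e = x (s(k := e))"
  by (cases e) (simp add: entries_def pluecker_vec_def)

lemma pluecker_vec_mem:
  assumes b: "is_basis r b U" and k: "k < r" shows "pluecker_vec (pluecker r b) s k \<in> U"
proof -
  let ?c = "\<lambda>\<sigma>. of_int (sign \<sigma>) * (\<Prod>j\<in>{..<r} - {k}. entries (b (\<sigma> j)) (s j))"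
  have "pluecker_vec (pluecker r b) s k = (\<Sum>\<sigma> | \<sigma> permutes {..<r}. ?c \<sigma> *\<^sub>C b (\<sigma> k))"
  proof (rule entries_eqI)
    fix e
    have "(\<Prod>j<r. entries (b (\<sigma> j)) ((s(k := e)) j)) =
        entries (b (\<sigma> k)) e * (\<Prod>j\<in>{..<r} - {k}. entries (b (\<sigma> j)) (s j))" for \<sigma>
      using k by (subst prod.remove[of _ k]) (auto intro!: prod.cong)
    then show "entries (pluecker_vec (pluecker r b) s k) e =
        entries (\<Sum>\<sigma> | \<sigma> permutes {..<r}. ?c \<sigma> *\<^sub>C b (\<sigma> k)) e"
      unfolding entries_pluecker_vec pluecker_def by (simp add: mult_ac)
  qed
  also have "\<dots> \<in> U"
  proof (intro cmat.subspace_sum cmat.subspace_scale is_basis_subspace[OF b])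
    fix \<sigma> assume "\<sigma> \<in> {\<sigma>. \<sigma> permutes {..<r}}"
    then have "\<sigma> k < r" using k permutes_in_image[of \<sigma> "{..<r}" k] by auto
    then show "b (\<sigma> k) \<in> U" by (rule is_basis_mem[OF b])
  qed
  finally show ?thesis .
qed

lemma pluecker_vec_dual_at:
  assumes "pluecker r b s \<noteq> 0"
  shows "dual_at r (\<lambda>k. (1 / pluecker r b s) *\<^sub>C pluecker_vec (pluecker r b) s k) s"
  unfolding dual_at_def
proof (intro allI impI)
  fix k l assume "k < r" "l < r"
  then have "pluecker r b (s(k := s l)) = (if k = l then pluecker r b s else 0)"
    using pluecker_repeated[of k r l "s(k := s l)" b] by auto
  then show "entries ((1 / pluecker r b s) *\<^sub>C pluecker_vec (pluecker r b) s k) (s l) = (if k = l then 1 else 0)"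
    using assms by (simp add: entries_pluecker_vec)
qed

lemma pluecker_vec_basis:
  assumes "is_basis r b U" "pluecker r b s \<noteq> 0"
  shows "is_basis r (\<lambda>k. (1 / pluecker r b s) *\<^sub>C pluecker_vec (pluecker r b) s k) U"
proof (rule dual_at_basis[OF assms(1) pluecker_vec_dual_at[OF assms(2)]])
  fix k assume "k < r"
  then have "pluecker_vec (pluecker r b) s k \<in> U" by (rule pluecker_vec_mem[OF assms(1)])
  then show "(1 / pluecker r b s) *\<^sub>C pluecker_vec (pluecker r b) s k \<in> U"
    by (rule cmat.subspace_scale[OF is_basis_subspace[OF assms(1)]])
qed

text \<open>Choosing the position where the Pluecker coordinate is largest keeps all entries of the
  resulting basis bounded by \<open>1\<close>.\<close>

lemma exists_bounded_basis:
  fixes U :: "'n::finite cmat set"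
  assumes b: "is_basis r b U"
  shows "\<exists>v s. s \<in> {..<r} \<rightarrow>\<^sub>E UNIV \<and> is_basis r v U \<and> dual_at r v s \<and>
    (\<forall>k<r. \<forall>e. cmod (entries (v k) e) \<le> 1)"
proof -
  let ?S = "{..<r} \<rightarrow>\<^sub>E (UNIV :: ('n \<times> 'n) set)"
  let ?p = "\<lambda>s. cmod (pluecker r b s)"
  have fin: "finite ?S" by (rule finite_PiE) auto
  have re: "pluecker r b (restrict s {..<r}) = pluecker r b s" for s
    by (rule pluecker_cong) simp
  obtain s1 where s1: "pluecker r b s1 \<noteq> 0" using pluecker_nonzero[OF b] by blast
  have "?S \<noteq> {}" by (simp add: PiE_eq_empty_iff)
  then have "Max (?p ` ?S) \<in> ?p ` ?S" by (intro Max_in) (use fin in auto)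
  then obtain s where s: "s \<in> ?S" "Max (?p ` ?S) = ?p s" by blast
  have mx: "?p t \<le> ?p s" for t
  proof -
    have "?p (restrict t {..<r}) \<in> ?p ` ?S" by (rule imageI) (auto simp: PiE_def extensional_def)
    then show ?thesis unfolding re s(2)[symmetric] by (intro Max_ge) (use fin in auto)
  qed
  have nz: "pluecker r b s \<noteq> 0" using mx[of s1] s1 by auto
  have "cmod (entries ((1 / pluecker r b s) *\<^sub>C pluecker_vec (pluecker r b) s k) e) \<le> 1" for k e
    using mx[of "s(k := e)"] nz by (simp add: entries_pluecker_vec norm_divide norm_mult)
  then show ?thesis using s(1) pluecker_vec_basis[OF b nz] pluecker_vec_dual_at[OF nz] by blast
qed

section \<open>Closed subsets of Grassmann varieties\<close>

lemma finite_spanning_set: "\<exists>E :: 'n::finite cmat set. finite E \<and> cmat.span E = UNIV"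
proof -
  define E where "E = (\<lambda>(i, j). (\<chi> k l. if k = i \<and> l = j then 1 else 0) :: 'n cmat)"
  have "A = (\<Sum>e\<in>UNIV. entries A e *\<^sub>C E e)" for A
  proof (rule entries_eqI)
    fix e :: "'n \<times> 'n"
    have Ef: "entries (E f) e = (if f = e then 1 else 0)" for f
      by (cases e; cases f) (auto simp: E_def entries_def)
    show "entries A e = entries (\<Sum>e\<in>UNIV. entries A e *\<^sub>C E e) e"
      by (simp add: Ef if_distrib cong: if_cong)
  qed
  moreover have "(\<Sum>e\<in>UNIV. entries A e *\<^sub>C E e) \<in> cmat.span (range E)" for A
    by (intro cmat.span_sum cmat.span_scale cmat.span_base) auto
  ultimately have "A \<in> cmat.span (range E)" for A by metis
  then show ?thesis by (intro exI[of _ "range E"]) auto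
qed

lemma cmat_independent_finite:
  assumes "cmat.independent (S :: 'n::finite cmat set)" shows "finite S"
proof -
  obtain E :: "'n cmat set" where E: "finite E" "cmat.span E = UNIV"
    using finite_spanning_set by blast
  show ?thesis using cmat.independent_span_bound[OF E(1) assms] E(2) by simp
qed

lemma is_basis_exists:
  assumes "U \<in> Gr r V" shows "\<exists>b. is_basis r b U"
proof -
  have U: "cmat.subspace U" "cmat.dim U = r" using assms by (auto simp: Gr_def)
  obtain S where S: "S \<subseteq> U" "cmat.independent S" "U \<subseteq> cmat.span S" "card S = cmat.dim U"
    using cmat.basis_exists[of U] by blast
  have "finite S" using S(2) by (rule cmat_independent_finite)
  then obtain b where b: "bij_betw b {0..<card S} S" using ex_bij_betw_nat_finite by blast
  have "cmat.span S = U" using S(1,3) cmat.span_minimal[OF S(1) U(1)] by (rule_tac equalityI)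
  then have "is_basis r b U"
    using b S U(2) by (auto simp: is_basis_def bij_betw_def atLeast0LessThan)
  then show ?thesis by blast
qed

lemma is_basis_Gr:
  assumes "is_basis r b U" "U \<subseteq> V" shows "U \<in> Gr r V"
proof -
  have "cmat.dim (cmat.span (b ` {..<r})) = card (b ` {..<r})"
    by (rule cmat.dim_span_eq_card_independent) (use assms(1) in \<open>simp add: is_basis_def\<close>)
  moreover have "cmat.span (b ` {..<r}) = U" "card (b ` {..<r}) = r"
    using assms(1) by (simp_all add: is_basis_def card_image)
  ultimately have "cmat.dim U = r" by metis
  then show ?thesis using is_basis_subspace[OF assms(1)] assms(2) by (simp add: Gr_def)
qed

text \<open>Two bases have proportional Pluecker coordinates, so a homogeneous condition may be checked
  on either of them.\<close>

lemma homogeneous_pluecker_nonzero: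
  assumes "homogeneous d F" "is_basis r b U" "is_basis r b' U" "F (pluecker r b) \<noteq> 0"
  shows "F (pluecker r b') \<noteq> 0"
proof -
  obtain c where "c \<noteq> 0" "pluecker r b' = (\<lambda>s. c * pluecker r b s)"
    using pluecker_basis_change[OF assms(2,3)] by blast
  then show ?thesis using assms(1,4) by (simp add: homogeneous_def)
qed

definition gr_basic :: "nat \<Rightarrow> 'n::finite cmat set \<Rightarrow> (((nat \<Rightarrow> 'n \<times> 'n) \<Rightarrow> complex) \<Rightarrow> complex) \<Rightarrow> 'n cmat set set"
  where "gr_basic r V F = {U \<in> Gr r V. \<forall>b. is_basis r b U \<longrightarrow> F (pluecker r b) \<noteq> 0}"

lemma grassmannian_basic:
  "grassmannian r V = topology_generated_by (gr_basic r V ` {F. poly_fun F \<and> (\<exists>d. homogeneous d F)})"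
  unfolding grassmannian_def gr_basic_def by (rule arg_cong[where f = topology_generated_by]) auto

lemma openin_gr_basic:
  "poly_fun F \<Longrightarrow> homogeneous d F \<Longrightarrow> openin (grassmannian r V) (gr_basic r V F)"
  unfolding grassmannian_basic by (intro topology_generated_by_Basis imageI) auto

lemma topspace_grassmannian: "topspace (grassmannian r V) = Gr r V"
proof
  show "topspace (grassmannian r V) \<subseteq> Gr r V"
    unfolding grassmannian_basic topology_generated_by_topspace by (auto simp: gr_basic_def)
  have "gr_basic r V (\<lambda>_. 1) = Gr r V" by (simp add: gr_basic_def)
  moreover have "homogeneous 0 (\<lambda>_. 1)" by (simp add: homogeneous_def)
  ultimately have "openin (grassmannian r V) (Gr r V)"
    using openin_gr_basic[OF poly_fun.const] by metis
  then show "Gr r V \<subseteq> topspace (grassmannian r V)" by (rule openin_subset)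
qed

text \<open>The product of two homogeneous polynomials is homogeneous, so the basic open sets are stable
  under intersections.\<close>

lemma grassmannian_open_contains_basic:
  assumes W: "openin (grassmannian r V) W" "U \<in> W"
  shows "\<exists>F d. poly_fun F \<and> homogeneous d F \<and> U \<in> gr_basic r V F \<and> gr_basic r V F \<subseteq> W"
proof -
  let ?B = "gr_basic r V ` {F. poly_fun F \<and> (\<exists>d. homogeneous d F)}"
  have "\<exists>C\<subseteq>?B. W = \<Union>C"
  proof (rule openin_topology_generated_by_base[THEN iffD1])
    show "openin (topology_generated_by ?B) W" using W(1) by (simp add: grassmannian_basic)
    fix S T assume "S \<in> ?B" "T \<in> ?B"
    then obtain F H d e where FH: "poly_fun F" "poly_fun H" "homogeneous d F" "homogeneous e H"
      "S = gr_basic r V F" "T = gr_basic r V H" by auto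
    have "S \<inter> T = gr_basic r V (\<lambda>x. F x * H x)"
      unfolding FH(5,6) gr_basic_def by auto
    moreover have "homogeneous (d + e) (\<lambda>x. F x * H x)"
      using FH(3,4) by (simp add: homogeneous_def power_add)
    ultimately show "S \<inter> T \<in> ?B" using poly_fun.mult[OF FH(1,2)] by blast
  qed
  then obtain C where C: "C \<subseteq> ?B" "W = \<Union>C" by blast
  then obtain S where S: "S \<in> C" "U \<in> S" using W(2) by blast
  then have "S \<in> ?B" using C(1) by (rule_tac subsetD)
  then obtain F d where "poly_fun F" "homogeneous d F" "S = gr_basic r V F" by blast
  then show ?thesis using S C(2) by blast
qed

lemma gr_basicI:
  assumes "U \<in> Gr r V" "homogeneous d F" "is_basis r b U" "F (pluecker r b) \<noteq> 0"
  shows "U \<in> gr_basic r V F"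
  unfolding gr_basic_def using assms(1) homogeneous_pluecker_nonzero[OF assms(2,3) _ assms(4)] by simp

lemma mat_poly_fun_bracket_power:
  assumes "mat_poly_fun M" "mat_poly_fun M'" shows "mat_poly_fun (\<lambda>x. (bracket (M x) ^^ N) (M' x))"
proof (induction N)
  case (Suc N)
  then show ?case using assms(1)
    by (simp add: bracket_def mat_poly_fun_diff mat_poly_fun_mult)
qed (simp add: assms(2))

lemma bracket_power_scale:
  "(bracket (c *\<^sub>C X) ^^ N) (c *\<^sub>C Y) = c ^ Suc N *\<^sub>C (bracket X ^^ N) Y"
  by (induction N) (simp_all add: bracket_simps mult_ac)

text \<open>The vectors \<open>pluecker_vec\<close> are linear in the Pluecker coordinates and span the subspace.  So a
  nonzero entry of \<open>(ad X)\<^sup>N Y\<close>, for \<open>X\<close> and \<open>Y\<close> with fixed coefficients with respect to these vectors, is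
  a homogeneous polynomial of degree \<open>N + 1\<close> which defines an open neighbourhood.\<close>

lemma closure_bracket_power_zero:
  assumes S: "\<And>\<aa> X Y. \<aa> \<in> S \<Longrightarrow> X \<in> \<aa> \<Longrightarrow> Y \<in> \<aa> \<Longrightarrow> (bracket X ^^ N) Y = 0"
    and U: "U \<in> grassmannian r V closure_of S" "X \<in> U" "Y \<in> U"
  shows "(bracket X ^^ N) Y = 0"
proof (rule ccontr)
  assume "(bracket X ^^ N) Y \<noteq> 0"
  then obtain i j where ij: "((bracket X ^^ N) Y) $ i $ j \<noteq> 0"
    by (auto simp: Finite_Cartesian_Product.vec_eq_iff)
  have UG: "U \<in> Gr r V" using U(1) by (simp add: in_closure_of topspace_grassmannian)
  obtain b where b: "is_basis r b U" using is_basis_exists[OF UG] by blast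
  obtain s where s: "pluecker r b s \<noteq> 0" using pluecker_nonzero[OF b] by blast
  let ?p = "pluecker r b s"
  note v = pluecker_vec_basis[OF b s]
  have ex: "\<exists>c. Z = (\<Sum>k<r. c k *\<^sub>C pluecker_vec (pluecker r b) s k)" if "Z \<in> U" for Z
  proof -
    obtain c where "Z = (\<Sum>k<r. c k *\<^sub>C ((1 / ?p) *\<^sub>C pluecker_vec (pluecker r b) s k))"
      using is_basis_coords[OF v \<open>Z \<in> U\<close>] by blast
    then have "Z = (\<Sum>k<r. (c k * (1 / ?p)) *\<^sub>C pluecker_vec (pluecker r b) s k)"
      by (simp only: cmat.scale_scale)
    then show ?thesis by (rule exI[of _ "\<lambda>k. c k * (1 / ?p)"])
  qed
  obtain c where c: "X = (\<Sum>k<r. c k *\<^sub>C pluecker_vec (pluecker r b) s k)" using ex[OF U(2)] by blast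
  obtain c' where c': "Y = (\<Sum>k<r. c' k *\<^sub>C pluecker_vec (pluecker r b) s k)" using ex[OF U(3)] by blast
  define L where "L a x = (\<Sum>k<r. a k *\<^sub>C pluecker_vec x s k)" for a x
  define F where "F x = ((bracket (L c x) ^^ N) (L c' x)) $ i $ j" for x
  have pv: "mat_poly_fun (\<lambda>x. pluecker_vec x s k)" for k
    by (simp add: mat_poly_fun_def pluecker_vec_def poly_fun.coord)
  have "mat_poly_fun (L a)" for a
    unfolding L_def by (intro mat_poly_fun_sum mat_poly_fun_cscale pv)
  then have "mat_poly_fun (\<lambda>x. (bracket (L c x) ^^ N) (L c' x))"
    by (intro mat_poly_fun_bracket_power) auto
  then have polF: "poly_fun F" unfolding F_def mat_poly_fun_def by blast
  have "pluecker_vec (\<lambda>i. t * x i) s k = t *\<^sub>C pluecker_vec x s k" for t x k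
    by (rule entries_eqI) (simp add: entries_pluecker_vec)
  then have "L a (\<lambda>i. t * x i) = t *\<^sub>C L a x" for a t x
    by (simp add: L_def cmat.scale_sum_right mult.commute)
  then have homF: "homogeneous (Suc N) F"
    unfolding homogeneous_def F_def by (simp add: bracket_power_scale del: power_Suc)
  have "F (pluecker r b) \<noteq> 0" using ij by (simp add: F_def L_def c c')
  then have "U \<in> gr_basic r V F" by (rule gr_basicI[OF UG homF b])
  then obtain \<aa> where a: "\<aa> \<in> S" "\<aa> \<in> gr_basic r V F"
    using U(1) openin_gr_basic[OF polF homF, of r V] unfolding in_closure_of by blast
  obtain b' where b': "is_basis r b' \<aa>"
    using a(2) is_basis_exists[of \<aa> r V] by (auto simp: gr_basic_def)
  have "L a (pluecker r b') \<in> \<aa>" for a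
    unfolding L_def
    by (intro cmat.subspace_sum cmat.subspace_scale is_basis_subspace[OF b'])
       (auto intro: pluecker_vec_mem[OF b'])
  then have "F (pluecker r b') = 0" using S[OF a(1)] by (simp add: F_def)
  then show False using a(2) b' by (simp add: gr_basic_def)
qed

section \<open>Compactness of closed subsets of Grassmann varieties\<close>

lemma norm_cmat_le: "norm (A :: 'n::finite cmat) \<le> (\<Sum>i\<in>UNIV. \<Sum>j\<in>UNIV. cmod (A $ i $ j))"
proof -
  have "norm A \<le> (\<Sum>i\<in>UNIV. norm (A $ i))" unfolding norm_vec_def[of A] by (rule L2_set_le_sum) simp
  also have "\<dots> \<le> (\<Sum>i\<in>UNIV. \<Sum>j\<in>UNIV. cmod (A $ i $ j))"
    by (rule sum_mono) (unfold norm_vec_def, rule L2_set_le_sum, simp)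
  finally show ?thesis .
qed

lemma tendsto_entries: "(X \<longlongrightarrow> L) F \<Longrightarrow> ((\<lambda>n. entries (X n) e) \<longlongrightarrow> entries L e) F"
  by (cases e) (auto simp: entries_def intro: tendsto_intros)

text \<open>The Pluecker topology is coarser than the classical one, for which the Grassmann
  variety is compact.\<close>

lemma closedin_grassmannian_compact:
  fixes V :: "'n::finite cmat set"
  assumes O: "closedin (grassmannian r V) \<O>" and V: "cmat.subspace V" and U: "\<And>n :: nat. U n \<in> \<O>"
  shows "\<exists>\<sigma> U'. strict_mono \<sigma> \<and> U' \<in> \<O> \<and>
    (\<forall>X'\<in>U'. \<exists>X. (\<forall>n. X n \<in> U (\<sigma> n)) \<and> X \<longlonglongrightarrow> X')"
proof -
  let ?S = "{..<r} \<rightarrow>\<^sub>E (UNIV :: ('n \<times> 'n) set)"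
  have UG: "U n \<in> Gr r V" for n
    using closedin_subset[OF O] U[of n] by (auto simp: topspace_grassmannian)
  have "\<exists>v s. s \<in> ?S \<and> is_basis r v (U n) \<and> dual_at r v s \<and> (\<forall>k<r. \<forall>e. cmod (entries (v k) e) \<le> 1)" for n
    using is_basis_exists[OF UG[of n]] exists_bounded_basis by blast
  then obtain v s where v: "\<And>n. s n \<in> ?S" "\<And>n. is_basis r (v n) (U n)" "\<And>n. dual_at r (v n) (s n)"
    "\<And>n k e. k < r \<Longrightarrow> cmod (entries (v n k) e) \<le> 1" by metis
  have fin: "finite ?S" by (rule finite_PiE) auto
  have "finite (range s)" by (rule finite_subset[OF _ fin]) (use v(1) in blast)
  then obtain n0 where "infinite {n. s n = s n0}"
    using pigeonhole_infinite[of UNIV s] by auto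
  then obtain \<rho> where rho: "strict_mono (\<rho> :: nat \<Rightarrow> nat)" "\<And>n. s (\<rho> n) = s n0"
    using infinite_enumerate[of "{n. s n = s n0}"] by auto
  have "bounded (range (\<lambda>n. v (\<rho> n) k))" if "k \<in> {..<r}" for k
  proof (rule boundedI)
    fix A assume "A \<in> range (\<lambda>n. v (\<rho> n) k)"
    then have "cmod (A $ i $ j) \<le> 1" for i j
      using v(4)[of k _ "(i, j)"] that by (auto simp: entries_def)
    then have "(\<Sum>i\<in>UNIV. \<Sum>j\<in>UNIV. cmod (A $ i $ j)) \<le> (\<Sum>i\<in>(UNIV :: 'n set). \<Sum>j\<in>(UNIV :: 'n set). 1)"
      by (intro sum_mono)
    then show "norm A \<le> (\<Sum>i\<in>(UNIV :: 'n set). \<Sum>j\<in>(UNIV :: 'n set). 1)"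
      using norm_cmat_le[of A] by linarith
  qed
  then obtain \<tau> where tau: "strict_mono \<tau>" "\<forall>k\<in>{..<r}. convergent (\<lambda>n. v (\<rho> (\<tau> n)) k)"
    using bounded_family_convergent_subseq[of "{..<r}" "\<lambda>n. v (\<rho> n)"] by auto
  define \<sigma> where "\<sigma> = \<rho> \<circ> \<tau>"
  have sig: "strict_mono \<sigma>" unfolding \<sigma>_def by (rule strict_mono_o[OF rho(1) tau(1)])
  obtain w where w: "\<And>k. k < r \<Longrightarrow> (\<lambda>n. v (\<sigma> n) k) \<longlonglongrightarrow> w k"
    using tau(2) unfolding convergent_def \<sigma>_def o_def by (metis lessThan_iff)
  have s: "s (\<sigma> n) = s n0" for n by (simp add: \<sigma>_def rho(2))
  \<comment> \<open>The pivots are the same along the subsequence, so the limit vectors are still dual to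
    them; in particular they do not become dependent.\<close>
  have dual: "dual_at r w (s n0)"
    unfolding dual_at_def
  proof (intro allI impI)
    fix k l assume kl: "k < r" "l < r"
    have "(\<lambda>n. entries (v (\<sigma> n) k) (s n0 l)) \<longlonglongrightarrow> entries (w k) (s n0 l)"
      by (rule tendsto_entries[OF w[OF kl(1)]])
    moreover have "entries (v (\<sigma> n) k) (s n0 l) = (if k = l then 1 else 0)" for n
      using v(3)[of "\<sigma> n"] kl by (simp add: dual_at_def s)
    ultimately show "entries (w k) (s n0 l) = (if k = l then 1 else 0)"
      by (simp add: LIMSEQ_const_iff)
  qed
  have wV: "w k \<in> V" if "k < r" for k
  proof (rule closed_sequentially[OF closed_subspace[OF csubspace_imp_subspace[OF V]] _ w[OF that]])
    show "v (\<sigma> n) k \<in> V" for n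
      using is_basis_mem[OF v(2) that] UG by (auto simp: Gr_def)
  qed
  define U' where "U' = cmat.span (w ` {..<r})"
  have bas: "is_basis r w U'"
    using dual_at_independent[OF dual] by (simp add: is_basis_def U'_def)
  have "U' \<subseteq> V" unfolding U'_def by (rule cmat.span_minimal[OF _ V]) (use wV in auto)
  then have UG': "U' \<in> Gr r V" by (rule is_basis_Gr[OF bas])
  have "U' \<in> \<O>"
  proof (rule ccontr)
    assume "U' \<notin> \<O>"
    then have "U' \<in> topspace (grassmannian r V) - \<O>" using UG' by (simp add: topspace_grassmannian)
    moreover have "openin (grassmannian r V) (topspace (grassmannian r V) - \<O>)"
      using O by (simp add: closedin_def)
    ultimately obtain F d where F: "poly_fun F" "homogeneous d F" "U' \<in> gr_basic r V F"
      "gr_basic r V F \<subseteq> topspace (grassmannian r V) - \<O>"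
      using grassmannian_open_contains_basic by meson
    have "F (pluecker r (v (\<sigma> n))) = 0" for n
    proof (rule ccontr)
      assume "F (pluecker r (v (\<sigma> n))) \<noteq> 0"
      then have "U (\<sigma> n) \<in> gr_basic r V F" by (rule gr_basicI[OF UG F(2) v(2)])
      then show False using F(4) U[of "\<sigma> n"] by auto
    qed
    moreover have "(\<lambda>n. F (pluecker r (v (\<sigma> n)))) \<longlonglongrightarrow> F (pluecker r w)"
    proof (rule poly_fun_tendsto[OF F(1)])
      fix t
      have "(\<lambda>n. entries (v (\<sigma> n) (p j)) (t j)) \<longlonglongrightarrow> entries (w (p j)) (t j)"
        if "p permutes {..<r}" "j < r" for p j
        using that permutes_in_image[OF that(1), of j] by (intro tendsto_entries w) auto
      then show "(\<lambda>n. pluecker r (v (\<sigma> n)) t) \<longlonglongrightarrow> pluecker r w t"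
        unfolding pluecker_def by (intro tendsto_sum tendsto_mult tendsto_prod tendsto_const) auto
    qed
    ultimately have "F (pluecker r w) = 0" by (simp add: LIMSEQ_const_iff)
    then show False using F(3) bas by (simp add: gr_basic_def)
  qed
  moreover have "\<exists>X. (\<forall>n. X n \<in> U (\<sigma> n)) \<and> X \<longlonglongrightarrow> X'" if X': "X' \<in> U'" for X'
  proof -
    obtain c where c: "X' = (\<Sum>k<r. c k *\<^sub>C w k)" using is_basis_coords[OF bas X'] by blast
    define X where "X n = (\<Sum>k<r. c k *\<^sub>C v (\<sigma> n) k)" for n
    have "X \<longlonglongrightarrow> X'" unfolding X_def c
      by (intro tendsto_sum continuous_cscale tendsto_const w) auto
    moreover have "X n \<in> U (\<sigma> n)" for n unfolding X_def by (rule is_basis_combination[OF v(2)])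
    ultimately show ?thesis by blast
  qed
  ultimately show ?thesis using sig by blast
qed

section \<open>Holomorphic curves of matrices and the exponential\<close>

definition mderiv :: "(complex \<Rightarrow> 'n::finite cmat) \<Rightarrow> 'n cmat \<Rightarrow> complex \<Rightarrow> bool"
  where "mderiv Y Y' t \<longleftrightarrow> (\<forall>i j. ((\<lambda>s. Y s $ i $ j) has_field_derivative Y' $ i $ j) (at t))"

lemma mderiv_const: "mderiv (\<lambda>s. A) 0 t"
  by (simp add: mderiv_def)

lemma mderiv_add: "mderiv Y Y' t \<Longrightarrow> mderiv Z Z' t \<Longrightarrow> mderiv (\<lambda>s. Y s + Z s) (Y' + Z') t"
  by (simp add: mderiv_def DERIV_add)

lemma mderiv_mult:
  assumes "mderiv Y Y' t" "mderiv Z Z' t"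
  shows "mderiv (\<lambda>s. Y s ** Z s) (Y' ** Z t + Y t ** Z') t"
  unfolding mderiv_def
proof (intro allI)
  fix i j
  have "((\<lambda>s. \<Sum>k\<in>UNIV. Y s $ i $ k * Z s $ k $ j) has_field_derivative
      (\<Sum>k\<in>UNIV. Y' $ i $ k * Z t $ k $ j + Z' $ k $ j * Y t $ i $ k)) (at t)"
    using assms unfolding mderiv_def by (intro DERIV_sum DERIV_mult) auto
  then show "((\<lambda>s. (Y s ** Z s) $ i $ j) has_field_derivative (Y' ** Z t + Y t ** Z') $ i $ j) (at t)"
    by (simp add: matmul_nth sum.distrib mult.commute)
qed

lemma mderiv_mult_const:
  assumes "mderiv Y Y' t" shows "mderiv (\<lambda>s. A ** Y s) (A ** Y') t" "mderiv (\<lambda>s. Y s ** A) (Y' ** A) t"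
  using mderiv_mult[OF mderiv_const assms, of A] mderiv_mult[OF assms mderiv_const, of A] by simp_all

lemma mderiv_cscale:
  assumes "(f has_field_derivative f') (at t)" shows "mderiv (\<lambda>s. f s *\<^sub>C A) (f' *\<^sub>C A) t"
  using assms by (auto simp: mderiv_def intro!: derivative_eq_intros)

lemma mderiv_chain:
  assumes "mderiv Y Y' (f t)" "(f has_field_derivative f') (at t)"
  shows "mderiv (\<lambda>s. Y (f s)) (f' *\<^sub>C Y') t"
  unfolding mderiv_def
proof (intro allI)
  fix i j
  have "((\<lambda>s. Y s $ i $ j) has_field_derivative Y' $ i $ j) (at (f t))"
    using assms(1) by (simp add: mderiv_def)
  from DERIV_chain2[OF this assms(2)]
  show "((\<lambda>s. Y (f s) $ i $ j) has_field_derivative (f' *\<^sub>C Y') $ i $ j) (at t)"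
    by (simp add: mult.commute)
qed

lemma mderiv_line: "mderiv (\<lambda>t. mat 1 + t *\<^sub>C X) X 0"
  using mderiv_add[OF mderiv_const mderiv_cscale[OF DERIV_ident], of "mat 1" X 0] by simp

lemma mderiv_unique:
  assumes "mderiv Y A t" "mderiv Y B t" shows "A = B"
proof -
  have "A $ i $ j = B $ i $ j" for i j
    using assms DERIV_unique[of "\<lambda>s. Y s $ i $ j"] unfolding mderiv_def by blast
  then show ?thesis by (simp add: vec_eq_iff)
qed

lemma mderiv_zero_constant:
  assumes "\<And>t. mderiv Y 0 t" shows "Y s = Y t"
proof -
  have "Y s $ i $ j = Y t $ i $ j" for i j
  proof -
    have "\<exists>c. \<forall>x\<in>UNIV. Y x $ i $ j = c"
      by (rule has_field_derivative_zero_constant) (use assms in \<open>auto simp: mderiv_def\<close>)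
    then show ?thesis by auto
  qed
  then show ?thesis by (simp add: vec_eq_iff)
qed

text \<open>The value at \<open>t\<close> of the one-parameter group generated by \<open>A\<close>, that is, \<open>exp (t A)\<close>.\<close>

definition mexp :: "'n::finite cmat \<Rightarrow> complex \<Rightarrow> 'n cmat"
  where "mexp A t = (\<chi> i j. \<Sum>k. matpow A k $ i $ j / fact k * t ^ k)"

lemma matpow_entry_bound:
  "cmod (matpow A k $ i $ j) \<le> (\<Sum>i\<in>UNIV. \<Sum>j\<in>UNIV. cmod (A $ i $ j)) ^ k"
proof (induction k arbitrary: i)
  case (Suc k)
  let ?M = "\<Sum>i\<in>UNIV. \<Sum>j\<in>UNIV. cmod (A $ i $ j)"
  have "cmod (matpow A (Suc k) $ i $ j) \<le> (\<Sum>l\<in>UNIV. cmod (A $ i $ l * matpow A k $ l $ j))"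
    unfolding matpow_Suc matmul_nth by (rule norm_sum)
  also have "\<dots> \<le> (\<Sum>l\<in>UNIV. cmod (A $ i $ l) * ?M ^ k)"
    unfolding norm_mult by (intro sum_mono mult_left_mono Suc) auto
  also have "\<dots> = (\<Sum>l\<in>UNIV. cmod (A $ i $ l)) * ?M ^ k" by (simp add: sum_distrib_right)
  also have "\<dots> \<le> ?M * ?M ^ k"
  proof (rule mult_right_mono)
    show "(\<Sum>l\<in>UNIV. cmod (A $ i $ l)) \<le> ?M"
      by (rule member_le_sum[of i UNIV "\<lambda>i. \<Sum>l\<in>UNIV. cmod (A $ i $ l)"]) (auto intro: sum_nonneg)
    show "0 \<le> ?M ^ k" by (intro zero_le_power sum_nonneg) auto
  qed
  finally show ?case by simp
qed (simp add: mat_def)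

lemma mexp_summable: "summable (\<lambda>k. matpow A k $ i $ j / fact k * t ^ k)"
proof (rule summable_comparison_test)
  let ?M = "\<Sum>i\<in>UNIV. \<Sum>j\<in>UNIV. cmod (A $ i $ j)"
  show "summable (\<lambda>k. (?M * cmod t) ^ k /\<^sub>R fact k)" by (rule summable_exp_generic)
  have "norm (matpow A k $ i $ j / fact k * t ^ k) \<le> (?M * cmod t) ^ k /\<^sub>R fact k" for k
    using matpow_entry_bound[of A k i j]
    by (simp add: norm_mult norm_divide norm_power power_mult_distrib field_simps mult_right_mono mult_left_mono)
  then show "\<exists>N. \<forall>k\<ge>N. norm (matpow A k $ i $ j / fact k * t ^ k) \<le> (?M * cmod t) ^ k /\<^sub>R fact k"
    by blast
qed

lemma mexp_sums: "(\<lambda>k. matpow A k $ i $ j / fact k * t ^ k) sums (mexp A t $ i $ j)"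
  using summable_sums[OF mexp_summable] by (simp add: mexp_def)

lemma mexp_mult_left_sums: "(\<lambda>k. (B ** matpow A k) $ i $ j / fact k * t ^ k) sums ((B ** mexp A t) $ i $ j)"
proof -
  have "(\<lambda>k. \<Sum>l\<in>UNIV. B $ i $ l * (matpow A k $ l $ j / fact k * t ^ k)) sums
      (\<Sum>l\<in>UNIV. B $ i $ l * mexp A t $ l $ j)"
    by (intro sums_sum sums_mult mexp_sums)
  then show ?thesis by (simp add: matmul_nth sum_divide_distrib sum_distrib_right mult.assoc)
qed

lemma mexp_mult_right_sums: "(\<lambda>k. (matpow A k ** B) $ i $ j / fact k * t ^ k) sums ((mexp A t ** B) $ i $ j)"
proof -
  have "(\<lambda>k. \<Sum>l\<in>UNIV. (matpow A k $ i $ l / fact k * t ^ k) * B $ l $ j) sums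
      (\<Sum>l\<in>UNIV. mexp A t $ i $ l * B $ l $ j)"
    by (intro sums_sum sums_mult2 mexp_sums)
  then show ?thesis
    by (simp add: matmul_nth sum_divide_distrib sum_distrib_left sum_distrib_right mult_ac)
qed

lemma mexp_commute:
  assumes "A ** B = B ** A" shows "mexp A t ** B = B ** mexp A t"
proof -
  have "(mexp A t ** B) $ i $ j = (B ** mexp A t) $ i $ j" for i j
    using mexp_mult_right_sums[of A B i j t] mexp_mult_left_sums[of B A i j t]
    unfolding matpow_commute[OF assms] by (rule sums_unique2)
  then show ?thesis by (simp add: vec_eq_iff)
qed

lemma mexp_0 [simp]: "mexp A 0 = mat 1"
proof -
  have "mexp A 0 $ i $ j = (mat 1 :: 'a cmat) $ i $ j" for i j
    using powser_zero[of "\<lambda>k. matpow A k $ i $ j / fact k"] by (simp add: mexp_def)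
  then show ?thesis by (simp add: vec_eq_iff)
qed

lemma mexp_deriv: "mderiv (mexp A) (A ** mexp A t) t"
  unfolding mderiv_def
proof (intro allI)
  fix i j
  let ?c = "\<lambda>k. matpow A k $ i $ j / fact k"
  have "((\<lambda>s. \<Sum>k. ?c k * s ^ k) has_field_derivative (\<Sum>k. diffs ?c k * t ^ k)) (at t)"
    by (rule termdiffs_strong_converges_everywhere) (rule mexp_summable)
  moreover have "diffs ?c k * t ^ k = (A ** matpow A k) $ i $ j / fact k * t ^ k" for k
    by (simp add: diffs_def field_simps del: of_nat_Suc)
  then have "(\<Sum>k. diffs ?c k * t ^ k) = (A ** mexp A t) $ i $ j"
    using sums_unique[OF mexp_mult_left_sums[of A A i j t]] by simp
  ultimately show "((\<lambda>s. mexp A s $ i $ j) has_field_derivative (A ** mexp A t) $ i $ j) (at t)"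
    by (simp add: mexp_def)
qed

lemma mexp_neg_deriv: "mderiv (\<lambda>s. mexp A (- s)) (- (A ** mexp A (- t))) t"
proof -
  have "mderiv (\<lambda>s. mexp A (- s)) ((- 1) *\<^sub>C (A ** mexp A (- t))) t"
    by (rule mderiv_chain[OF mexp_deriv]) (auto intro!: derivative_eq_intros)
  then show ?thesis by simp
qed

lemma mexp_inverse: "mexp A (- t) ** mexp A t = mat 1" "mexp A t ** mexp A (- t) = mat 1"
proof -
  have c: "mexp A s ** A = A ** mexp A s" for s by (rule mexp_commute) (rule refl)
  have "mderiv (\<lambda>s. mexp A (- s) ** mexp A s)
      (- (A ** mexp A (- t)) ** mexp A t + mexp A (- t) ** (A ** mexp A t)) t" for t
    by (rule mderiv_mult[OF mexp_neg_deriv mexp_deriv])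
  moreover have "- (A ** mexp A (- t)) ** mexp A t + mexp A (- t) ** (A ** mexp A t) = 0" for t
    using c by (simp add: matmul_ring) (metis matrix_mul_assoc)
  ultimately have "mderiv (\<lambda>s. mexp A (- s) ** mexp A s) 0 t" for t by simp
  then have "mexp A (- s) ** mexp A s = mexp A (- 0) ** mexp A 0" for s
    by (rule mderiv_zero_constant)
  then have *: "mexp A (- s) ** mexp A s = mat 1" for s by simp
  show "mexp A (- t) ** mexp A t = mat 1" "mexp A t ** mexp A (- t) = mat 1"
    using *[of t] *[of "- t"] by simp_all
qed

lemma mexp_invertible: "invertible (mexp A t)"
  using mexp_inverse[of A t] unfolding invertible_def by blast

lemma matrix_inv_mexp: "matrix_inv (mexp A t) = mexp A (- t)"
  by (rule matrix_inv_eqI) (rule mexp_inverse)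

text \<open>The derivative of \<open>exp (- t A) Y t\<close> vanishes.  The functional equations of the exponential below are all
  instances.\<close>

lemma linear_ode_unique:
  assumes "\<And>t. mderiv Y (A ** Y t) t" shows "Y t = mexp A t ** Y 0"
proof -
  have c: "mexp A s ** A = A ** mexp A s" for s by (rule mexp_commute) (rule refl)
  have "mderiv (\<lambda>s. mexp A (- s) ** Y s)
      (- (A ** mexp A (- t)) ** Y t + mexp A (- t) ** (A ** Y t)) t" for t
    by (rule mderiv_mult[OF mexp_neg_deriv assms])
  moreover have "- (A ** mexp A (- t)) ** Y t + mexp A (- t) ** (A ** Y t) = 0" for t
    using c by (simp add: matmul_ring) (metis matrix_mul_assoc)
  ultimately have "mderiv (\<lambda>s. mexp A (- s) ** Y s) 0 t" for t by simp
  then have "mexp A (- t) ** Y t = mexp A (- 0) ** Y 0" by (rule mderiv_zero_constant)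
  then have "mexp A (- t) ** Y t = Y 0" by simp
  then have "mexp A t ** (mexp A (- t) ** Y t) = mexp A t ** Y 0" by simp
  then show ?thesis by (simp add: matrix_mul_assoc mexp_inverse)
qed

lemma mexp_unique:
  assumes "\<And>t. mderiv Y (A ** Y t) t" "Y 0 = mat 1" shows "Y t = mexp A t"
  using linear_ode_unique[of Y A, OF assms(1)] assms(2) by simp

lemma mexp_add_arg: "mexp A (s + t) = mexp A s ** mexp A t"
proof -
  have "mderiv (\<lambda>s. mexp A (s + t)) (1 *\<^sub>C (A ** mexp A (s + t))) s" for s
    by (rule mderiv_chain[OF mexp_deriv]) (auto intro!: derivative_eq_intros)
  then show ?thesis using linear_ode_unique[of "\<lambda>s. mexp A (s + t)" A s] by simp
qed

lemma mexp_scale_arg: "mexp (c *\<^sub>C A) t = mexp A (c * t)"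
proof -
  have "mderiv (\<lambda>t. mexp A (c * t)) (c *\<^sub>C (A ** mexp A (c * t))) t" for t
    by (rule mderiv_chain[OF mexp_deriv]) (auto intro!: derivative_eq_intros)
  then show ?thesis using mexp_unique[of "\<lambda>t. mexp A (c * t)" "c *\<^sub>C A" t] by (simp add: matmul_ring)
qed

lemma mexp_add:
  assumes "A ** B = B ** A" shows "mexp (A + B) t = mexp A t ** mexp B t"
proof -
  have c: "mexp A t ** B = B ** mexp A t" for t by (rule mexp_commute[OF assms])
  have "mderiv (\<lambda>t. mexp A t ** mexp B t) (A ** mexp A t ** mexp B t + mexp A t ** (B ** mexp B t)) t" for t
    by (rule mderiv_mult[OF mexp_deriv mexp_deriv])
  moreover have "A ** mexp A t ** mexp B t + mexp A t ** (B ** mexp B t) = (A + B) ** (mexp A t ** mexp B t)" for t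
    using c[of t] by (simp add: matmul_ring) (metis matrix_mul_assoc)
  ultimately have "mderiv (\<lambda>t. mexp A t ** mexp B t) ((A + B) ** (mexp A t ** mexp B t)) t" for t
    by simp
  then have "mexp A t ** mexp B t = mexp (A + B) t" by (rule mexp_unique) simp
  then show ?thesis ..
qed

lemma mexp_Ad:
  assumes "invertible g" shows "mexp (Ad g A) t = Ad g (mexp A t)"
proof -
  have "mderiv (\<lambda>t. Ad g (mexp A t)) (g ** (A ** mexp A t) ** matrix_inv g) t" for t
    unfolding Ad_def by (intro mderiv_mult_const mexp_deriv)
  moreover have "g ** (A ** mexp A t) ** matrix_inv g = Ad g A ** Ad g (mexp A t)" for t
    using Ad_simps(3)[OF assms] by (simp add: Ad_def)
  ultimately have "mderiv (\<lambda>t. Ad g (mexp A t)) (Ad g A ** Ad g (mexp A t)) t" for t by simp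
  then have "Ad g (mexp A t) = mexp (Ad g A) t" by (rule mexp_unique) (simp add: Ad_simps[OF assms])
  then show ?thesis ..
qed

lemma mexp_deriv_0: "mderiv (mexp A) A 0"
  using mexp_deriv[of A 0] by simp

lemma mexp_inject:
  assumes "\<And>t. mexp A t = mexp B t" shows "A = B"
proof -
  have "mexp A = mexp B" using assms by (rule ext)
  then show ?thesis using mexp_deriv_0[of A] mexp_deriv_0[of B] mderiv_unique by metis
qed

lemma Ad_mexp_deriv: "mderiv (\<lambda>t. Ad (mexp X t) Y) (bracket X Y) 0"
proof -
  have "mderiv (\<lambda>t. mexp X t ** Y ** mexp X (- t))
      (X ** mexp X 0 ** Y ** mexp X (- 0) + mexp X 0 ** Y ** (- (X ** mexp X (- 0)))) 0"
    by (rule mderiv_mult[OF mderiv_mult_const(2)[OF mexp_deriv] mexp_neg_deriv])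
  then show ?thesis by (simp add: Ad_def matrix_inv_mexp bracket_def matmul_ring)
qed

text \<open>Subspaces are topologically closed, hence contain the derivatives of their curves.\<close>

lemma mderiv_in_subspace:
  assumes S: "cmat.subspace S" and Y: "\<And>t. Y t \<in> S" "mderiv Y Y' 0" shows "Y' \<in> S"
proof (rule Lim_in_closed_set[OF closed_subspace[OF csubspace_imp_subspace[OF S]]])
  show "((\<lambda>h. (1 / h) *\<^sub>C (Y h - Y 0)) \<longlongrightarrow> Y') (at 0)"
    using Y(2) by (intro vec_tendstoI) (simp add: mderiv_def DERIV_def)
  show "\<forall>\<^sub>F h in at 0. (1 / h) *\<^sub>C (Y h - Y 0) \<in> S"
    using Y(1) by (intro always_eventually allI cmat.subspace_scale cmat.subspace_diff S) auto
qed simp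

section \<open>Differentials of polynomial and of regular functions\<close>

text \<open>The last clause says that the derivative along a vector field with polynomial coefficients is
  again a polynomial function, so that it can be differentiated repeatedly.\<close>

definition is_differential :: "(('i \<Rightarrow> complex) \<Rightarrow> complex) \<Rightarrow>
    (('i \<Rightarrow> complex) \<Rightarrow> ('i \<Rightarrow> complex) \<Rightarrow> complex) \<Rightarrow> bool"
  where "is_differential F D \<longleftrightarrow>
    (\<forall>\<gamma> \<gamma>' t. (\<forall>i. ((\<lambda>s. \<gamma> s i) has_field_derivative \<gamma>' i) (at t)) \<longrightarrow>
        ((\<lambda>s. F (\<gamma> s)) has_field_derivative D (\<gamma> t) \<gamma>') (at t)) \<and>
    (\<forall>x a v w. D x (\<lambda>i. a * v i + w i) = a * D x v + D x w) \<and>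
    (\<forall>l. (\<forall>i. poly_fun (\<lambda>x. l x i)) \<longrightarrow> poly_fun (\<lambda>x. D x (l x)))"

lemma is_differentialD:
  assumes "is_differential F D"
  shows "(\<And>i. ((\<lambda>s. \<gamma> s i) has_field_derivative \<gamma>' i) (at t)) \<Longrightarrow>
      ((\<lambda>s. F (\<gamma> s)) has_field_derivative D (\<gamma> t) \<gamma>') (at t)"
    "D x (\<lambda>i. a * v i + w i) = a * D x v + D x w"
    "(\<And>i. poly_fun (\<lambda>x. l x i)) \<Longrightarrow> poly_fun (\<lambda>x. D x (l x))"
  using assms unfolding is_differential_def by auto

lemma is_differentialI:
  assumes "\<And>\<gamma> \<gamma>' t. (\<And>i. ((\<lambda>s. \<gamma> s i) has_field_derivative \<gamma>' i) (at t)) \<Longrightarrow>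
      ((\<lambda>s. F (\<gamma> s)) has_field_derivative D (\<gamma> t) \<gamma>') (at t)"
    "\<And>x a v w. D x (\<lambda>i. a * v i + w i) = a * D x v + D x w"
    "\<And>l. (\<And>i. poly_fun (\<lambda>x. l x i)) \<Longrightarrow> poly_fun (\<lambda>x. D x (l x))"
  shows "is_differential F D"
  unfolding is_differential_def by (intro conjI allI impI assms) auto

lemma poly_fun_differential:
  assumes "poly_fun F" shows "\<exists>D. is_differential F D"
  using assms
proof induction
  case (const c)
  have "is_differential (\<lambda>_. c) (\<lambda>x v. 0)" by (rule is_differentialI) (auto intro: poly_fun.const)
  then show ?case by blast
next
  case (coord i)
  have "is_differential (\<lambda>x. x i) (\<lambda>x v. v i)" by (rule is_differentialI) auto
  then show ?case by blast
next
  case (add F H)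
  then obtain D E where "is_differential F D" "is_differential H E" by blast
  note D = is_differentialD[OF this(1)] and E = is_differentialD[OF this(2)]
  have "is_differential (\<lambda>x. F x + H x) (\<lambda>x v. D x v + E x v)"
  proof (rule is_differentialI)
    show "D x (\<lambda>i. a * v i + w i) + E x (\<lambda>i. a * v i + w i) = a * (D x v + E x v) + (D x w + E x w)"
      for x a v w unfolding D(2) E(2) by (simp add: algebra_simps)
  qed (intro DERIV_add poly_fun.add D E; assumption)+
  then show ?case by blast
next
  case (mult F H)
  then obtain D E where "is_differential F D" "is_differential H E" by blast
  note D = is_differentialD[OF this(1)] and E = is_differentialD[OF this(2)]
  have "is_differential (\<lambda>x. F x * H x) (\<lambda>x v. D x v * H x + E x v * F x)"
  proof (rule is_differentialI)
    show "D x (\<lambda>i. a * v i + w i) * H x + E x (\<lambda>i. a * v i + w i) * F x =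
        a * (D x v * H x + E x v * F x) + (D x w * H x + E x w * F x)" for x a v w
      unfolding D(2) E(2) by (simp add: algebra_simps)
  qed (intro DERIV_mult poly_fun.add poly_fun.mult mult.hyps D E; assumption)+
  then show ?case by blast
qed

lemma poly_fun_compose:
  assumes "poly_fun F" "\<And>i. poly_fun (\<lambda>x. l x i)" shows "poly_fun (\<lambda>x. F (l x))"
  using assms(1) by induction (simp_all add: poly_fun.intros assms(2))

definition mat_of :: "('n::finite \<times> 'n \<Rightarrow> complex) \<Rightarrow> 'n cmat"
  where "mat_of x = (\<chi> i j. x (i, j))"

lemma mat_of_entries [simp]: "mat_of (entries A) = A" "entries (mat_of x) = x"
  by (auto simp: mat_of_def entries_def vec_eq_iff)

lemma mat_poly_fun_mat_of: "mat_poly_fun mat_of"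
  by (simp add: mat_poly_fun_def mat_of_def poly_fun.coord)

lemma poly_fun_entries_compose:
  assumes "poly_fun F" "mat_poly_fun M" shows "poly_fun (\<lambda>x. F (entries (M x)))"
  using assms(2) by (intro poly_fun_compose[OF assms(1)]) (auto simp: entries_def mat_poly_fun_def)

definition poly_differential :: "(('n::finite \<times> 'n \<Rightarrow> complex) \<Rightarrow> complex) \<Rightarrow> 'n cmat \<Rightarrow> 'n cmat \<Rightarrow> complex"
  where "poly_differential F A X = deriv (\<lambda>t. F (entries (A + t *\<^sub>C X))) 0"

lemma poly_differential:
  assumes "poly_fun F"
  shows poly_differential_curve: "mderiv Y Y' t \<Longrightarrow>
      ((\<lambda>s. F (entries (Y s))) has_field_derivative poly_differential F (Y t) Y') (at t)"
    and poly_differential_linear: "poly_differential F A (c *\<^sub>C X + Z) = c * poly_differential F A X + poly_differential F A Z"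
    and poly_differential_poly_fun: "mat_poly_fun M \<Longrightarrow> poly_fun (\<lambda>x. poly_differential F (mat_of x) (M x))"
proof -
  obtain D where "is_differential F D" using poly_fun_differential[OF assms] by blast
  note D = is_differentialD[OF this]
  have 1: "((\<lambda>s. F (entries (Y s))) has_field_derivative D (entries (Y t)) (entries Y')) (at t)"
    if "mderiv Y Y' t" for Y Y' t
    using that by (intro D(1)) (auto simp: mderiv_def entries_def)
  have 2: "poly_differential F A X = D (entries A) (entries X)" for A X
  proof -
    have "mderiv (\<lambda>t. A + t *\<^sub>C X) (0 + 1 *\<^sub>C X) 0"
      by (intro mderiv_add mderiv_const mderiv_cscale DERIV_ident)
    then have "mderiv (\<lambda>t. A + t *\<^sub>C X) X 0" by simp
    from DERIV_imp_deriv[OF 1[OF this]] show ?thesis by (simp add: poly_differential_def)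
  qed
  show "((\<lambda>s. F (entries (Y s))) has_field_derivative poly_differential F (Y t) Y') (at t)" if "mderiv Y Y' t"
    unfolding 2 using that by (rule 1)
  have "entries (c *\<^sub>C X + Z) = (\<lambda>i. c * entries X i + entries Z i)"
    by (auto simp: entries_def fun_eq_iff)
  then show "poly_differential F A (c *\<^sub>C X + Z) = c * poly_differential F A X + poly_differential F A Z"
    unfolding 2 by (simp add: D(2))
  show "poly_fun (\<lambda>x. poly_differential F (mat_of x) (M x))" if "mat_poly_fun M"
    unfolding 2 mat_of_entries
    by (rule D(3)) (use that in \<open>auto simp: entries_def mat_poly_fun_def\<close>)
qed

lemma poly_differential_zero: "poly_fun F \<Longrightarrow> poly_differential F A 0 = 0"
  using poly_differential_linear[of F A 1 0 0] by simp

lemma poly_differential_add: "poly_fun F \<Longrightarrow> poly_differential F A (X + Z) = poly_differential F A X + poly_differential F A Z"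
  using poly_differential_linear[of F A 1 X Z] by simp

lemma poly_differential_scale: "poly_fun F \<Longrightarrow> poly_differential F A (c *\<^sub>C X) = c * poly_differential F A X"
  using poly_differential_linear[of F A c X 0] by (simp add: poly_differential_zero)

lemma poly_fun_det: "mat_poly_fun M \<Longrightarrow> poly_fun (\<lambda>x. det (M x))"
  unfolding det_def
  by (auto intro!: poly_fun_sum poly_fun.mult poly_fun_prod poly_fun.const simp: mat_poly_fun_def)

lemma det_poly_fun: "poly_fun (\<lambda>x. det (mat_of x))"
  by (rule poly_fun_det[OF mat_poly_fun_mat_of])

lemma regular_GL_differential:
  assumes "regular_GL f"
  shows "\<exists>L. (\<forall>Y Y'. Y 0 = mat 1 \<longrightarrow> mderiv Y Y' 0 \<longrightarrow>
      ((\<lambda>t. f (Y t)) has_field_derivative L Y') (at 0)) \<and>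
    (\<forall>c X Z. L (c *\<^sub>C X + Z) = c * L X + L Z)"
proof -
  obtain F k where F: "poly_fun F" "\<And>A. invertible A \<Longrightarrow> f A = F (entries A) / det A ^ k"
    using assms unfolding regular_GL_def by blast
  let ?d = "\<lambda>x. det (mat_of x)"
  define L where "L X = poly_differential F (mat 1) X - F (entries (mat 1)) * (of_nat k * poly_differential ?d (mat 1) X)" for X
  have "((\<lambda>t. f (Y t)) has_field_derivative L Y') (at 0)" if Y: "Y 0 = mat 1" "mderiv Y Y' 0" for Y Y'
  proof -
    have 1: "((\<lambda>t. F (entries (Y t))) has_field_derivative poly_differential F (mat 1) Y') (at 0)"
      using poly_differential_curve[OF F(1) Y(2)] Y(1) by simp
    have 2: "((\<lambda>t. det (Y t)) has_field_derivative poly_differential ?d (mat 1) Y') (at 0)"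
      using poly_differential_curve[OF det_poly_fun Y(2)] Y(1) by simp
    have "((\<lambda>t. F (entries (Y t)) / det (Y t) ^ k) has_field_derivative L Y') (at 0)"
      using DERIV_divide[OF 1 DERIV_power[OF 2, of k]] by (simp add: Y(1) L_def)
    moreover have "\<forall>\<^sub>F t in nhds 0. f (Y t) = F (entries (Y t)) / det (Y t) ^ k"
    proof -
      have "isCont (\<lambda>t. det (Y t)) 0" using 2 by (rule DERIV_isCont)
      then have "((\<lambda>t. det (Y t)) \<longlongrightarrow> det (Y 0)) (nhds 0)"
        unfolding isCont_def by (rule tendsto_at_iff_tendsto_nhds[THEN iffD1])
      then have "\<forall>\<^sub>F t in nhds 0. det (Y t) \<noteq> 0"
        by (rule tendsto_imp_eventually_ne) (simp add: Y(1))
      then show ?thesis by eventually_elim (simp add: F(2) invertible_det_nz)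
    qed
    ultimately show ?thesis by (subst DERIV_cong_ev[OF refl _ refl])
  qed
  moreover have "L (c *\<^sub>C X + Z) = c * L X + L Z" for c X Z
    unfolding L_def poly_differential_linear[OF F(1)] poly_differential_linear[OF det_poly_fun] by (simp add: algebra_simps)
  ultimately show ?thesis by blast
qed

section \<open>The Lie algebra of a linear algebraic group\<close>

lemma lie_algebra_iff:
  "X \<in> lie_algebra G \<longleftrightarrow> (\<forall>F. poly_fun F \<and> (\<forall>g\<in>G. F (entries g) = 0) \<longrightarrow> poly_differential F (mat 1) X = 0)"
proof -
  have "((\<lambda>t. F (entries (mat 1 + t *\<^sub>C X))) has_field_derivative 0) (at 0) \<longleftrightarrow> poly_differential F (mat 1) X = 0"
    if "poly_fun F" for F
    using poly_differential_curve[OF that mderiv_line, of X] DERIV_unique by fastforce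
  then show ?thesis unfolding lie_algebra_def by blast
qed

lemma lie_algebra_curve:
  assumes Y: "Y 0 = mat 1" "mderiv Y X 0"
    and F: "\<And>F t. poly_fun F \<Longrightarrow> (\<And>g. g \<in> G \<Longrightarrow> F (entries g) = 0) \<Longrightarrow> F (entries (Y t)) = 0"
  shows "X \<in> lie_algebra G"
  unfolding lie_algebra_iff
proof (intro allI impI)
  fix F assume F': "poly_fun F \<and> (\<forall>g\<in>G. F (entries g) = 0)"
  then have "F (entries (Y t)) = 0" for t using F by blast
  then have "((\<lambda>t. 0) has_field_derivative poly_differential F (mat 1) X) (at 0)"
    using poly_differential_curve[of F Y X 0] F' Y by simp
  then show "poly_differential F (mat 1) X = 0" using DERIV_unique DERIV_const by blast
qed

lemma lie_algebra_group_curve: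
  assumes "Y 0 = mat 1" "mderiv Y X 0" "\<And>t. Y t \<in> G" shows "X \<in> lie_algebra G"
  using assms by (intro lie_algebra_curve[of Y]) auto

lemma lie_algebra_subspace: "cmat.subspace (lie_algebra G)"
  unfolding cmat.subspace_def by (auto simp: lie_algebra_iff poly_differential_zero poly_differential_add poly_differential_scale)

lemma group_GL_mem:
  assumes "subgroup G GL"
  shows "mat 1 \<in> G" "\<And>g h. g \<in> G \<Longrightarrow> h \<in> G \<Longrightarrow> g ** h \<in> G" "\<And>g. g \<in> G \<Longrightarrow> invertible g"
  using subgroup.one_closed[OF assms] subgroup.m_closed[OF assms] subgroup.subset[OF assms]
  by (auto simp: GL_def)

lemma algebraic_group_zeros:
  assumes "algebraic_group G" "invertible A"
    and "\<And>F. poly_fun F \<Longrightarrow> (\<And>g. g \<in> G \<Longrightarrow> F (entries g) = 0) \<Longrightarrow> F (entries A) = 0"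
  shows "A \<in> G"
proof -
  obtain S where S: "\<forall>F\<in>S. poly_fun F" "G = {A. invertible A \<and> (\<forall>F\<in>S. F (entries A) = 0)}"
    using assms(1) unfolding algebraic_group_def closedin_zariski_GL by blast
  have "F (entries A) = 0" if "F \<in> S" for F
    by (rule assms(3)) (use S that in auto)
  then show ?thesis using S(2) assms(2) by blast
qed

text \<open>The left-invariant vector field of \<open>X\<close> preserves the ideal of \<open>G\<close>; hence all derivatives
  at \<open>0\<close> of \<open>t \<mapsto> F (exp (t X))\<close> vanish.\<close>

lemma mexp_in_zeros:
  assumes G: "subgroup G GL" and X: "X \<in> lie_algebra G"
    and F: "poly_fun F" "\<And>g. g \<in> G \<Longrightarrow> F (entries g) = 0"
  shows "F (entries (mexp X t)) = 0"
proof -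
  define D where "D F = (\<lambda>x. poly_differential F (mat_of x) (mat_of x ** X))" for F
  have der: "((\<lambda>s. F (entries (mexp X s))) has_field_derivative D F (entries (mexp X t))) (at t)"
    if "poly_fun F" for F t
    using poly_differential_curve[OF that mexp_deriv, of X t] mexp_commute[of X X t] by (simp add: D_def)
  have ideal: "poly_fun (D F) \<and> (\<forall>g\<in>G. D F (entries g) = 0)"
    if F: "poly_fun F" "\<forall>g\<in>G. F (entries g) = 0" for F
  proof (intro conjI ballI)
    show "poly_fun (D F)" unfolding D_def
      by (intro poly_differential_poly_fun F mat_poly_fun_mult mat_poly_fun_mat_of mat_poly_fun_const)
    fix g assume g: "g \<in> G"
    define H where "H = (\<lambda>x. F (entries (g ** mat_of x)))"
    have "poly_fun H" unfolding H_def
      by (intro poly_fun_entries_compose F mat_poly_fun_mult mat_poly_fun_mat_of mat_poly_fun_const)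
    moreover have "\<forall>h\<in>G. H (entries h) = 0"
      using F(2) group_GL_mem(2)[OF G g] by (simp add: H_def)
    ultimately have "poly_differential H (mat 1) X = 0" using X unfolding lie_algebra_iff by blast
    moreover have "((\<lambda>t. H (entries (mat 1 + t *\<^sub>C X))) has_field_derivative D F (entries g)) (at 0)"
      using poly_differential_curve[OF F(1) mderiv_mult_const(1)[OF mderiv_line, of g X]]
      by (simp add: H_def D_def)
    ultimately show "D F (entries g) = 0"
      using poly_differential_curve[OF \<open>poly_fun H\<close> mderiv_line, of X] DERIV_unique by fastforce
  qed
  have deriv0: "(deriv ^^ n) (\<lambda>s. F (entries (mexp X s))) 0 = 0"
    if "poly_fun F" "\<forall>g\<in>G. F (entries g) = 0" for n F
    using that
  proof (induction n arbitrary: F)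
    case 0
    then show ?case using group_GL_mem(1)[OF G] by simp
  next
    case (Suc n)
    have "deriv (\<lambda>s. F (entries (mexp X s))) = (\<lambda>s. D F (entries (mexp X s)))"
      using DERIV_imp_deriv[OF der[OF Suc.prems(1)]] by (rule ext)
    then show ?case using Suc.IH[of "D F"] ideal[OF Suc.prems] by (simp add: funpow_swap1)
  qed
  show ?thesis
  proof (rule holomorphic_fun_eq_0_on_connected[of "\<lambda>s. F (entries (mexp X s))" UNIV 0])
    show "(\<lambda>s. F (entries (mexp X s))) holomorphic_on UNIV"
      unfolding holomorphic_on_def using der[OF F(1)] field_differentiable_def by fastforce
    show "(deriv ^^ n) (\<lambda>s. F (entries (mexp X s))) 0 = 0" for n
      by (rule deriv0) (use F in auto)
  qed auto
qed

lemma mexp_in_group: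
  assumes "algebraic_group G" "X \<in> lie_algebra G" shows "mexp X t \<in> G"
proof (rule algebraic_group_zeros[OF assms(1) mexp_invertible])
  have "subgroup G GL" using assms(1) by (simp add: algebraic_group_def)
  then show "F (entries (mexp X t)) = 0" if "poly_fun F" "\<And>g. g \<in> G \<Longrightarrow> F (entries g) = 0" for F
    using mexp_in_zeros[OF _ assms(2) that] by blast
qed

lemma matrix_inv_in_group:
  assumes "subgroup G GL" "g \<in> G" shows "matrix_inv g \<in> G"
proof -
  have g: "invertible g" by (rule group_GL_mem(3)[OF assms])
  have "Group.group (GL :: 'a cmat monoid)"
    by (rule groupI) (auto simp: GL_def invertible_mult invertible_mat_1 matrix_mul_assoc
        intro!: bexI[of _ "matrix_inv _"] matrix_inv_mult invertible_matrix_inv)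
  then have "m_inv GL g = matrix_inv g"
    by (rule group.inv_equality) (use g in \<open>auto simp: GL_def matrix_inv_mult invertible_matrix_inv\<close>)
  then show ?thesis using subgroup.m_inv_closed[OF assms] by simp
qed

lemma lie_algebra_Ad:
  assumes G: "algebraic_group G" and g: "g \<in> G" and X: "X \<in> lie_algebra G"
  shows "Ad g X \<in> lie_algebra G"
proof (rule lie_algebra_group_curve)
  have sub: "subgroup G GL" using G by (simp add: algebraic_group_def)
  have inv: "invertible g" by (rule group_GL_mem(3)[OF sub g])
  show "mexp (Ad g X) 0 = mat 1" by simp
  show "mderiv (mexp (Ad g X)) (Ad g X) 0" by (rule mexp_deriv_0)
  show "mexp (Ad g X) t \<in> G" for t
  proof -
    have "g ** mexp X t ** matrix_inv g \<in> G"
      by (intro group_GL_mem(2)[OF sub] g mexp_in_group[OF G X] matrix_inv_in_group[OF sub g])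
    then show ?thesis unfolding mexp_Ad[OF inv] by (simp add: Ad_def)
  qed
qed

section \<open>The Zariski topology on the general linear group\<close>

lemma topspace_zariski_GL: "topspace zariski_GL = {A :: 'n::finite cmat. invertible A}"
proof -
  have "{A :: 'n cmat. invertible A \<and> (\<lambda>_. 1 :: complex) (entries A) \<noteq> 0} \<subseteq>
      \<Union>{{A. invertible A \<and> F (entries A) \<noteq> 0} | F. poly_fun F}"
    using poly_fun.const by blast
  then show ?thesis unfolding zariski_GL_def topology_generated_by_topspace by auto
qed

lemma continuous_map_into_zariski_GL:
  fixes f :: "'a \<Rightarrow> 'n::finite cmat"
  assumes "\<And>x. x \<in> topspace T \<Longrightarrow> invertible (f x)"
    and "\<And>F. poly_fun F \<Longrightarrow> openin T {x \<in> topspace T. F (entries (f x)) \<noteq> 0}"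
  shows "continuous_map T zariski_GL f"
  unfolding zariski_GL_def
proof (rule continuous_on_generated_topo)
  fix U assume "U \<in> {{A :: 'n cmat. invertible A \<and> F (entries A) \<noteq> 0} | F. poly_fun F}"
  then obtain F where F: "poly_fun F" "U = {A. invertible A \<and> F (entries A) \<noteq> 0}" by blast
  have "f -` U \<inter> topspace T = {x \<in> topspace T. F (entries (f x)) \<noteq> 0}"
    using assms(1) by (auto simp: F(2))
  then show "openin T (f -` U \<inter> topspace T)" using assms(2)[OF F(1)] by simp
next
  have "f ` topspace T \<subseteq> topspace zariski_GL" using assms(1) by (auto simp: topspace_zariski_GL)
  then show "f ` topspace T \<subseteq> \<Union>{{A. invertible A \<and> F (entries A) \<noteq> 0} | F. poly_fun F}"
    unfolding zariski_GL_def topology_generated_by_topspace .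
qed

lemma continuous_map_zariski_GL:
  fixes f :: "'n::finite cmat \<Rightarrow> 'n cmat"
  assumes "\<And>A. invertible A \<Longrightarrow> invertible (f A)"
    and "\<And>F. poly_fun F \<Longrightarrow> \<exists>H. poly_fun H \<and> (\<forall>A. invertible A \<longrightarrow> (F (entries (f A)) = 0 \<longleftrightarrow> H (entries A) = 0))"
  shows "continuous_map zariski_GL zariski_GL f"
proof (rule continuous_map_into_zariski_GL)
  fix F :: "('n \<times> 'n \<Rightarrow> complex) \<Rightarrow> complex" assume "poly_fun F"
  then obtain H where H: "poly_fun H" "\<And>A. invertible A \<Longrightarrow> F (entries (f A)) = 0 \<longleftrightarrow> H (entries A) = 0"
    using assms(2) by blast
  have "{A \<in> topspace zariski_GL. F (entries (f A)) \<noteq> 0} = {A. invertible A \<and> H (entries A) \<noteq> 0}"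
    using H(2) by (auto simp: topspace_zariski_GL)
  then show "openin zariski_GL {A \<in> topspace zariski_GL. F (entries (f A)) \<noteq> 0}"
    unfolding zariski_GL_def using H(1) by (auto intro!: topology_generated_by_Basis)
qed (use assms(1) in \<open>auto simp: topspace_zariski_GL\<close>)

lemma continuous_map_zariski_mult:
  fixes g h :: "'n::finite cmat"
  assumes "invertible g" "invertible h" shows "continuous_map zariski_GL zariski_GL (\<lambda>A. g ** A ** h)"
proof (rule continuous_map_zariski_GL)
  fix F :: "('n \<times> 'n \<Rightarrow> complex) \<Rightarrow> complex" assume F: "poly_fun F"
  have "poly_fun (\<lambda>x. F (entries (g ** mat_of x ** h)))"
    by (intro poly_fun_entries_compose F mat_poly_fun_mult mat_poly_fun_const mat_poly_fun_mat_of)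
  then show "\<exists>H. poly_fun H \<and> (\<forall>A. invertible A \<longrightarrow> (F (entries (g ** A ** h)) = 0 \<longleftrightarrow> H (entries A) = 0))"
    by (rule exI[of _ "\<lambda>x. F (entries (g ** mat_of x ** h))", OF conjI]) simp
qed (intro invertible_mult assms)

lemma matrix_inv_entry:
  assumes "invertible (A :: 'n::finite cmat)"
  shows "matrix_inv A $ i $ j =
    det (\<chi> p q. if q = i then (if p = j then 1 else 0) else A $ p $ q) / det A"
proof -
  let ?b = "(\<chi> p. if p = j then 1 else 0) :: complex ^ 'n"
  let ?x = "\<chi> i. matrix_inv A $ i $ j"
  have eq: "A *v ?x = ?b"
  proof (rule vec_eq_iff[THEN iffD2, rule_format])
    fix p
    have "(A *v ?x) $ p = (A ** matrix_inv A) $ p $ j"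
      by (simp add: matrix_vector_mult_def matmul_nth)
    then show "(A *v ?x) $ p = ?b $ p" by (simp add: matrix_inv_mult[OF assms] mat_def)
  qed
  have "det (\<chi> p q. if q = i then ?b $ p else A $ p $ q) = matrix_inv A $ i $ j * det A"
    using cramer_lemma[of i A ?x] unfolding eq by (simp only: vec_lambda_beta)
  then show ?thesis using assms by (simp add: invertible_det_nz cong: if_cong)
qed

text \<open>The entries of the inverse are polynomials divided by the determinant.\<close>

lemma poly_fun_inverse:
  assumes "poly_fun F"
  shows "\<exists>H k. poly_fun H \<and> (\<forall>A :: 'n::finite cmat. invertible A \<longrightarrow>
    H (entries A) = det A ^ k * F (entries (matrix_inv A)))"
  using assms
proof induction
  case (const c)
  show ?case by (rule exI[of _ "\<lambda>_. c"], rule exI[of _ 0]) (simp add: poly_fun.const)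
next
  case (coord e)
  obtain i j where e: "e = (i, j)" by (cases e)
  define M :: "('n \<times> 'n \<Rightarrow> complex) \<Rightarrow> 'n cmat"
    where "M x = (\<chi> p q. if q = i then (if p = j then 1 else 0) else x (p, q))" for x
  have M: "mat_poly_fun M"
    unfolding mat_poly_fun_def
  proof (intro allI)
    show "poly_fun (\<lambda>x. M x $ p $ q)" for p q
      by (cases "q = i"; cases "p = j") (simp_all add: M_def poly_fun.const poly_fun.coord)
  qed
  have "det (M (entries A)) = det A ^ 1 * entries (matrix_inv A) e" if "invertible A" for A
    using that by (simp add: M_def e entries_def matrix_inv_entry invertible_det_nz cong: if_cong)
  then show ?case using poly_fun_det[OF M] by blast
next
  case (add F F')
  obtain H k where H1: "poly_fun H"
    "\<forall>A :: 'n cmat. invertible A \<longrightarrow> H (entries A) = det A ^ k * F (entries (matrix_inv A))"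
    using add.IH(1) by (elim exE conjE)
  obtain H' k' where H2: "poly_fun H'"
    "\<forall>A :: 'n cmat. invertible A \<longrightarrow> H' (entries A) = det A ^ k' * F' (entries (matrix_inv A))"
    using add.IH(2) by (elim exE conjE)
  note H = H1(1) H2(1) H1(2)[rule_format] H2(2)[rule_format]
  let ?d = "\<lambda>x. det (mat_of x)"
  have pw: "poly_fun (\<lambda>x. ?d x ^ m)" for m
    by (induction m) (auto intro: poly_fun.const poly_fun.mult det_poly_fun)
  have "poly_fun (\<lambda>x. ?d x ^ k' * H x + ?d x ^ k * H' x)"
    by (intro poly_fun.add poly_fun.mult pw H)
  moreover have "?d (entries A) ^ k' * H (entries A) + ?d (entries A) ^ k * H' (entries A) =
      det A ^ (k + k') * (F (entries (matrix_inv A)) + F' (entries (matrix_inv A)))"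
    if "invertible A" for A
    by (simp only: H(3)[OF that] H(4)[OF that] mat_of_entries power_add distrib_left mult_ac)
  ultimately show ?case
    by (intro exI[of _ "\<lambda>x. ?d x ^ k' * H x + ?d x ^ k * H' x"] exI[of _ "k + k'"] conjI allI impI)
next
  case (mult F F')
  obtain H k where H1: "poly_fun H"
    "\<forall>A :: 'n cmat. invertible A \<longrightarrow> H (entries A) = det A ^ k * F (entries (matrix_inv A))"
    using mult.IH(1) by (elim exE conjE)
  obtain H' k' where H2: "poly_fun H'"
    "\<forall>A :: 'n cmat. invertible A \<longrightarrow> H' (entries A) = det A ^ k' * F' (entries (matrix_inv A))"
    using mult.IH(2) by (elim exE conjE)
  note H = H1(1) H2(1) H1(2)[rule_format] H2(2)[rule_format]
  show ?case
  proof (intro exI[of _ "\<lambda>x. H x * H' x"] exI[of _ "k + k'"] conjI allI impI)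
    show "poly_fun (\<lambda>x. H x * H' x)" by (intro poly_fun.mult H)
    show "H (entries A) * H' (entries A) =
        det A ^ (k + k') * (F (entries (matrix_inv A)) * F' (entries (matrix_inv A)))"
      if "invertible A" for A
      by (simp only: H(3)[OF that] H(4)[OF that] power_add mult_ac)
  qed
qed

lemma continuous_map_zariski_inverse: "continuous_map zariski_GL zariski_GL matrix_inv"
proof (rule continuous_map_zariski_GL)
  fix F :: "('a \<times> 'a \<Rightarrow> complex) \<Rightarrow> complex" assume "poly_fun F"
  then obtain H k where "poly_fun H"
    "\<forall>A. invertible A \<longrightarrow> H (entries A) = det A ^ k * F (entries (matrix_inv A))"
    using poly_fun_inverse by blast
  then show "\<exists>H. poly_fun H \<and> (\<forall>A. invertible A \<longrightarrow> (F (entries (matrix_inv A)) = 0 \<longleftrightarrow> H (entries A) = 0))"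
    by (intro exI[of _ H]) (simp add: invertible_det_nz)
qed (rule invertible_matrix_inv)

lemma connectedin_range_mexp: "connectedin zariski_GL (range (mexp A))"
proof (rule connectedin_continuous_map_image)
  show "continuous_map euclidean zariski_GL (mexp A)"
  proof (rule continuous_map_into_zariski_GL)
    fix F :: "('a \<times> 'a \<Rightarrow> complex) \<Rightarrow> complex" assume F: "poly_fun F"
    have "continuous_on UNIV (\<lambda>t. F (entries (mexp A t)))"
      using poly_differential_curve[OF F mexp_deriv, of A] by (intro continuous_at_imp_continuous_on) (auto intro: DERIV_isCont)
    then show "openin euclidean {t \<in> topspace euclidean. F (entries (mexp A t)) \<noteq> 0}"
      by (auto intro: open_Collect_neq continuous_on_const)
  qed (simp add: mexp_invertible)
qed (simp add: convex_connected)

lemma group_GL: "Group.group (GL :: 'n::finite cmat monoid)"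
proof (rule groupI)
  fix x :: "'n cmat" assume "x \<in> carrier GL"
  then show "\<exists>y\<in>carrier GL. y \<otimes>\<^bsub>GL\<^esub> x = \<one>\<^bsub>GL\<^esub>"
    by (intro bexI[of _ "matrix_inv x"]) (auto simp: GL_def matrix_inv_mult invertible_matrix_inv)
qed (auto simp: GL_def invertible_mult invertible_mat_1 matrix_mul_assoc)

lemma subgroup_GLI:
  assumes "mat 1 \<in> N" "\<And>x. x \<in> N \<Longrightarrow> invertible x" "\<And>x y. x \<in> N \<Longrightarrow> y \<in> N \<Longrightarrow> x ** y \<in> N"
    "\<And>x. x \<in> N \<Longrightarrow> matrix_inv x \<in> N"
  shows "subgroup N GL"
proof (rule group.subgroupI[OF group_GL])
  fix a assume a: "a \<in> N"
  have "m_inv GL a = matrix_inv a"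
    by (rule group.inv_equality[OF group_GL])
       (use assms(2)[OF a] in \<open>auto simp: GL_def matrix_inv_mult invertible_matrix_inv\<close>)
  then show "m_inv GL a \<in> N" using assms(4)[OF a] by simp
qed (use assms in \<open>auto simp: GL_def\<close>)

lemma closure_of_maps_into:
  assumes "continuous_map T T f" "f ` S \<subseteq> T closure_of R" "x \<in> T closure_of S"
  shows "f x \<in> T closure_of R"
proof -
  have "f x \<in> T closure_of (f ` S)" using continuous_map_image_closure_subset[OF assms(1)] assms(3) by blast
  moreover have "T closure_of (f ` S) \<subseteq> T closure_of R"
    by (rule closure_of_minimal[OF assms(2)]) simp
  ultimately show ?thesis by blast
qed

text \<open>Closedness under products takes two steps, as multiplication is only continuous in each variable
  separately: first by an element of the group, then by one of the closure.\<close>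

lemma subgroup_zariski_closure:
  assumes A: "subgroup A GL" shows "subgroup (zariski_GL closure_of A) GL"
proof -
  let ?N = "zariski_GL closure_of A"
  note mem = group_GL_mem[OF A]
  have sub: "A \<subseteq> ?N"
    by (rule closure_of_subset) (use mem(3) in \<open>auto simp: topspace_zariski_GL\<close>)
  have inv: "invertible x" if "x \<in> ?N" for x
    using that closure_of_subset_topspace[of zariski_GL A] by (auto simp: topspace_zariski_GL)
  have 1: "a ** x \<in> ?N" if "a \<in> A" "x \<in> ?N" for a x
  proof -
    have "a ** x ** mat 1 \<in> ?N"
      by (rule closure_of_maps_into[OF continuous_map_zariski_mult _ that(2)])
         (use mem sub that in \<open>auto simp: invertible_mat_1\<close>)
    then show ?thesis by simp
  qed
  have 2: "y ** x \<in> ?N" if "y \<in> ?N" "x \<in> ?N" for x y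
  proof -
    have "mat 1 ** y ** x \<in> ?N"
      by (rule closure_of_maps_into[OF continuous_map_zariski_mult _ that(1)])
         (use 1 that inv in \<open>auto simp: invertible_mat_1\<close>)
    then show ?thesis by simp
  qed
  show ?thesis
  proof (rule subgroup_GLI)
    fix x assume "x \<in> ?N"
    then show "matrix_inv x \<in> ?N"
      by (rule closure_of_maps_into[OF continuous_map_zariski_inverse, rotated])
         (use matrix_inv_in_group[OF A] sub in auto)
  qed (use mem(1) sub inv 2 in auto)
qed

lemma zariski_closure_commute:
  assumes "\<And>a. a \<in> A \<Longrightarrow> invertible a" "\<And>a. a \<in> A \<Longrightarrow> a ** g = g ** a" "x \<in> zariski_GL closure_of A"
  shows "x ** g = g ** x"
proof -
  let ?c = "\<lambda>(i, j) x. (mat_of x ** g - g ** mat_of x) $ i $ j"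
  let ?Z = "{x. invertible x \<and> (\<forall>F\<in>range ?c. F (entries x) = 0)}"
  have "mat_poly_fun (\<lambda>x. mat_of x ** g - g ** mat_of x)"
    by (intro mat_poly_fun_diff mat_poly_fun_mult mat_poly_fun_const mat_poly_fun_mat_of)
  then have "\<forall>F\<in>range ?c. poly_fun F" by (auto simp: mat_poly_fun_def)
  then have "closedin zariski_GL ?Z" unfolding closedin_zariski_GL by blast
  moreover have "A \<subseteq> ?Z" using assms(1,2) by auto
  ultimately have "x \<in> ?Z" using closure_of_minimal assms(3) by blast
  then show ?thesis by (auto simp: vec_eq_iff)
qed

section \<open>Semisimple groups have Lie algebras with trivial center\<close>

lemma solvable_commutative:
  assumes N: "subgroup N GL" and comm: "\<And>x y. x \<in> N \<Longrightarrow> y \<in> N \<Longrightarrow> x ** y = y ** x"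
  shows "solvable (GL\<lparr>carrier := N\<rparr>)"
proof -
  interpret N: Group.group "GL\<lparr>carrier := N\<rparr>"
    by (rule group.subgroup_imp_group[OF group_GL N])
  interpret N: comm_group "GL\<lparr>carrier := N\<rparr>"
    by (rule N.group_comm_groupI) (use comm in \<open>auto simp: GL_def\<close>)
  have "derived (GL\<lparr>carrier := N\<rparr>) N = {\<one>\<^bsub>GL\<lparr>carrier := N\<rparr>\<^esub>}"
    by (rule N.derived_eq_singleton) simp
  then have "((derived (GL\<lparr>carrier := N\<rparr>)) ^^ 1) N = {\<one>\<^bsub>GL\<lparr>carrier := N\<rparr>\<^esub>}" by simp
  then have "solvable_seq (GL\<lparr>carrier := N\<rparr>) N"
    by (rule N.trivial_derived_seq_imp_solvable[rotated]) (use N.subgroup_self in simp)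
  then show ?thesis by (simp add: solvable_def)
qed

lemma normal_in_subgroup_GL:
  assumes G: "subgroup G GL" and N: "subgroup N GL" "N \<subseteq> G"
    and norm: "\<And>g x. g \<in> G \<Longrightarrow> x \<in> N \<Longrightarrow> Ad g x \<in> N"
  shows "N \<lhd> GL\<lparr>carrier := G\<rparr>"
proof -
  interpret G: Group.group "GL\<lparr>carrier := G\<rparr>"
    by (rule group.subgroup_imp_group[OF group_GL G])
  have inv: "m_inv (GL\<lparr>carrier := G\<rparr>) g = matrix_inv g" if "g \<in> G" for g
    by (rule G.inv_equality)
       (use that matrix_inv_in_group[OF G that] group_GL_mem(3)[OF G that] in \<open>auto simp: GL_def matrix_inv_mult\<close>)
  have "subgroup N (GL\<lparr>carrier := G\<rparr>)"
    by (rule group.subgroup_incl[OF group_GL N(1) G N(2)])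
  then show ?thesis
    unfolding G.normal_inv_iff using norm inv by (auto simp: GL_def Ad_def)
qed

text \<open>The exponentials of the center form a connected commutative group, normalized by \<open>G\<close>.  Its Zariski
  closure inherits these properties, so it is trivial in a semisimple group.  Working with the
  center of the Lie algebra, rather than of the group, makes normality hold for disconnected
  \<open>G\<close> too.\<close>

lemma semisimple_center_trivial:
  assumes G: "semisimple_group G" and Z: "Z \<in> lie_algebra G"
    and comm: "\<And>Y. Y \<in> lie_algebra G \<Longrightarrow> Z ** Y = Y ** Z"
  shows "Z = 0"
proof -
  have alg: "algebraic_group G" using G by (simp add: semisimple_group_def)
  then have sub: "subgroup G GL" and clo: "closedin zariski_GL G" by (auto simp: algebraic_group_def)
  define z where "z = {Z \<in> lie_algebra G. \<forall>Y\<in>lie_algebra G. Z ** Y = Y ** Z}"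
  define A where "A = (\<Union>Z\<in>z. range (mexp Z))"
  have z_scale: "c *\<^sub>C X \<in> z" if "X \<in> z" for c X
    using that cmat.subspace_scale[OF lie_algebra_subspace] by (auto simp: z_def matmul_ring)
  have z_add: "X + Y \<in> z" if "X \<in> z" "Y \<in> z" for X Y
    using that cmat.subspace_add[OF lie_algebra_subspace] by (auto simp: z_def matmul_ring)
  have zero: "0 \<in> z" using cmat.subspace_0[OF lie_algebra_subspace] by (simp add: z_def)
  have z_Ad: "Ad g X \<in> z" if g: "g \<in> G" and X: "X \<in> z" for g X
  proof -
    note inv = group_GL_mem(3)[OF sub g]
    have "Ad g X ** Y = Y ** Ad g X" if Y: "Y \<in> lie_algebra G" for Y
    proof -
      have "Ad (matrix_inv g) Y \<in> lie_algebra G"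
        by (rule lie_algebra_Ad[OF alg matrix_inv_in_group[OF sub g] Y])
      then have "Ad g (X ** Ad (matrix_inv g) Y) = Ad g (Ad (matrix_inv g) Y ** X)"
        using X by (simp add: z_def)
      then show ?thesis by (simp only: Ad_simps[OF inv])
    qed
    then show ?thesis using lie_algebra_Ad[OF alg g] X by (simp add: z_def)
  qed
  have AI: "mexp X t \<in> A" if "X \<in> z" for X t using that by (auto simp: A_def)
  have AE: "\<exists>X\<in>z. a = mexp X 1" if a: "a \<in> A" for a
  proof -
    obtain X t where "X \<in> z" "a = mexp X t" using a by (auto simp: A_def)
    then show ?thesis using z_scale by (intro bexI[of _ "t *\<^sub>C X"]) (auto simp: mexp_scale_arg)
  qed
  have z_comm: "X ** Y = Y ** X" if "X \<in> z" "Y \<in> z" for X Y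
    using that unfolding z_def by blast
  have A_mult: "a ** b \<in> A \<and> a ** b = b ** a" if "a \<in> A" "b \<in> A" for a b
  proof -
    obtain X Y where XY: "X \<in> z" "Y \<in> z" "a = mexp X 1" "b = mexp Y 1" using AE \<open>a \<in> A\<close> \<open>b \<in> A\<close> by blast
    have "mexp X 1 ** mexp Y 1 = mexp (X + Y) 1" "mexp Y 1 ** mexp X 1 = mexp (Y + X) 1"
      by (simp_all add: mexp_add[OF z_comm] XY)
    then show ?thesis using AI[OF z_add[OF XY(1,2)], of 1] XY by (simp add: add.commute)
  qed
  have A_inv: "invertible a" if "a \<in> A" for a using that by (auto simp: A_def mexp_invertible)
  have subA: "subgroup A GL"
  proof (rule subgroup_GLI)
    show "mat 1 \<in> A" using AI[OF zero, of 0] by simp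
    fix x assume "x \<in> A"
    then obtain X where "X \<in> z" "x = mexp X 1" using AE by blast
    then show "matrix_inv x \<in> A" by (simp add: matrix_inv_mexp AI)
  qed (use A_mult A_inv in auto)
  have AG: "A \<subseteq> G" unfolding A_def z_def using mexp_in_group[OF alg] by auto
  define N where "N = zariski_GL closure_of A"
  have subN: "subgroup N GL" unfolding N_def by (rule subgroup_zariski_closure[OF subA])
  have NG: "N \<subseteq> G" unfolding N_def by (rule closure_of_minimal[OF AG clo])
  have algN: "algebraic_group N" using subN by (simp add: algebraic_group_def N_def)
  have "connectedin zariski_GL A"
    unfolding A_def
  proof (rule connectedin_Union)
    have "mat 1 \<in> range (mexp Z)" for Z :: "'a cmat" using rangeI[of "mexp Z" 0] by simp
    then have "mat 1 \<in> \<Inter>((\<lambda>Z. range (mexp Z)) ` z)" by blast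
    then show "\<Inter>((\<lambda>Z. range (mexp Z)) ` z) \<noteq> {}" by blast
  qed (auto intro: connectedin_range_mexp)
  then have conN: "connectedin zariski_GL N" unfolding N_def by (rule connectedin_closure_of)
  have xa: "x ** a = a ** x" if "x \<in> N" "a \<in> A" for x a
  proof (rule zariski_closure_commute[of A])
    show "b ** a = a ** b" if "b \<in> A" for b using A_mult[OF that \<open>a \<in> A\<close>] by blast
  qed (use that A_inv in \<open>simp_all add: N_def\<close>)
  have commN: "x ** y = y ** x" if "x \<in> N" "y \<in> N" for x y
  proof -
    have "y ** x = x ** y"
    proof (rule zariski_closure_commute[of A])
      show "b ** x = x ** b" if "b \<in> A" for b by (rule xa[OF \<open>x \<in> N\<close> that, symmetric])
    qed (use that A_inv in \<open>simp_all add: N_def\<close>)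
    then show ?thesis ..
  qed
  have "Ad g a \<in> A" if g: "g \<in> G" and a: "a \<in> A" for g a
  proof -
    obtain X where X: "X \<in> z" "a = mexp X 1" using AE[OF a] by blast
    have "Ad g a = mexp (Ad g X) 1" by (simp add: X(2) mexp_Ad group_GL_mem(3)[OF sub g])
    then show ?thesis using AI[OF z_Ad[OF g X(1)]] by simp
  qed
  moreover have "A \<subseteq> N" unfolding N_def
    by (rule closure_of_subset) (use A_inv in \<open>auto simp: topspace_zariski_GL\<close>)
  ultimately have normN: "Ad g x \<in> N" if "g \<in> G" "x \<in> N" for g x
    unfolding N_def Ad_def
    by (intro closure_of_maps_into[OF continuous_map_zariski_mult])
       (use that group_GL_mem(3)[OF sub] in \<open>auto simp: N_def Ad_def invertible_matrix_inv\<close>)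
  have "N \<lhd> GL\<lparr>carrier := G\<rparr>" by (rule normal_in_subgroup_GL[OF sub subN NG normN])
  then have "N = {mat 1}"
    using G algN conN solvable_commutative[OF subN commN] unfolding semisimple_group_def by blast
  then have "mexp Z t = mexp 0 t" for t
  proof -
    have "Z \<in> z" using Z comm by (simp add: z_def)
    then have "mexp Z t \<in> N" "mexp 0 t \<in> N" using AI zero \<open>A \<subseteq> N\<close> by auto
    then show ?thesis using \<open>N = {mat 1}\<close> by simp
  qed
  then show ?thesis by (rule mexp_inject)
qed

section \<open>Symmetric pairs\<close>

lemma regular_extension_differential:
  fixes \<Phi> :: "'n::finite cmat \<Rightarrow> 'n cmat"
  assumes "regular_extension G \<phi> \<Phi>"
  shows "\<exists>L. (\<forall>Y Y'. Y 0 = mat 1 \<longrightarrow> mderiv Y Y' 0 \<longrightarrow> mderiv (\<lambda>t. \<Phi> (Y t)) (L Y') 0) \<and>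
    (\<forall>c X Z. L (c *\<^sub>C X + Z) = c *\<^sub>C L X + L Z)"
proof -
  have "\<forall>i j. \<exists>L. (\<forall>Y Y'. Y 0 = mat 1 \<longrightarrow> mderiv Y Y' 0 \<longrightarrow>
      ((\<lambda>t. \<Phi> (Y t) $ i $ j) has_field_derivative L Y') (at 0)) \<and>
    (\<forall>c X Z. L (c *\<^sub>C X + Z) = c * L X + L Z)"
    using assms regular_GL_differential unfolding regular_extension_def by blast
  then obtain L where
    L: "\<And>i j Y Y'. Y 0 = mat 1 \<Longrightarrow> mderiv Y Y' 0 \<Longrightarrow>
        ((\<lambda>t. \<Phi> (Y t) $ i $ j) has_field_derivative L i j Y') (at 0)"
      "\<And>i j c X Z. L i j (c *\<^sub>C X + Z) = c * L i j X + L i j Z"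
    by metis
  show ?thesis
  proof (intro exI[of _ "\<lambda>X. \<chi> i j. L i j X"] conjI allI impI)
    show "mderiv (\<lambda>t. \<Phi> (Y t)) (\<chi> i j. L i j Y') 0" if "Y 0 = mat 1" "mderiv Y Y' 0" for Y Y'
      using L(1)[OF that] by (simp add: mderiv_def)
    show "(\<chi> i j. L i j (c *\<^sub>C X + Z)) = c *\<^sub>C (\<chi> i j. L i j X) + (\<chi> i j. L i j Z)" for c X Z
      by (simp add: vec_eq_iff L(2))
  qed
qed

text \<open>The differential along \<open>exp (t X)\<close> does not involve the extension, since the curve
  stays in the group.\<close>

lemma differential_linear:
  fixes \<phi> :: "'n::finite cmat \<Rightarrow> 'n cmat"
  assumes G: "algebraic_group G" and ext: "\<exists>\<Phi>. regular_extension G \<phi> \<Phi>"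
  shows "\<exists>L. (\<forall>c X Z. L (c *\<^sub>C X + Z) = c *\<^sub>C L X + L Z) \<and>
    (\<forall>X\<in>lie_algebra G. differential G \<phi> X = L X \<and> mderiv (\<lambda>t. \<phi> (mexp X t)) (L X) 0)"
proof -
  obtain \<Phi> where Phi: "regular_extension G \<phi> \<Phi>" using ext by blast
  obtain L where
    L: "\<And>Y Y'. Y 0 = mat 1 \<Longrightarrow> mderiv Y Y' 0 \<Longrightarrow> mderiv (\<lambda>t. \<Phi> (Y t)) (L Y') 0"
      "\<And>c X Z. L (c *\<^sub>C X + Z) = c *\<^sub>C L X + L Z"
    using regular_extension_differential[OF Phi] by metis
  have along: "\<Psi> (mexp X t) = \<phi> (mexp X t)" if "regular_extension G \<phi> \<Psi>" "X \<in> lie_algebra G" for \<Psi> X t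
    using that mexp_in_group[OF G that(2)] by (simp add: regular_extension_def)
  have curve: "mderiv (\<lambda>t. \<phi> (mexp X t)) (L X) 0" if "X \<in> lie_algebra G" for X
    using L(1)[OF mexp_0 mexp_deriv_0, of X] along[OF Phi that] by simp
  have line: "mderiv (\<lambda>t. \<Psi> (mat 1 + t *\<^sub>C X)) (L X) 0"
    if Psi: "regular_extension G \<phi> \<Psi>" and X: "X \<in> lie_algebra G" for \<Psi> X
  proof -
    obtain M where M: "\<And>Y Y'. Y 0 = mat 1 \<Longrightarrow> mderiv Y Y' 0 \<Longrightarrow> mderiv (\<lambda>t. \<Psi> (Y t)) (M Y') 0"
      using regular_extension_differential[OF Psi] by metis
    have "mderiv (\<lambda>t. \<phi> (mexp X t)) (M X) 0"
      using M[OF mexp_0 mexp_deriv_0, of X] along[OF Psi X] by simp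
    then have "M X = L X" using curve[OF X] by (rule mderiv_unique)
    then show ?thesis using M[OF _ mderiv_line, of X] by simp
  qed
  have "differential G \<phi> X = L X" if X: "X \<in> lie_algebra G" for X
    unfolding differential_def
  proof (rule the_equality)
    show "\<forall>\<Psi>. regular_extension G \<phi> \<Psi> \<longrightarrow> (\<forall>i j.
        ((\<lambda>t. \<Psi> (mat 1 + t *\<^sub>C X) $ i $ j) has_field_derivative L X $ i $ j) (at 0))"
      using line[OF _ X] unfolding mderiv_def by blast
    fix Y assume "\<forall>\<Psi>. regular_extension G \<phi> \<Psi> \<longrightarrow> (\<forall>i j.
        ((\<lambda>t. \<Psi> (mat 1 + t *\<^sub>C X) $ i $ j) has_field_derivative Y $ i $ j) (at 0))"
    then have "mderiv (\<lambda>t. \<Phi> (mat 1 + t *\<^sub>C X)) Y 0" using Phi unfolding mderiv_def by blast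
    then show "Y = L X" using line[OF Phi X] by (rule mderiv_unique)
  qed
  then show ?thesis using L(2) curve by blast
qed

locale symmetric_pair =
  fixes G :: "'n::finite cmat set" and \<theta> :: "'n cmat \<Rightarrow> 'n cmat"
  assumes alg: "algebraic_group G" and hom: "algebraic_hom G G \<theta>"
    and invol: "\<And>g. g \<in> G \<Longrightarrow> \<theta> (\<theta> g) = g"
begin

abbreviation (input) "\<gg> \<equiv> lie_algebra G"
abbreviation (input) "d\<theta> \<equiv> differential G \<theta>"

lemma sub: "subgroup G GL" using alg by (simp add: algebraic_group_def)

lemma theta_mult: "g \<in> G \<Longrightarrow> h \<in> G \<Longrightarrow> \<theta> (g ** h) = \<theta> g ** \<theta> h"
  and theta_mem: "g \<in> G \<Longrightarrow> \<theta> g \<in> G"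
  using hom by (auto simp: algebraic_hom_def hom_def GL_def)

lemma theta_one: "\<theta> (mat 1) = mat 1"
proof -
  have 1: "mat 1 \<in> G" by (rule group_GL_mem(1)[OF sub])
  have "\<theta> (mat 1) ** \<theta> (mat 1) = \<theta> (mat 1) ** mat 1" using theta_mult[OF 1 1] by simp
  then show ?thesis
    using invertible_matmul_left_cancel[OF group_GL_mem(3)[OF sub theta_mem[OF 1]]] by blast
qed

lemma dtheta_linear_ex:
  "\<exists>L. (\<forall>c X Z. L (c *\<^sub>C X + Z) = c *\<^sub>C L X + L Z) \<and>
    (\<forall>X\<in>\<gg>. d\<theta> X = L X \<and> mderiv (\<lambda>t. \<theta> (mexp X t)) (L X) 0)"
  using differential_linear[OF alg] hom unfolding algebraic_hom_def by blast

lemma dtheta_deriv: "X \<in> \<gg> \<Longrightarrow> mderiv (\<lambda>t. \<theta> (mexp X t)) (d\<theta> X) 0"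
  using dtheta_linear_ex by auto

lemma dtheta_linear: "X \<in> \<gg> \<Longrightarrow> Z \<in> \<gg> \<Longrightarrow> d\<theta> (c *\<^sub>C X + Z) = c *\<^sub>C d\<theta> X + d\<theta> Z"
proof -
  assume X: "X \<in> \<gg>" "Z \<in> \<gg>"
  then have "c *\<^sub>C X + Z \<in> \<gg>"
    by (intro cmat.subspace_add cmat.subspace_scale lie_algebra_subspace)
  then show ?thesis using dtheta_linear_ex X by metis
qed

lemma theta_mexp:
  assumes X: "X \<in> \<gg>" shows "\<theta> (mexp X t) = mexp (d\<theta> X) t"
proof (rule mexp_unique)
  note mem = mexp_in_group[OF alg X]
  fix t
  have "mderiv (\<lambda>s. \<theta> (mexp X (s - t)) ** \<theta> (mexp X t)) (d\<theta> X ** \<theta> (mexp X t)) t"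
  proof (rule mderiv_mult_const(2))
    have "mderiv (\<lambda>s. \<theta> (mexp X (s - t))) (1 *\<^sub>C d\<theta> X) t"
      by (rule mderiv_chain) (use dtheta_deriv[OF X] in \<open>auto intro!: derivative_eq_intros\<close>)
    then show "mderiv (\<lambda>s. \<theta> (mexp X (s - t))) (d\<theta> X) t" by simp
  qed
  moreover have "\<theta> (mexp X (s - t)) ** \<theta> (mexp X t) = \<theta> (mexp X s)" for s
    using theta_mult[OF mem mem, of "s - t" t] mexp_add_arg[of X "s - t" t] by simp
  ultimately show "mderiv (\<lambda>s. \<theta> (mexp X s)) (d\<theta> X ** \<theta> (mexp X t)) t" by simp
qed (simp add: theta_one)

lemma dtheta_mem: "X \<in> \<gg> \<Longrightarrow> d\<theta> X \<in> \<gg>"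
proof (rule lie_algebra_group_curve[of "mexp (d\<theta> X)"])
  assume X: "X \<in> \<gg>"
  show "mexp (d\<theta> X) t \<in> G" for t
    using theta_mem[OF mexp_in_group[OF alg X]] by (simp add: theta_mexp[OF X])
qed (simp_all add: mexp_deriv_0)

lemma dtheta_invol:
  assumes X: "X \<in> \<gg>" shows "d\<theta> (d\<theta> X) = X"
proof (rule mexp_inject)
  fix t
  have "mexp (d\<theta> (d\<theta> X)) t = \<theta> (\<theta> (mexp X t))"
    by (simp add: theta_mexp[OF X] theta_mexp[OF dtheta_mem[OF X]])
  then show "mexp (d\<theta> (d\<theta> X)) t = mexp X t" by (simp add: invol mexp_in_group[OF alg X])
qed

lemma dtheta_Ad:
  assumes X: "X \<in> \<gg>" and g: "g \<in> G" shows "d\<theta> (Ad g X) = Ad (\<theta> g) (d\<theta> X)"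
proof (rule mexp_inject)
  fix t
  note inv = group_GL_mem(3)[OF sub g] group_GL_mem(3)[OF sub theta_mem[OF g]]
  have gi: "matrix_inv g \<in> G" by (rule matrix_inv_in_group[OF sub g])
  have "\<theta> g ** \<theta> (matrix_inv g) = mat 1"
    using theta_mult[OF g gi] by (simp add: matrix_inv_mult[OF inv(1)] theta_one)
  then have ti: "\<theta> (matrix_inv g) = matrix_inv (\<theta> g)" using matrix_inv_eqI by metis
  have "mexp (d\<theta> (Ad g X)) t = \<theta> (g ** mexp X t ** matrix_inv g)"
    using theta_mexp[OF lie_algebra_Ad[OF alg g X]] mexp_Ad[OF inv(1)] by (simp add: Ad_def)
  also have "\<dots> = \<theta> g ** \<theta> (mexp X t) ** matrix_inv (\<theta> g)"
    using theta_mult g gi group_GL_mem(2)[OF sub] mexp_in_group[OF alg X] by (simp add: ti)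
  also have "\<dots> = mexp (Ad (\<theta> g) (d\<theta> X)) t"
    unfolding theta_mexp[OF X] mexp_Ad[OF inv(2)] by (simp add: Ad_def)
  finally show "mexp (d\<theta> (Ad g X)) t = mexp (Ad (\<theta> g) (d\<theta> X)) t" .
qed

definition \<kk> :: "'n cmat set" where "\<kk> = {X \<in> \<gg>. d\<theta> X = X}"

lemma eigenspace_subspace: "cmat.subspace {X \<in> \<gg>. d\<theta> X = a *\<^sub>C X}"
  unfolding cmat.subspace_def
proof (intro conjI ballI allI)
  have z: "0 \<in> \<gg>" by (rule cmat.subspace_0[OF lie_algebra_subspace])
  have d0: "d\<theta> 0 = 0" using dtheta_linear[OF z z, of 1] by simp
  then show "0 \<in> {X \<in> \<gg>. d\<theta> X = a *\<^sub>C X}" using z by simp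
  show "x + y \<in> {X \<in> \<gg>. d\<theta> X = a *\<^sub>C X}"
    if "x \<in> {X \<in> \<gg>. d\<theta> X = a *\<^sub>C X}" "y \<in> {X \<in> \<gg>. d\<theta> X = a *\<^sub>C X}" for x y
    using that dtheta_linear[of x y 1] cmat.subspace_add[OF lie_algebra_subspace, of x G y]
    by (simp add: cmat.scale_right_distrib)
  show "c *\<^sub>C x \<in> {X \<in> \<gg>. d\<theta> X = a *\<^sub>C X}" if "x \<in> {X \<in> \<gg>. d\<theta> X = a *\<^sub>C X}" for c x
    using that dtheta_linear[of x 0 c] z d0 cmat.subspace_scale[OF lie_algebra_subspace, of x G c]
    by (simp add: mult.commute)
qed

lemma subspace_k: "cmat.subspace \<kk>"
  using eigenspace_subspace[of 1] by (simp add: \<kk>_def)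

lemma subspace_p: "cmat.subspace (sym_p G \<theta>)"
  using eigenspace_subspace[of "- 1"] by (simp add: sym_p_def)

lemma decomposition:
  assumes "Y \<in> \<gg>" shows "\<exists>A\<in>\<kk>. \<exists>B\<in>sym_p G \<theta>. Y = A + B"
proof -
  note S = lie_algebra_subspace[of G]
  have dY: "d\<theta> Y \<in> \<gg>" by (rule dtheta_mem[OF assms])
  define A where "A = (1 / 2) *\<^sub>C (1 *\<^sub>C Y + d\<theta> Y)"
  define B where "B = (1 / 2) *\<^sub>C ((- 1) *\<^sub>C d\<theta> Y + Y)"
  have 1: "1 *\<^sub>C Y + d\<theta> Y \<in> \<gg>" "(- 1) *\<^sub>C d\<theta> Y + Y \<in> \<gg>"
    by (intro cmat.subspace_add[OF S] cmat.subspace_scale[OF S] assms dY)+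
  have z: "0 \<in> \<gg>" by (rule cmat.subspace_0[OF S])
  have d0: "d\<theta> 0 = 0" using dtheta_linear[OF z z, of 1] by simp
  have ds: "d\<theta> ((1 / 2) *\<^sub>C X) = (1 / 2) *\<^sub>C d\<theta> X" if "X \<in> \<gg>" for X
    using dtheta_linear[OF that z, of "1 / 2"] d0 by simp
  have "d\<theta> A = A" unfolding A_def ds[OF 1(1)] dtheta_linear[OF assms dY] dtheta_invol[OF assms]
    by (simp add: add.commute)
  moreover have "d\<theta> B = - B" unfolding B_def ds[OF 1(2)] dtheta_linear[OF dY assms] dtheta_invol[OF assms]
    by (simp add: vec_eq_iff field_simps)
  moreover have "A \<in> \<gg>" "B \<in> \<gg>" unfolding A_def B_def
    by (intro cmat.subspace_scale[OF S] 1)+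
  moreover have "Y = A + B" by (simp add: A_def B_def vec_eq_iff field_simps)
  ultimately show ?thesis by (auto simp: \<kk>_def sym_p_def)
qed

text \<open>The curve \<open>Ad (exp (t X)) Y + Ad (exp (- t X)) (- Y)\<close> is fixed by the differential of the involution, which
  exchanges its two summands; its derivative at \<open>0\<close> is \<open>2 [X, Y]\<close>.\<close>

lemma bracket_p_p:
  assumes X: "X \<in> sym_p G \<theta>" and Y: "Y \<in> sym_p G \<theta>" shows "bracket X Y \<in> \<kk>"
proof -
  have g: "X \<in> \<gg>" "Y \<in> \<gg>" "d\<theta> X = - X" "d\<theta> Y = - Y" using X Y by (auto simp: sym_p_def)
  have mX: "- X \<in> \<gg>" "- Y \<in> \<gg>" using g dtheta_mem by metis+
  define Z where "Z t = Ad (mexp X t) Y + Ad (mexp (- X) t) (- Y)" for t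
  have "Z t \<in> \<kk>" for t
  proof -
    let ?U = "Ad (mexp X t) Y" and ?W = "Ad (mexp (- X) t) (- Y)"
    have UW: "?U \<in> \<gg>" "?W \<in> \<gg>"
      by (intro lie_algebra_Ad[OF alg] mexp_in_group[OF alg] g mX)+
    have dU: "d\<theta> ?U = ?W"
      by (simp add: dtheta_Ad[OF g(2) mexp_in_group[OF alg g(1)]] theta_mexp[OF g(1)] g)
    then have "d\<theta> ?W = ?U" using dtheta_invol[OF UW(1)] by simp
    then have "d\<theta> (Z t) = Z t" using dtheta_linear[OF UW, of 1] dU by (simp add: Z_def add.commute)
    moreover have "Z t \<in> \<gg>" unfolding Z_def by (intro cmat.subspace_add[OF lie_algebra_subspace] UW)
    ultimately show ?thesis by (simp add: \<kk>_def)
  qed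
  moreover have "mderiv Z (bracket X Y + bracket (- X) (- Y)) 0"
    unfolding Z_def by (intro mderiv_add Ad_mexp_deriv)
  ultimately have "bracket X Y + bracket (- X) (- Y) \<in> \<kk>" by (rule mderiv_in_subspace[OF subspace_k])
  then have "(1 / 2) *\<^sub>C (bracket X Y + bracket (- X) (- Y)) \<in> \<kk>"
    by (rule cmat.subspace_scale[OF subspace_k])
  moreover have "(1 / 2) *\<^sub>C (bracket X Y + bracket (- X) (- Y)) = bracket X Y"
    by (simp add: bracket_simps vec_eq_iff)
  ultimately show ?thesis by simp
qed

lemma symK_subset: "symK G \<theta> \<subseteq> {g \<in> G. \<theta> g = g}"
proof -
  have "symK G \<theta> \<subseteq> topspace (subtopology zariski_GL {g \<in> G. \<theta> g = g})"
    unfolding symK_def identity_component_def by (rule connected_component_of_subset_topspace)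
  then show ?thesis by auto
qed

lemma mexp_in_symK:
  assumes Y: "Y \<in> \<kk>" shows "mexp Y t \<in> symK G \<theta>"
proof -
  have g: "Y \<in> \<gg>" "d\<theta> Y = Y" using Y by (auto simp: \<kk>_def)
  have "range (mexp Y) \<subseteq> {g \<in> G. \<theta> g = g}"
    using mexp_in_group[OF alg g(1)] theta_mexp[OF g(1)] g(2) by auto
  then have "connectedin (subtopology zariski_GL {g \<in> G. \<theta> g = g}) (range (mexp Y))"
    by (simp add: connectedin_subtopology connectedin_range_mexp)
  moreover have "mat 1 \<in> range (mexp Y)" using rangeI[of "mexp Y" 0] by simp
  ultimately show ?thesis
    unfolding symK_def identity_component_def connected_component_of_set by blast
qed

end

section \<open>Exponential polynomials\<close>

lemma exp_poly_independent:
  fixes p :: "complex \<Rightarrow> complex poly"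
  assumes "finite S" "\<And>t. (\<Sum>\<nu>\<in>S. exp (\<nu> * t) * poly (p \<nu>) t) = 0"
  shows "\<forall>\<nu>\<in>S. p \<nu> = 0"
  using assms
proof (induction S arbitrary: p rule: finite_induct)
  case (insert \<nu>0 S)
  \<comment> \<open>Dividing by the first exponential and differentiating often enough kills its
    polynomial, while the others are subjected to an injective operator.\<close>
  define T where "T a q = smult a q + pderiv q" for a :: complex and q
  have T_inj: "q = 0" if "T a q = 0" "a \<noteq> 0" for a q
  proof (rule ccontr)
    assume q: "q \<noteq> 0"
    have "coeff (pderiv q) (degree q) = 0" by (simp add: coeff_pderiv coeff_eq_0)
    then have "coeff (T a q) (degree q) = a * lead_coeff q" by (simp add: T_def)
    then show False using that q by simp
  qed
  have T_pow_inj: "q = 0" if "(T a ^^ k) q = 0" "a \<noteq> 0" for a q k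
    using that by (induction k) (auto dest: T_inj)
  have der: "(\<Sum>\<nu>\<in>insert \<nu>0 S. exp ((\<nu> - \<nu>0) * t) * poly ((T (\<nu> - \<nu>0) ^^ k) (p \<nu>)) t) = 0" for k t
  proof (induction k arbitrary: t)
    case 0
    have "(\<Sum>\<nu>\<in>insert \<nu>0 S. exp ((\<nu> - \<nu>0) * t) * poly (p \<nu>) t) =
        exp (- (\<nu>0 * t)) * (\<Sum>\<nu>\<in>insert \<nu>0 S. exp (\<nu> * t) * poly (p \<nu>) t)"
      unfolding sum_distrib_left
    proof (rule sum.cong)
      fix \<nu>
      have "exp ((\<nu> - \<nu>0) * t) = exp (- (\<nu>0 * t)) * exp (\<nu> * t)"
        unfolding exp_add[symmetric] by (simp add: left_diff_distrib)
      then show "exp ((\<nu> - \<nu>0) * t) * poly (p \<nu>) t = exp (- (\<nu>0 * t)) * (exp (\<nu> * t) * poly (p \<nu>) t)"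
        by (simp only: mult.assoc)
    qed simp
    then show ?case using insert.prems by (simp only: funpow_0 mult_zero_right)
  next
    case (Suc k)
    have "((\<lambda>t. \<Sum>\<nu>\<in>insert \<nu>0 S. exp ((\<nu> - \<nu>0) * t) * poly ((T (\<nu> - \<nu>0) ^^ k) (p \<nu>)) t)
        has_field_derivative (\<Sum>\<nu>\<in>insert \<nu>0 S. exp ((\<nu> - \<nu>0) * t) * poly ((T (\<nu> - \<nu>0) ^^ Suc k) (p \<nu>)) t)) (at t)"
    proof (rule DERIV_sum)
      fix \<nu>
      let ?a = "\<nu> - \<nu>0" and ?q = "(T (\<nu> - \<nu>0) ^^ k) (p \<nu>)"
      have 1: "((\<lambda>t. exp (?a * t)) has_field_derivative exp (?a * t) * ?a) (at t)"
        by (auto intro!: derivative_eq_intros)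
      have "exp (?a * t) * ?a * poly ?q t + poly (pderiv ?q) t * exp (?a * t) =
          exp (?a * t) * poly ((T ?a ^^ Suc k) (p \<nu>)) t"
        by (simp add: T_def distrib_left mult_ac)
      then show "((\<lambda>t. exp (?a * t) * poly ?q t) has_field_derivative
          exp (?a * t) * poly ((T ?a ^^ Suc k) (p \<nu>)) t) (at t)"
        using DERIV_mult[OF 1 poly_DERIV, of ?q] by metis
    qed
    then have "((\<lambda>t. 0) has_field_derivative
        (\<Sum>\<nu>\<in>insert \<nu>0 S. exp ((\<nu> - \<nu>0) * t) * poly ((T (\<nu> - \<nu>0) ^^ Suc k) (p \<nu>)) t)) (at t)"
      unfolding Suc.IH .
    then show ?case by (rule DERIV_unique) (rule DERIV_const)
  qed
  define k where "k = Suc (degree (p \<nu>0))"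
  have "(T 0 ^^ m) q = (pderiv ^^ m) q" for m q by (induction m) (simp_all add: T_def)
  moreover have "(pderiv ^^ k) (p \<nu>0) = 0"
  proof -
    have "(pderiv ^^ Suc (degree q)) q = 0" for q :: "complex poly"
    proof (induction "degree q" arbitrary: q rule: less_induct)
      case less
      show ?case
      proof (cases "degree q = 0")
        case True
        then show ?thesis by (simp add: pderiv_eq_0_iff)
      next
        case False
        have d: "degree (pderiv q) = degree q - 1" by (rule degree_pderiv)
        then have "(pderiv ^^ Suc (degree (pderiv q))) (pderiv q) = 0" by (intro less) (use False in simp)
        then show ?thesis using False unfolding d by (simp add: funpow_swap1)
      qed
    qed
    then show ?thesis by (simp add: k_def)
  qed
  ultimately have z0: "(T (\<nu>0 - \<nu>0) ^^ k) (p \<nu>0) = 0" by simp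
  have "(\<Sum>\<nu>\<in>S. exp (\<nu> * t) * poly ((T (\<nu> - \<nu>0) ^^ k) (p \<nu>)) t) = 0" for t
  proof -
    have "(\<Sum>\<nu>\<in>S. exp ((\<nu> - \<nu>0) * t) * poly ((T (\<nu> - \<nu>0) ^^ k) (p \<nu>)) t) = 0"
      using der[of t k] insert.hyps z0 by simp
    moreover have "(\<Sum>\<nu>\<in>S. exp (\<nu> * t) * poly ((T (\<nu> - \<nu>0) ^^ k) (p \<nu>)) t) =
        exp (\<nu>0 * t) * (\<Sum>\<nu>\<in>S. exp ((\<nu> - \<nu>0) * t) * poly ((T (\<nu> - \<nu>0) ^^ k) (p \<nu>)) t)"
      unfolding sum_distrib_left
    proof (rule sum.cong)
      fix \<nu>
      have "exp (\<nu> * t) = exp (\<nu>0 * t) * exp ((\<nu> - \<nu>0) * t)"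
        unfolding exp_add[symmetric] by (simp add: left_diff_distrib)
      then show "exp (\<nu> * t) * poly ((T (\<nu> - \<nu>0) ^^ k) (p \<nu>)) t =
          exp (\<nu>0 * t) * (exp ((\<nu> - \<nu>0) * t) * poly ((T (\<nu> - \<nu>0) ^^ k) (p \<nu>)) t)"
        by (simp only: mult.assoc)
    qed simp
    ultimately show ?thesis by simp
  qed
  then have "\<forall>\<nu>\<in>S. (T (\<nu> - \<nu>0) ^^ k) (p \<nu>) = 0" by (rule insert.IH)
  then have S0: "\<forall>\<nu>\<in>S. p \<nu> = 0" using T_pow_inj insert.hyps(2) by (metis eq_iff_diff_eq_0)
  have "poly (p \<nu>0) t = 0" for t using insert.prems[of t] insert.hyps S0 by simp
  then have "p \<nu>0 = 0" by (simp add: poly_all_0_iff_0[symmetric])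
  then show ?case using S0 by simp
qed simp

text \<open>Keeping the argument of the exponentials apart from that of the polynomials allows one to
  scale the semisimple and the nilpotent part of a matrix independently.\<close>

definition exp_poly :: "(complex \<Rightarrow> complex \<Rightarrow> complex) \<Rightarrow> bool"
  where "exp_poly f \<longleftrightarrow>
    (\<exists>S p. finite S \<and> (\<forall>s t. f s t = (\<Sum>\<nu>\<in>S. exp (\<nu> * s) * poly (p \<nu>) t)))"

lemma exp_poly_monomial: "exp_poly (\<lambda>s t. exp (\<nu> * s) * poly q t)"
  unfolding exp_poly_def by (rule exI[of _ "{\<nu>}"], rule exI[of _ "\<lambda>_. q"]) simp

lemma exp_poly_add:
  assumes "exp_poly f" "exp_poly g" shows "exp_poly (\<lambda>s t. f s t + g s t)"
proof -
  obtain S p where f: "finite S" "\<And>s t. f s t = (\<Sum>\<nu>\<in>S. exp (\<nu> * s) * poly (p \<nu>) t)"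
    using assms(1) unfolding exp_poly_def by blast
  obtain R q where g: "finite R" "\<And>s t. g s t = (\<Sum>\<nu>\<in>R. exp (\<nu> * s) * poly (q \<nu>) t)"
    using assms(2) unfolding exp_poly_def by blast
  let ?p = "\<lambda>\<nu>. if \<nu> \<in> S then p \<nu> else 0" and ?q = "\<lambda>\<nu>. if \<nu> \<in> R then q \<nu> else 0"
  have "f s t = (\<Sum>\<nu>\<in>S \<union> R. exp (\<nu> * s) * poly (?p \<nu>) t)" for s t
    unfolding f(2) by (rule sum.mono_neutral_cong_left) (use f(1) g(1) in auto)
  moreover have "g s t = (\<Sum>\<nu>\<in>S \<union> R. exp (\<nu> * s) * poly (?q \<nu>) t)" for s t
    unfolding g(2) by (rule sum.mono_neutral_cong_left) (use f(1) g(1) in auto)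
  ultimately have eq: "f s t + g s t = (\<Sum>\<nu>\<in>S \<union> R. exp (\<nu> * s) * poly (?p \<nu> + ?q \<nu>) t)" for s t
    by (simp add: distrib_left sum.distrib del: sum.union_inter)
  show ?thesis unfolding exp_poly_def
  proof (intro exI[of _ "S \<union> R"] exI[of _ "\<lambda>\<nu>. ?p \<nu> + ?q \<nu>"] conjI allI)
    show "finite (S \<union> R)" using f(1) g(1) by simp
  qed (rule eq)
qed

lemma exp_poly_sum:
  "finite I \<Longrightarrow> (\<And>i. i \<in> I \<Longrightarrow> exp_poly (f i)) \<Longrightarrow> exp_poly (\<lambda>s t. \<Sum>i\<in>I. f i s t)"
proof (induction I rule: finite_induct)
  case empty
  then show ?case using exp_poly_monomial[of 0 0] by simp
next
  case (insert i I)
  have "exp_poly (\<lambda>s t. f i s t + (\<Sum>i\<in>I. f i s t))"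
    by (rule exp_poly_add) (use insert in auto)
  then show ?case using insert by simp
qed

lemma exp_poly_mult:
  assumes "exp_poly f" "exp_poly g" shows "exp_poly (\<lambda>s t. f s t * g s t)"
proof -
  obtain S p where f: "finite S" "\<And>s t. f s t = (\<Sum>\<nu>\<in>S. exp (\<nu> * s) * poly (p \<nu>) t)"
    using assms(1) unfolding exp_poly_def by blast
  obtain R q where g: "finite R" "\<And>s t. g s t = (\<Sum>\<nu>\<in>R. exp (\<nu> * s) * poly (q \<nu>) t)"
    using assms(2) unfolding exp_poly_def by blast
  have "exp_poly (\<lambda>s t. \<Sum>\<nu>\<in>S. \<Sum>\<xi>\<in>R. exp ((\<nu> + \<xi>) * s) * poly (p \<nu> * q \<xi>) t)"
    by (intro exp_poly_sum f(1) g(1) exp_poly_monomial)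
  moreover have "f s t * g s t = (\<Sum>\<nu>\<in>S. \<Sum>\<xi>\<in>R. exp ((\<nu> + \<xi>) * s) * poly (p \<nu> * q \<xi>) t)" for s t
    unfolding f(2) g(2) sum_product distrib_right exp_add poly_mult by (simp only: mult_ac)
  ultimately show ?thesis by simp
qed

text \<open>Independence, applied on the diagonal, kills every polynomial coefficient.\<close>

lemma exp_poly_diagonal:
  assumes "exp_poly f" "\<And>t. f t t = 0" shows "f s t = 0"
proof -
  obtain S p where f: "finite S" "\<And>s t. f s t = (\<Sum>\<nu>\<in>S. exp (\<nu> * s) * poly (p \<nu>) t)"
    using assms(1) unfolding exp_poly_def by blast
  have "\<forall>\<nu>\<in>S. p \<nu> = 0" by (rule exp_poly_independent[OF f(1)]) (use assms(2) f(2) in metis)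
  then show ?thesis by (simp add: f(2))
qed

lemma exp_poly_poly_fun:
  assumes "poly_fun F" "\<And>i. exp_poly (\<lambda>s t. x s t i)" shows "exp_poly (\<lambda>s t. F (x s t))"
  using assms(1)
proof induction
  case (const c)
  show ?case using exp_poly_monomial[of 0 "[:c:]"] by simp
qed (auto intro: assms(2) exp_poly_add exp_poly_mult)

section \<open>Semisimple parts stay in the Lie algebra\<close>

lemma mexp_scalar: "mexp (\<mu> *\<^sub>C mat 1) t = exp (\<mu> * t) *\<^sub>C mat 1"
proof (rule mexp_unique[symmetric])
  fix t
  have "mderiv (\<lambda>t. exp (\<mu> * t) *\<^sub>C (mat 1 :: 'a cmat)) ((exp (\<mu> * t) * \<mu>) *\<^sub>C mat 1) t"
    by (rule mderiv_cscale) (auto intro!: derivative_eq_intros)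
  then show "mderiv (\<lambda>t. exp (\<mu> * t) *\<^sub>C (mat 1 :: 'a cmat)) (\<mu> *\<^sub>C mat 1 ** exp (\<mu> * t) *\<^sub>C mat 1) t"
    by (simp add: matmul_ring mult.commute)
qed simp

lemma mexp_nilpotent_block:
  assumes "matpow B N ** e = 0"
  shows "(mexp B t ** e) $ i $ j = (\<Sum>k<N. (matpow B k ** e) $ i $ j / fact k * t ^ k)"
proof -
  have "matpow B k ** e = 0" if "k \<ge> N" for k
  proof -
    have "matpow B k = matpow B (k - N) ** matpow B N" using that by (simp add: matpow_add[symmetric])
    then have "matpow B k ** e = matpow B (k - N) ** (matpow B N ** e)" by (metis matrix_mul_assoc)
    then show ?thesis by (simp add: assms)
  qed
  then have "(\<lambda>k. (matpow B k ** e) $ i $ j / fact k * t ^ k) sums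
      (\<Sum>k<N. (matpow B k ** e) $ i $ j / fact k * t ^ k)"
    by (intro sums_finite) auto
  then show ?thesis using mexp_mult_right_sums sums_unique2 by blast
qed

text \<open>If a polynomial vanishes at all \<open>exp (t X)\<close>, then the independence of exponential
  polynomials allows one to replace \<open>t\<close> by two independent parameters in the semisimple and in
  the nilpotent part of \<open>X\<close>.\<close>

lemma semisimple_part_in_lie_algebra:
  assumes G: "algebraic_group G" and X: "X \<in> lie_algebra G"
  shows "(\<Sum>\<mu>\<in>cspec X. \<mu> *\<^sub>C spectral_proj X \<mu>) \<in> lie_algebra G"
proof (rule lie_algebra_curve)
  let ?N = "matdim TYPE('a)"
  define B where "B \<mu> = X - \<mu> *\<^sub>C mat 1" for \<mu>
  define \<Gamma> where "\<Gamma> s = (\<Sum>\<mu>\<in>cspec X. exp (\<mu> * s) *\<^sub>C spectral_proj X \<mu>)" for s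
  define f where "f s t = (\<Sum>\<mu>\<in>cspec X. exp (\<mu> * s) *\<^sub>C (mexp (B \<mu>) t ** spectral_proj X \<mu>))" for s t
  have diag: "f t t = mexp X t" for t
  proof -
    have "mexp X t ** spectral_proj X \<mu> = exp (\<mu> * t) *\<^sub>C (mexp (B \<mu>) t ** spectral_proj X \<mu>)" for \<mu>
    proof -
      have "mexp X t = mexp (\<mu> *\<^sub>C mat 1 + B \<mu>) t" by (simp add: B_def)
      also have "\<dots> = exp (\<mu> * t) *\<^sub>C mexp (B \<mu>) t"
        by (subst mexp_add) (simp_all add: matmul_ring mexp_scalar)
      finally show ?thesis by (simp add: matmul_ring)
    qed
    then have "f t t = (\<Sum>\<mu>\<in>cspec X. mexp X t ** spectral_proj X \<mu>)" by (simp add: f_def)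
    also have "\<dots> = mexp X t" unfolding matmul_sum_right[symmetric] spectral_proj_sum by simp
    finally show ?thesis .
  qed
  \<comment> \<open>The series for the nilpotent part on a block is a finite sum, so it is polynomial
    in its parameter.\<close>
  have ep: "exp_poly (\<lambda>s t. f s t $ i $ j)" for i j
  proof -
    define q where "q \<mu> = (\<Sum>k<?N. monom ((matpow (B \<mu>) k ** spectral_proj X \<mu>) $ i $ j / fact k) k)" for \<mu>
    have "f s t $ i $ j = (\<Sum>\<mu>\<in>cspec X. exp (\<mu> * s) * poly (q \<mu>) t)" for s t
    proof -
      have "(mexp (B \<mu>) t ** spectral_proj X \<mu>) $ i $ j = poly (q \<mu>) t" if "\<mu> \<in> cspec X" for \<mu>
        using mexp_nilpotent_block[of "B \<mu>" ?N "spectral_proj X \<mu>"] spectral_proj_nilpotent[OF that]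
        by (simp add: B_def q_def poly_sum poly_monom)
      then show ?thesis by (simp add: f_def)
    qed
    moreover have "exp_poly (\<lambda>s t. \<Sum>\<mu>\<in>cspec X. exp (\<mu> * s) * poly (q \<mu>) t)"
      by (intro exp_poly_sum cspec_finite_card exp_poly_monomial)
    ultimately show ?thesis by simp
  qed
  have f0: "f s 0 = \<Gamma> s" for s by (simp add: f_def \<Gamma>_def)
  show "\<Gamma> 0 = mat 1" by (simp add: \<Gamma>_def spectral_proj_sum)
  show "mderiv \<Gamma> (\<Sum>\<mu>\<in>cspec X. \<mu> *\<^sub>C spectral_proj X \<mu>) 0"
    unfolding mderiv_def \<Gamma>_def by (auto intro!: derivative_eq_intros sum.cong)
  fix F s assume F: "poly_fun F" "\<And>g. g \<in> G \<Longrightarrow> F (entries g) = 0"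
  have "exp_poly (\<lambda>s t. F (entries (f s t)))"
    by (rule exp_poly_poly_fun[OF F(1)]) (auto simp: entries_def ep split: prod.split)
  moreover have "F (entries (f t t)) = 0" for t using F(2) mexp_in_group[OF G X] by (simp add: diag)
  ultimately have "F (entries (f s 0)) = 0" by (rule exp_poly_diagonal)
  then show "F (entries (\<Gamma> s)) = 0" by (simp add: f0)
qed

section \<open>Cartan subspaces and their limits\<close>

text \<open>A relation between the iterates loses its lowest term when a high power of \<open>f\<close> is applied to it.\<close>

lemma iterates_independent:
  fixes f :: "'a::real_vector \<Rightarrow> 'a"
  assumes f: "linear f" and "(f ^^ Suc n) v = 0" "(f ^^ n) v \<noteq> 0"
    and "(\<Sum>i\<le>n. c i *\<^sub>R (f ^^ i) v) = 0"
  shows "\<forall>i\<le>n. c i = 0"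
  using assms(2-)
proof (induction n arbitrary: v c)
  case (Suc n)
  have lin: "linear (f ^^ k)" for k
  proof (induction k)
    case (Suc k)
    then show ?case using linear_compose[OF Suc f] by (simp add: o_def)
  qed (simp add: linear_id[unfolded id_def])
  have zero: "(f ^^ j) v = 0" if "j \<ge> Suc (Suc n)" for j
  proof -
    define m where "m = j - Suc (Suc n)"
    have "j = m + Suc (Suc n)" using that by (simp add: m_def)
    then have "(f ^^ j) v = (f ^^ m) ((f ^^ Suc (Suc n)) v)" by (simp only: funpow_add o_apply)
    then show ?thesis using Suc.prems(1) linear_0[OF lin] by simp
  qed
  have split: "(\<Sum>i\<le>Suc n. c i *\<^sub>R (f ^^ i) v) = c 0 *\<^sub>R v + (\<Sum>i\<le>n. c (Suc i) *\<^sub>R (f ^^ i) (f v))"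
    by (simp add: sum.atMost_Suc_shift funpow_swap1 del: sum.atMost_Suc)
  have "(f ^^ Suc n) ((f ^^ i) (f v)) = 0" for i
    using zero[of "Suc n + Suc i"] by (simp add: funpow_add funpow_swap1)
  then have "(f ^^ Suc n) (\<Sum>i\<le>n. c (Suc i) *\<^sub>R (f ^^ i) (f v)) = 0"
    by (simp only: linear_sum[OF lin] linear_scale[OF lin]) simp
  moreover have "(f ^^ Suc n) (c 0 *\<^sub>R v + (\<Sum>i\<le>n. c (Suc i) *\<^sub>R (f ^^ i) (f v))) = 0"
    unfolding split[symmetric] Suc.prems(3) by (rule linear_0[OF lin])
  ultimately have "c 0 *\<^sub>R (f ^^ Suc n) v = 0"
    by (simp only: linear_add[OF lin] linear_scale[OF lin]) simp
  then have c0: "c 0 = 0" using Suc.prems(2) by simp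
  have "\<forall>i\<le>n. c (Suc i) = 0"
  proof (rule Suc.IH[of "f v"])
    show "(f ^^ Suc n) (f v) = 0" "(f ^^ n) (f v) \<noteq> 0"
      using Suc.prems(1,2) by (simp_all add: funpow_swap1)
    show "(\<Sum>i\<le>n. c (Suc i) *\<^sub>R (f ^^ i) (f v)) = 0" using Suc.prems(3) split c0 by simp
  qed
  then show ?case using c0 by (metis Suc_le_mono not0_implies_Suc)
qed simp

lemma funpow_zero_DIM:
  fixes f :: "'a::euclidean_space \<Rightarrow> 'a"
  assumes f: "linear f" and k: "(f ^^ k) v = 0" shows "(f ^^ DIM('a)) v = 0"
proof (rule ccontr)
  assume nz: "(f ^^ DIM('a)) v \<noteq> 0"
  have f0: "f 0 = 0" by (rule linear_0[OF f])
  have up: "(f ^^ (i + j)) v = 0" if "(f ^^ i) v = 0" for i j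
    using that by (induction j) (simp_all add: f0)
  define n where "n = (LEAST m. (f ^^ Suc m) v = 0)"
  have "k \<noteq> 0" using k up[of 0 "DIM('a)"] nz by (cases k) auto
  then have ex: "(f ^^ Suc (k - 1)) v = 0" using k by simp
  have n1: "(f ^^ Suc n) v = 0" unfolding n_def by (rule LeastI[of _ "k - 1"]) (rule ex)
  have big: "DIM('a) \<le> n" using up[OF n1, of "DIM('a) - Suc n"] nz by (cases "DIM('a) \<le> n") auto
  have n2: "(f ^^ n) v \<noteq> 0"
  proof (cases n)
    case 0
    then show ?thesis using big by (simp add: DIM_positive)
  next
    case (Suc m)
    then have "m < (LEAST m. (f ^^ Suc m) v = 0)" by (simp add: n_def)
    then show ?thesis using not_less_Least Suc by blast
  qed
  obtain c where c: "\<exists>i\<le>DIM('a). c i \<noteq> 0" "(\<Sum>i\<le>DIM('a). c i *\<^sub>R (f ^^ i) v) = 0"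
    using exists_linear_relation[of "\<lambda>i. (f ^^ i) v"] by blast
  define c' where "c' i = (if i \<le> DIM('a) then c i else 0)" for i
  have "(\<Sum>i\<le>n. c' i *\<^sub>R (f ^^ i) v) = (\<Sum>i\<le>DIM('a). c' i *\<^sub>R (f ^^ i) v)"
    by (rule sum.mono_neutral_right) (use big in \<open>auto simp: c'_def\<close>)
  also have "\<dots> = 0" using c(2) by (simp add: c'_def)
  finally have "\<forall>i\<le>n. c' i = 0" by (rule iterates_independent[OF f n1 n2])
  then have "\<forall>i\<le>DIM('a). c i = 0" using big unfolding c'_def by (meson le_trans)
  then show False using c(1) by blast
qed

text \<open>The order of nilpotency may depend on the Cartan subspace; a uniform exponent is what turns nilpotency
  into one polynomial condition, which then extends to the closure.\<close>

lemma bracket_power_uniform: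
  fixes X :: "'n::finite cmat"
  assumes "(bracket X ^^ k) Y = 0" shows "(bracket X ^^ matdim TYPE('n)) Y = 0"
  unfolding matdim_def
proof (rule funpow_zero_DIM[OF _ assms])
  show "linear (bracket X)"
    by (rule linearI) (simp_all add: bracket_simps cscale_of_real[symmetric])
qed

lemma cartan_subalgebra_bracket_power:
  fixes X :: "'n::finite cmat"
  assumes "cartan_subalgebra \<hh> \<gg>" "X \<in> \<hh>" "Y \<in> \<hh>"
  shows "(bracket X ^^ matdim TYPE('n)) Y = 0"
proof -
  have mem: "(bracket X ^^ k) Y \<in> lower_central_series \<hh> k" for k
  proof (induction k)
    case (Suc k)
    then show ?case using assms(2) by (auto intro!: cmat.span_base)
  qed (simp add: assms(3))
  obtain k where "lower_central_series \<hh> k = {0}"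
    using assms(1) unfolding cartan_subalgebra_def nilpotent_lie_algebra_def by blast
  then have "(bracket X ^^ k) Y = 0" using mem[of k] by simp
  then show ?thesis by (rule bracket_power_uniform)
qed

lemma reductions_ad_nilpotent:
  assumes "U \<in> variety_of_reductions G \<theta>" shows "ad_nilpotent_on U"
  unfolding ad_nilpotent_on_def
proof (intro ballI)
  fix X Y assume XY: "X \<in> U" "Y \<in> U"
  have "(bracket X ^^ matdim TYPE('a)) Y = 0"
  proof (rule closure_bracket_power_zero[OF _ _ XY])
    show "U \<in> pair_grassmannian G \<theta> closure_of {\<aa>. cartan_subspace G \<theta> \<aa>}"
      using assms by (simp add: variety_of_reductions_def)
    fix \<aa> A B assume "\<aa> \<in> {\<aa>. cartan_subspace G \<theta> \<aa>}" "A \<in> \<aa>" "B \<in> \<aa>"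
    then obtain \<hh> where "cartan_subalgebra \<hh> (lie_algebra G)" "A \<in> \<hh>" "B \<in> \<hh>"
      unfolding cartan_subspace_def pre_cartan_subspace_def by blast
    then show "(bracket A ^^ matdim TYPE('a)) B = 0" by (rule cartan_subalgebra_bracket_power)
  qed
  then show "\<exists>k. (bracket X ^^ k) Y = 0" by blast
qed

section \<open>Spectral projections along a closed orbit\<close>

context symmetric_pair
begin

lemma reductions_Gr: "U \<in> variety_of_reductions G \<theta> \<Longrightarrow> U \<in> Gr (pair_rank G \<theta>) (sym_p G \<theta>)"
  unfolding variety_of_reductions_def
  using closure_of_subset_topspace[of "pair_grassmannian G \<theta>"] topspace_grassmannian by blast

lemma symK_invertible: "k \<in> symK G \<theta> \<Longrightarrow> invertible k"
  using symK_subset group_GL_mem(3)[OF sub] by blast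

text \<open>Suppose that the projections \<open>k e k\<^sup>-\<^sup>1\<close> are unbounded along a sequence of translates of \<open>U\<close>.  The
  translates accumulate at a point \<open>U'\<close> of the orbit, and a generic element of \<open>U'\<close> is a limit of elements
  of the translates, which become generic as well.  Their projections stay bounded, but they are those of
  the translates.\<close>

lemma orbit_spectral_proj_bounded:
  assumes U: "U \<in> variety_of_reductions G \<theta>"
    and clo: "closedin (subtopology (pair_grassmannian G \<theta>) (variety_of_reductions G \<theta>)) (K_orbit G \<theta> U)"
    and X: "generic_in U X" and mu: "\<mu> \<in> cspec X"
  shows "bounded ((\<lambda>k. Ad k (spectral_proj X \<mu>)) ` symK G \<theta>)"
proof (rule ccontr)
  assume nb: "\<not> bounded ((\<lambda>k. Ad k (spectral_proj X \<mu>)) ` symK G \<theta>)"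
  have "\<exists>k\<in>symK G \<theta>. real n < norm (Ad k (spectral_proj X \<mu>))" for n
    using nb unfolding bounded_iff by (auto simp: not_le)
  then obtain k where k: "\<And>n. k n \<in> symK G \<theta>" "\<And>n. real n < norm (Ad (k n) (spectral_proj X \<mu>))"
    by metis
  have "closedin (pair_grassmannian G \<theta>) (variety_of_reductions G \<theta>)"
    unfolding variety_of_reductions_def by (rule closedin_closure_of)
  then have clo': "closedin (pair_grassmannian G \<theta>) (K_orbit G \<theta> U)"
    using clo by (rule closedin_trans_full[rotated])
  have orb: "Ad (k n) ` U \<in> K_orbit G \<theta> U" for n using k(1) by (auto simp: K_orbit_def)
  obtain \<sigma> U' where s: "strict_mono \<sigma>" "U' \<in> K_orbit G \<theta> U"
    "\<forall>X'\<in>U'. \<exists>Z. (\<forall>n. Z n \<in> Ad (k (\<sigma> n)) ` U) \<and> Z \<longlonglongrightarrow> X'"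
    using closedin_grassmannian_compact[where U = "\<lambda>n. Ad (k n) ` U", OF clo' subspace_p orb] by blast
  obtain k' where k': "k' \<in> symK G \<theta>" "U' = Ad k' ` U" using s(2) by (auto simp: K_orbit_def)
  have XU: "X \<in> U" using X by (simp add: generic_in_def)
  then have "Ad k' X \<in> U'" by (simp add: k'(2))
  then obtain Z where Z: "\<And>n. Z n \<in> Ad (k (\<sigma> n)) ` U" "Z \<longlonglongrightarrow> Ad k' X"
    using s(3) by blast
  note inv = symK_invertible[OF k(1)]
  have cX: "cspec (Ad k' X) = cspec X" by (rule cspec_Ad[OF symK_invertible[OF k'(1)]])
  have gen: "generic_in (Ad (k n) ` U) (Ad (k n) X)" for n by (rule generic_Ad[OF inv X])
  have "card (cspec (Z n)) \<le> card (cspec (Ad k' X))" for n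
  proof -
    obtain W where "W \<in> U" "Z n = Ad (k (\<sigma> n)) W" using Z(1) by blast
    then show ?thesis using X by (simp add: generic_in_def cX cspec_Ad[OF inv])
  qed
  then obtain \<rho> B where rho: "strict_mono (\<rho> :: nat \<Rightarrow> nat)"
    "\<And>n. card (cspec (Z (\<rho> n))) = card (cspec (Ad k' X))"
    "\<And>n \<nu>. \<nu> \<in> cspec (Z (\<rho> n)) \<Longrightarrow> norm (spectral_proj (Z (\<rho> n)) \<nu>) \<le> B"
    using spectral_proj_bounded_along_subsequence[OF Z(2)] by blast
  have "norm (Ad (k (\<sigma> (\<rho> n))) (spectral_proj X \<mu>)) \<le> B" for n
  proof -
    let ?k = "k (\<sigma> (\<rho> n))"
    have "cmat.subspace U" using reductions_Gr[OF U] by (simp add: Gr_def)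
    then have S: "cmat.subspace (Ad ?k ` U)" by (rule subspace_Ad[OF inv])
    have A: "ad_nilpotent_on (Ad ?k ` U)"
      by (rule ad_nilpotent_on_Ad[OF inv reductions_ad_nilpotent[OF U]])
    have gZ: "generic_in (Ad ?k ` U) (Z (\<rho> n))"
      using gen[of "\<sigma> (\<rho> n)"] Z(1)[of "\<rho> n"] rho(2)[of n]
      by (simp add: generic_in_def cX cspec_Ad[OF inv])
    have "\<mu> \<in> cspec (Ad ?k X)" using mu by (simp add: cspec_Ad[OF inv])
    then obtain \<nu> where "\<nu> \<in> cspec (Z (\<rho> n))" "spectral_proj (Ad ?k X) \<mu> = spectral_proj (Z (\<rho> n)) \<nu>"
      using generic_spectral_proj_eq[OF S A gen gZ] by blast
    then show ?thesis using rho(3) by (simp add: spectral_proj_Ad[OF inv, symmetric])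
  qed
  then have le: "real (\<sigma> (\<rho> n)) \<le> B" for n using k(2) by (meson less_imp_le order_trans)
  have "n \<le> \<sigma> (\<rho> n)" for n
    using seq_suble[OF s(1)] seq_suble[OF rho(1)] le_trans by blast
  then have "real n \<le> B" for n using le[of n] by (meson of_nat_le_iff order_trans)
  then show False using reals_Archimedean2[of B] by (meson not_le)
qed

text \<open>Liouville's theorem on the one-parameter group generated by \<open>Y\<close>.\<close>

lemma bounded_orbit_fixed:
  assumes Y: "Y \<in> \<kk>" and bd: "bounded ((\<lambda>k. Ad k E) ` symK G \<theta>)"
  shows "bracket Y E = 0"
proof -
  define Z where "Z t = Ad (mexp Y t) E" for t
  have Z: "Z t = mexp Y t ** E ** mexp Y (- t)" for t
    by (simp add: Z_def Ad_def matrix_inv_mexp)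
  have diff: "\<exists>Z'. mderiv Z Z' t" for t
    unfolding Z using mderiv_mult[OF mderiv_mult_const(2)[OF mexp_deriv] mexp_neg_deriv] by blast
  obtain B where B: "\<And>t. norm (Z t) \<le> B"
    using bd mexp_in_symK[OF Y] unfolding bounded_iff Z_def by blast
  have "bracket Y E $ i $ j = 0" for i j
  proof -
    have "\<exists>f'. ((\<lambda>t. Z t $ i $ j) has_field_derivative f') (at t)" for t
      using diff[of t] unfolding mderiv_def by blast
    then have "(\<lambda>t. Z t $ i $ j) holomorphic_on UNIV"
      by (simp add: holomorphic_on_def field_differentiable_def)
    moreover have "bounded (range (\<lambda>t. Z t $ i $ j))"
    proof (rule boundedI)
      fix z assume "z \<in> range (\<lambda>t. Z t $ i $ j)"
      then obtain t where "z = Z t $ i $ j" by blast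
      then show "norm z \<le> B"
        using Finite_Cartesian_Product.norm_nth_le[of "Z t $ i" j]
          Finite_Cartesian_Product.norm_nth_le[of "Z t" i] B[of t] by simp
    qed
    ultimately have "(\<lambda>t. Z t $ i $ j) constant_on UNIV" by (rule Liouville_theorem)
    then obtain c where c: "\<And>t. Z t $ i $ j = c" unfolding constant_on_def by blast
    have "((\<lambda>t. Z t $ i $ j) has_field_derivative bracket Y E $ i $ j) (at 0)"
      using Ad_mexp_deriv[of Y E] unfolding mderiv_def Z_def by blast
    then have "((\<lambda>t. c) has_field_derivative bracket Y E $ i $ j) (at 0)" unfolding c .
    then show ?thesis by (rule DERIV_unique) (rule DERIV_const)
  qed
  then show ?thesis by (simp add: vec_eq_iff)
qed

lemma generic_cspec:
  assumes ss: "semisimple_group G" and U: "U \<in> variety_of_reductions G \<theta>"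
    and clo: "closedin (subtopology (pair_grassmannian G \<theta>) (variety_of_reductions G \<theta>)) (K_orbit G \<theta> U)"
    and X: "generic_in U X"
  shows "cspec X = {0}"
proof -
  have Xp: "X \<in> sym_p G \<theta>"
    using X reductions_Gr[OF U] by (auto simp: generic_in_def Gr_def)
  then have Xg: "X \<in> \<gg>" by (simp add: sym_p_def)
  have comm: "spectral_proj X \<mu> ** Y = Y ** spectral_proj X \<mu>" if mu: "\<mu> \<in> cspec X" and Y: "Y \<in> \<gg>" for \<mu> Y
  proof -
    have k: "spectral_proj X \<mu> ** A = A ** spectral_proj X \<mu>" if "A \<in> \<kk>" for A
      using bounded_orbit_fixed[OF that orbit_spectral_proj_bounded[OF U clo X mu]]
      by (simp add: bracket_zero_iff)
    have p: "spectral_proj X \<mu> ** B = B ** spectral_proj X \<mu>" if B: "B \<in> sym_p G \<theta>" for B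
    proof (rule idempotent_commutant[of _ X])
      show "spectral_proj X \<mu> ** spectral_proj X \<mu> = spectral_proj X \<mu>" by (rule spectral_proj_idem[OF mu])
      show "spectral_proj X \<mu> ** C = C ** spectral_proj X \<mu>" if "X ** C = C ** X" for C
        by (rule spectral_proj_commute[OF that])
      show "bracket (spectral_proj X \<mu>) (bracket X B) = 0"
        unfolding bracket_zero_iff by (rule k[OF bracket_p_p[OF Xp B]])
    qed
    obtain A B where AB: "A \<in> \<kk>" "B \<in> sym_p G \<theta>" "Y = A + B" using decomposition[OF Y] by blast
    show ?thesis unfolding AB(3) matmul_ring k[OF AB(1)] p[OF AB(2)] ..
  qed
  let ?S = "\<Sum>\<mu>\<in>cspec X. \<mu> *\<^sub>C spectral_proj X \<mu>"
  have "?S = 0"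
  proof (rule semisimple_center_trivial[OF ss semisimple_part_in_lie_algebra[OF alg Xg]])
    fix Y assume Y: "Y \<in> \<gg>"
    show "?S ** Y = Y ** ?S"
      unfolding matmul_sum_left matmul_sum_right matmul_ring
      by (rule sum.cong) (simp_all only: comm[OF _ Y])
  qed
  have "\<mu> = 0" if mu: "\<mu> \<in> cspec X" for \<mu>
  proof -
    have "?S ** spectral_proj X \<mu> = (\<Sum>\<nu>\<in>cspec X. if \<nu> = \<mu> then \<mu> *\<^sub>C spectral_proj X \<mu> else 0)"
      unfolding matmul_sum_left
      by (rule sum.cong) (auto simp: matmul_ring spectral_proj_idem[OF mu] spectral_proj_orthogonal)
    also have "\<dots> = \<mu> *\<^sub>C spectral_proj X \<mu>" using mu cspec_finite_card(1)[of X] by simp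
    finally have "\<mu> *\<^sub>C spectral_proj X \<mu> = 0" using \<open>?S = 0\<close> by simp
    then show ?thesis using spectral_proj_nonzero[OF mu] by (simp add: cmat.scale_eq_0_iff)
  qed
  then show ?thesis using cspec_nonempty[of X] by blast
qed

end

lemma nilpotent_of_cspec:
  assumes "cspec (X :: 'n::finite cmat) = {0}" shows "nilpotent_mat X"
proof -
  have "spectral_proj X 0 = mat 1" using spectral_proj_sum[of X] assms by simp
  then have "matpow X (matdim TYPE('n)) = 0" using spectral_proj_nilpotent[of 0 X] assms by simp
  then show ?thesis unfolding nilpotent_mat_iff by blast
qed

theorem proposition5p3:
  fixes G :: "(complex ^ 'n::finite ^ 'n) set"
    and \<theta> :: "complex ^ 'n ^ 'n \<Rightarrow> complex ^ 'n ^ 'n"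
  assumes "reductive_symmetric_pair G \<theta>"
    and "semisimple_group G"
    and "closed_K_orbit G \<theta> \<O>"
    and "\<uu> \<in> \<O>"
  shows "\<uu> \<subseteq> nilpotent_cone (lie_algebra G)"
proof -
  interpret symmetric_pair G \<theta>
    using assms(1) by unfold_locales
      (auto simp: reductive_symmetric_pair_def reductive_group_def)
  obtain U where U: "U \<in> variety_of_reductions G \<theta>" and O: "\<O> = K_orbit G \<theta> U"
    and clo: "closedin (subtopology (pair_grassmannian G \<theta>) (variety_of_reductions G \<theta>)) (K_orbit G \<theta> U)"
    using assms(3) unfolding closed_K_orbit_def by blast
  have Up: "cmat.subspace U" "U \<subseteq> sym_p G \<theta>" using reductions_Gr[OF U] by (auto simp: Gr_def)
  have "U \<noteq> {}" using cmat.subspace_0[OF Up(1)] by blast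
  then obtain X0 where X0: "generic_in U X0" using exists_generic by blast
  have spec: "cspec X = {0}" if X: "X \<in> U" for X
  proof (rule generic_cspec[OF assms(2) U clo])
    have "card (cspec X0) = 1" using generic_cspec[OF assms(2) U clo X0] by simp
    then have "card (cspec Z) \<le> 1" if "Z \<in> U" for Z using X0 that by (simp add: generic_in_def)
    moreover have "1 \<le> card (cspec X)"
      using cspec_nonempty[of X] cspec_finite_card(1)[of X] by (simp add: card_gt_0_iff Suc_le_eq)
    ultimately show "generic_in U X" using X unfolding generic_in_def by (meson le_trans)
  qed
  obtain k where k: "k \<in> symK G \<theta>" "\<uu> = Ad k ` U"
    using assms(4) unfolding O K_orbit_def by blast
  show ?thesis
  proof
    fix A assume "A \<in> \<uu>"
    then obtain X where X: "X \<in> U" "A = Ad k X" using k(2) by blast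
    have "X \<in> lie_algebra G" using X(1) Up(2) by (auto simp: sym_p_def)
    then have "A \<in> lie_algebra G"
      unfolding X(2) using k(1) symK_subset by (intro lie_algebra_Ad[OF alg]) auto
    moreover have "nilpotent_mat A"
      by (rule nilpotent_of_cspec) (simp add: X(2) cspec_Ad[OF symK_invertible[OF k(1)]] spec[OF X(1)])
    ultimately show "A \<in> nilpotent_cone (lie_algebra G)" by (simp add: nilpotent_cone_def)
  qed
qed

end
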